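(* For all $\hat u_{1,h}=(u_1^-,u_1^\Gamma)\in V_1^-\times V_1^\Gamma$ the uniform norm equivalences $$\|\hat u_{1,h}\|_{b,\mathrm{FD}}^2\sim\|(u_1^-,0)\|_{b,\mathrm{FD}}^2+\|(0,u_1^\Gamma)\|_{b,\mathrm{FD}}^2,\qquad \|\hat u_{1,h}\|_{a,\mathrm{FD}}^2\sim\|(u_1^-,0)\|_{a,\mathrm{FD}}^2+\|(0,u_1^\Gamma)\|_{a,\mathrm{FD}}^2$$ hold, with constants independent of $\hat u_{1,h}$, of $h$ and of the location of $\Gamma$ in the triangulation.
   Context: Geometry and mesh. $d\in\{2,3\}$, $k\ge1$; $\Omega\subset\mathbb{R}^d$ is a bounded connected polygonal domain, $\Omega_1\subset\Omega$ a subdomain with (smooth) boundary $\Gamma=\partial\Omega_1$, outward unit normal $\mathbf{n}_\Gamma$, and $\Omega_2=\Omega\setminus\overline{\Omega}_1$. $\{\mathcal{T}_h\}_{h>0}$ is a family of shape regular (not necessarily quasi-uniform) simplicial triangulations of $\Omega$, not fitted to $\Gamma$; $h_T$ is the diameter of $T\in\mathcal{T}_h$. $V_h$ is the space of continuous piecewise polynomials of degree $\le k$ on $\mathcal{T}_h$ vanishing on $\partial\Omega$. $\mathcal{T}_h^\Gamma$ is the set of simplices cut by $\Gamma$ and $\Omega_h^\Gamma$ the domain they form; $\Omega_{1,h}^{\rm ex}$ is the domain formed by all simplices with nonzero intersection with $\Omega_1$. The fictitious domain space is $V_h^{\rm FD}=V_{1,h}=\{(v_h)_{|\Omega_{1,h}^{\rm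 ex}}: v_h\in V_h\}$. Norms. $\|\cdot\|_\omega$ and $(\cdot,\cdot)_\omega$ denote the $L^2$ norm and scalar product on $\omega$; $(h^{-1}u,v)_\Gamma=\sum_{T\in\mathcal{T}_h^\Gamma}h_T^{-1}(u,v)_{T\cap\Gamma}$ and $\|h^{-1/2}v\|_\Gamma^2=(h^{-1}v,v)_\Gamma$. $A\sim B$ means $c_1B\le A\le c_2B$ with constants $c_1,c_2>0$ independent of $h$ and of the location of $\Gamma$ in the triangulation (they may depend on shape regularity, $d$, $k$, the smoothness of $\Gamma$, $\gamma$, $\beta$). Splitting. $\phi_j$, $j\in I_0$, are the nodal basis functions of $V_h$; $I_1\subset I_0$ are the labels of nodes in $\Omega_{1,h}^{\rm ex}$, $I^\Gamma\subset I_0$ those of nodes in $\Omega_h^\Gamma$, and $I_1^\Gamma=\{j\in I^\Gamma:\text{node }j\text{ is not in }\Omega_1\}$. It is assumed that no nodes lie on $\Gamma$. $\phi_j^\Gamma=\phi_j|_{\Omega_h^\Gamma}$ for $j\in I^\Gamma$. $V_1^-=\mathrm{span}\{\phi_j\}_{j\in I_1\setminus I_1^\Gamma}$ and $V_1^\Gamma=\mathrm{span}\{\phi_j^\Gamma\}_{j\in I_1^\Gamma}$ (functions in $V_1^\Gamma$ extended by zero to $\Omega_{1,h}^{\rm ex}$). The isomorphism $L_1:V_1^-\times V_1^\Gamma\to V_h^{\rm FD}$ is $L_1(u_1^-,u_1^\Gamma)=u_1^-+u_1^\Gamma=:u_{1,h}$. Bilinear form and norms. With fixed parameters $\gamma,\beta>0$,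 a suitable subset $\mathcal{F}_{g,1}$ of faces in $\Omega_h^\Gamma$ (face diameters $h_F$) and $[\![\cdot]\!]$ the jump across a face, $$A_h^{\rm FD}(u,v)=(\nabla u,\nabla v)_{\Omega_1}-(\mathbf{n}_\Gamma\cdot\nabla u,v)_\Gamma-(u,\mathbf{n}_\Gamma\cdot\nabla v)_\Gamma+\gamma(h^{-1}u,v)_\Gamma+\beta\sum_{\ell=1}^k\sum_{F\in\mathcal{F}_{g,1}}h_F^{2\ell-1}([\![\partial_n^\ell u]\!],[\![\partial_n^\ell v]\!])_F .$$ On $V_1^-\times V_1^\Gamma$ define $\|\hat u_{1,h}\|_{a,\mathrm{FD}}^2=A_h^{\rm FD}(L_1\hat u_{1,h},L_1\hat u_{1,h})$ and $$\|\hat u_{1,h}\|_{b,\mathrm{FD}}^2=\|\nabla(u_1^-+u_1^\Gamma)\|_{\Omega_{1,h}^{\rm ex}}^2+\gamma\|h^{-1/2}(u_1^-+u_1^\Gamma)\|_\Gamma^2 .$$ The parameter $\gamma$ is sufficiently large and the ghost-penalty stabilization is such that the norm equivalence known from the literature, $A_h^{\rm FD}(u_{1,h},u_{1,h})\sim\|\hat u_{1,h}\|_{b,\mathrm{FD}}^2$ for all $u_{1,h}=L_1\hat u_{1,h}\in V_h^{\rm FD}$, holds. *)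

theory Defs
  imports "HOL-Analysis.Analysis"
begin

text \<open>The condition \<open>\<Omega> = interior (closure \<Omega>)\<close> excludes slits, so that \<open>\<Omega>\<close> is determined by
  the closed region that is triangulated.\<close>

definition polygonal_domain :: "'a::euclidean_space set \<Rightarrow> bool" where
  "polygonal_domain \<Omega> \<longleftrightarrow> \<Omega> \<noteq> {} \<and> connected \<Omega> \<and> bounded \<Omega> \<and> \<Omega> = interior (closure \<Omega>) \<and>
     (\<exists>\<P>. finite \<P> \<and> (\<forall>P\<in>\<P>. polytope P) \<and> closure \<Omega> = \<Union>\<P>)"

text \<open>One-sided derivatives: on a full-dimensional simplex \<open>T\<close> the derivative within \<open>T\<close> is unique
  at every point of \<open>T\<close>, boundary points included, so for a function that is polynomial on \<open>T\<close> the
  following are the derivatives of that polynomial.\<close>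

definition grad_within :: "'a::euclidean_space set \<Rightarrow> ('a \<Rightarrow> real) \<Rightarrow> 'a \<Rightarrow> 'a" where
  "grad_within T f x = (\<Sum>b\<in>Basis. frechet_derivative f (at x within T) b *\<^sub>R b)"

definition dir_deriv_within :: "'a::euclidean_space set \<Rightarrow> 'a \<Rightarrow> ('a \<Rightarrow> real) \<Rightarrow> 'a \<Rightarrow> real" where
  "dir_deriv_within T n f x = frechet_derivative f (at x within T) n"

primrec C_k_on :: "nat \<Rightarrow> 'a::euclidean_space set \<Rightarrow> ('a \<Rightarrow> real) \<Rightarrow> bool" where
  "C_k_on 0 U f \<longleftrightarrow> continuous_on U f"
| "C_k_on (Suc m) U f \<longleftrightarrow> (\<forall>x\<in>U. f differentiable (at x)) \<and>
     (\<forall>b\<in>Basis. C_k_on m U (\<lambda>x. frechet_derivative f (at x) b))"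

definition smooth_defining_function ::
    "'a::euclidean_space set \<Rightarrow> 'a set \<Rightarrow> ('a \<Rightarrow> real) \<Rightarrow> bool" where
  "smooth_defining_function D U \<psi> \<longleftrightarrow> open U \<and> (\<forall>m. C_k_on m U \<psi>) \<and>
     (\<forall>x\<in>U. grad_within UNIV \<psi> x \<noteq> 0) \<and> D \<inter> U = {x\<in>U. \<psi> x < 0}"

definition smooth_boundary :: "'a::euclidean_space set \<Rightarrow> bool" where
  "smooth_boundary D \<longleftrightarrow> (\<forall>p\<in>frontier D. \<exists>U \<psi>. p \<in> U \<and> smooth_defining_function D U \<psi>)"

definition outward_normal :: "'a::euclidean_space set \<Rightarrow> 'a \<Rightarrow> 'a" where
  "outward_normal D x = (THE n. \<exists>U \<psi>. x \<in> U \<and> smooth_defining_function D U \<psi> \<and>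
     n = sgn (grad_within UNIV \<psi> x))"

definition congruent_sets :: "'a::euclidean_space set \<Rightarrow> 'a set \<Rightarrow> bool" where
  "congruent_sets A B \<longleftrightarrow> (\<exists>f c. orthogonal_transformation f \<and> B = (\<lambda>x. c + f x) ` A)"

text \<open>The \<open>m\<close>-dimensional Hausdorff measure, normalised such that it is the usual surface measure on
  smooth \<open>m\<close>-dimensional submanifolds. The covering sets must be bounded because \<^const>\<open>diameter\<close> has
  no meaning on unbounded sets.\<close>

definition hausdorff_pre :: "nat \<Rightarrow> real \<Rightarrow> 'a::euclidean_space set \<Rightarrow> ennreal" where
  "hausdorff_pre m \<delta> A =
     (INF C \<in> {C :: nat \<Rightarrow> 'a set. A \<subseteq> (\<Union>i. C i) \<and> (\<forall>i. bounded (C i) \<and> diameter (C i) \<le> \<delta>)}.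
        \<Sum>i. ennreal (unit_ball_vol (real m) * (diameter (C i) / 2) ^ m))"

definition hausdorff_measure :: "nat \<Rightarrow> 'a::euclidean_space measure" where
  "hausdorff_measure m =
     measure_of UNIV (sets borel) (\<lambda>A. SUP \<delta> \<in> {0<..}. hausdorff_pre m \<delta> A)"

definition surface_measure :: "'a::euclidean_space measure" where
  "surface_measure = hausdorff_measure (DIM('a) - 1)"

definition triangulation_of :: "'a::euclidean_space set set \<Rightarrow> 'a set \<Rightarrow> bool" where
  "triangulation_of \<T> \<Omega> \<longleftrightarrow> triangulation \<T> \<and> (\<forall>T\<in>\<T>. int DIM('a) simplex T) \<and> \<Union>\<T> = closure \<Omega>"

definition shape_regular :: "real \<Rightarrow> 'a::euclidean_space set set \<Rightarrow> bool" where
  "shape_regular \<sigma> \<T> \<longleftrightarrow> (\<forall>T\<in>\<T>. \<exists>x r. r > 0 \<and> cball x r \<subseteq> T \<and> diameter T \<le> \<sigma> * r)"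

definition polynomials :: "nat \<Rightarrow> ('a::euclidean_space \<Rightarrow> real) set" where
  "polynomials k = {p. \<exists>c. \<forall>x. p x =
     (\<Sum>\<alpha> | \<alpha> \<in> Basis \<rightarrow>\<^sub>E {..k} \<and> (\<Sum>b\<in>Basis. \<alpha> b) \<le> k. c \<alpha> * (\<Prod>b\<in>Basis. (x \<bullet> b) ^ \<alpha> b))}"

text \<open>Elements of \<open>V\<^sub>h\<close> are represented by their extension by zero to the whole space.\<close>

definition fe_space :: "nat \<Rightarrow> 'a::euclidean_space set \<Rightarrow> 'a set set \<Rightarrow> ('a \<Rightarrow> real) set" where
  "fe_space k \<Omega> \<T> = {v. continuous_on (closure \<Omega>) v \<and> (\<forall>x. x \<notin> \<Omega> \<longrightarrow> v x = 0) \<and>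
     (\<forall>T\<in>\<T>. \<exists>p\<in>polynomials k. \<forall>x\<in>T. v x = p x)}"

text \<open>The Lagrange nodes of degree \<open>k\<close> (principal lattice) of all simplices, including the nodes on
  \<open>\<partial>\<Omega>\<close>. A label \<open>j\<close> of a nodal basis function is identified with its node, hence \<open>I\<^sub>0\<close> is the set of
  nodes in \<open>\<Omega>\<close>.\<close>

definition simplex_nodes :: "nat \<Rightarrow> 'a::euclidean_space set \<Rightarrow> 'a set" where
  "simplex_nodes k T =
     {(\<Sum>v | v extreme_point_of T. (real (\<alpha> v) / real k) *\<^sub>R v) | \<alpha> :: 'a \<Rightarrow> nat.
        (\<Sum>v | v extreme_point_of T. \<alpha> v) = k}"

definition mesh_nodes :: "nat \<Rightarrow> 'a::euclidean_space set set \<Rightarrow> 'a set" where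
  "mesh_nodes k \<T> = (\<Union>T\<in>\<T>. simplex_nodes k T)"

definition I0 :: "nat \<Rightarrow> 'a::euclidean_space set \<Rightarrow> 'a set set \<Rightarrow> 'a set" where
  "I0 k \<Omega> \<T> = mesh_nodes k \<T> \<inter> \<Omega>"

definition nodal_basis :: "nat \<Rightarrow> 'a::euclidean_space set \<Rightarrow> 'a set set \<Rightarrow> 'a \<Rightarrow> ('a \<Rightarrow> real)" where
  "nodal_basis k \<Omega> \<T> j = (THE v. v \<in> fe_space k \<Omega> \<T> \<and>
     (\<forall>i\<in>I0 k \<Omega> \<T>. v i = (if i = j then 1 else 0)))"

definition cut_elements :: "'a::euclidean_space set set \<Rightarrow> 'a set \<Rightarrow> 'a set set" where
  "cut_elements \<T> \<Omega>1 = {T\<in>\<T>. interior T \<inter> frontier \<Omega>1 \<noteq> {}}"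

definition cut_region :: "'a::euclidean_space set set \<Rightarrow> 'a set \<Rightarrow> 'a set" where
  "cut_region \<T> \<Omega>1 = \<Union>(cut_elements \<T> \<Omega>1)"

definition ex_elements :: "'a::euclidean_space set set \<Rightarrow> 'a set \<Rightarrow> 'a set set" where
  "ex_elements \<T> \<Omega>1 = {T\<in>\<T>. T \<inter> \<Omega>1 \<noteq> {}}"

definition ex_region :: "'a::euclidean_space set set \<Rightarrow> 'a set \<Rightarrow> 'a set" where
  "ex_region \<T> \<Omega>1 = \<Union>(ex_elements \<T> \<Omega>1)"

definition I1 :: "nat \<Rightarrow> 'a::euclidean_space set \<Rightarrow> 'a set set \<Rightarrow> 'a set \<Rightarrow> 'a set" where
  "I1 k \<Omega> \<T> \<Omega>1 = I0 k \<Omega> \<T> \<inter> ex_region \<T> \<Omega>1"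

definition I_Gamma :: "nat \<Rightarrow> 'a::euclidean_space set \<Rightarrow> 'a set set \<Rightarrow> 'a set \<Rightarrow> 'a set" where
  "I_Gamma k \<Omega> \<T> \<Omega>1 = I0 k \<Omega> \<T> \<inter> cut_region \<T> \<Omega>1"

definition I1_Gamma :: "nat \<Rightarrow> 'a::euclidean_space set \<Rightarrow> 'a set set \<Rightarrow> 'a set \<Rightarrow> 'a set" where
  "I1_Gamma k \<Omega> \<T> \<Omega>1 = {j \<in> I_Gamma k \<Omega> \<T> \<Omega>1. j \<notin> \<Omega>1}"

definition fun_span :: "'j set \<Rightarrow> ('j \<Rightarrow> 'a \<Rightarrow> real) \<Rightarrow> ('a \<Rightarrow> real) set" where
  "fun_span J f = {\<lambda>x. \<Sum>j\<in>J. c j * f j x | c. True}"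

definition V1_minus ::
    "nat \<Rightarrow> 'a::euclidean_space set \<Rightarrow> 'a set set \<Rightarrow> 'a set \<Rightarrow> ('a \<Rightarrow> real) set" where
  "V1_minus k \<Omega> \<T> \<Omega>1 = fun_span (I1 k \<Omega> \<T> \<Omega>1 - I1_Gamma k \<Omega> \<T> \<Omega>1) (nodal_basis k \<Omega> \<T>)"

definition V1_Gamma ::
    "nat \<Rightarrow> 'a::euclidean_space set \<Rightarrow> 'a set set \<Rightarrow> 'a set \<Rightarrow> ('a \<Rightarrow> real) set" where
  "V1_Gamma k \<Omega> \<T> \<Omega>1 = fun_span (I1_Gamma k \<Omega> \<T> \<Omega>1)
     (\<lambda>j x. if x \<in> cut_region \<T> \<Omega>1 then nodal_basis k \<Omega> \<T> j x else 0)"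

definition L1 :: "('a \<Rightarrow> real) \<times> ('a \<Rightarrow> real) \<Rightarrow> 'a \<Rightarrow> real" where
  "L1 u = (\<lambda>x. fst u x + snd u x)"

text \<open>Gradients of finite element functions are discontinuous across faces; integrals over \<open>\<Omega>\<^sub>1\<close>
  and \<open>\<Gamma>\<close> are assembled simplex by simplex.\<close>

definition Gamma_weighted ::
    "'a::euclidean_space set set \<Rightarrow> 'a set \<Rightarrow> ('a \<Rightarrow> real) \<Rightarrow> ('a \<Rightarrow> real) \<Rightarrow> real" where
  "Gamma_weighted \<T> \<Omega>1 u v = (\<Sum>T\<in>cut_elements \<T> \<Omega>1.
     inverse (diameter T) * (LINT x:T \<inter> frontier \<Omega>1|surface_measure. u x * v x))"

definition Gamma_flux ::
    "'a::euclidean_space set set \<Rightarrow> 'a set \<Rightarrow> ('a \<Rightarrow> real) \<Rightarrow> ('a \<Rightarrow> real) \<Rightarrow> real" where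
  "Gamma_flux \<T> \<Omega>1 u v = (\<Sum>T\<in>cut_elements \<T> \<Omega>1.
     (LINT x:T \<inter> frontier \<Omega>1|surface_measure. (outward_normal \<Omega>1 x \<bullet> grad_within T u x) * v x))"

text \<open>Faces in \<open>\<Omega>\<^sub>h\<^sup>\<Gamma>\<close> across which jumps of functions on \<open>\<Omega>\<^sub>1\<^sub>,\<^sub>h\<^sup>e\<^sup>x\<close> are defined.\<close>

definition ghost_faces :: "'a::euclidean_space set set \<Rightarrow> 'a set \<Rightarrow> 'a set set" where
  "ghost_faces \<T> \<Omega>1 = {F. F \<subseteq> cut_region \<T> \<Omega>1 \<and>
     (\<exists>T\<in>ex_elements \<T> \<Omega>1. \<exists>T'\<in>ex_elements \<T> \<Omega>1. T \<noteq> T' \<and> F facet_of T \<and> F facet_of T')}"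

text \<open>The order of the two simplices at a face and the orientation of its normal are chosen
  arbitrarily: the products of jumps below do not depend on them.\<close>

definition face_sides :: "'a::euclidean_space set set \<Rightarrow> 'a set \<Rightarrow> 'a set \<times> 'a set" where
  "face_sides \<T> F = (SOME (T, T'). T \<in> \<T> \<and> T' \<in> \<T> \<and> T \<noteq> T' \<and> F facet_of T \<and> F facet_of T')"

definition face_normal :: "'a::euclidean_space set \<Rightarrow> 'a" where
  "face_normal F = (SOME n. norm n = 1 \<and> (\<forall>x\<in>F. \<forall>y\<in>F. n \<bullet> (x - y) = 0))"

definition normal_jump ::
    "'a::euclidean_space set set \<Rightarrow> nat \<Rightarrow> 'a set \<Rightarrow> ('a \<Rightarrow> real) \<Rightarrow> 'a \<Rightarrow> real" where
  "normal_jump \<T> l F u x =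
     (dir_deriv_within (fst (face_sides \<T> F)) (face_normal F) ^^ l) u x -
     (dir_deriv_within (snd (face_sides \<T> F)) (face_normal F) ^^ l) u x"

definition ghost_penalty ::
    "nat \<Rightarrow> 'a::euclidean_space set set \<Rightarrow> 'a set set \<Rightarrow> ('a \<Rightarrow> real) \<Rightarrow> ('a \<Rightarrow> real) \<Rightarrow> real" where
  "ghost_penalty k \<T> \<F> u v = (\<Sum>l=1..k. \<Sum>F\<in>\<F>. diameter F ^ (2 * l - 1) *
     (LINT x:F|surface_measure. normal_jump \<T> l F u x * normal_jump \<T> l F v x))"

definition A_FD :: "nat \<Rightarrow> real \<Rightarrow> real \<Rightarrow> 'a::euclidean_space set set \<Rightarrow> 'a set \<Rightarrow> 'a set set \<Rightarrow>
    ('a \<Rightarrow> real) \<Rightarrow> ('a \<Rightarrow> real) \<Rightarrow> real" where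
  "A_FD k \<gamma> \<beta> \<T> \<Omega>1 \<F> u v =
     (\<Sum>T\<in>\<T>. (LINT x:T \<inter> \<Omega>1|lborel. grad_within T u x \<bullet> grad_within T v x))
     - Gamma_flux \<T> \<Omega>1 u v - Gamma_flux \<T> \<Omega>1 v u
     + \<gamma> * Gamma_weighted \<T> \<Omega>1 u v
     + \<beta> * ghost_penalty k \<T> \<F> u v"

definition norm_a_sq :: "nat \<Rightarrow> real \<Rightarrow> real \<Rightarrow> 'a::euclidean_space set set \<Rightarrow> 'a set \<Rightarrow> 'a set set \<Rightarrow>
    ('a \<Rightarrow> real) \<times> ('a \<Rightarrow> real) \<Rightarrow> real" where
  "norm_a_sq k \<gamma> \<beta> \<T> \<Omega>1 \<F> u = A_FD k \<gamma> \<beta> \<T> \<Omega>1 \<F> (L1 u) (L1 u)"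

definition norm_b_sq :: "real \<Rightarrow> 'a::euclidean_space set set \<Rightarrow> 'a set \<Rightarrow>
    ('a \<Rightarrow> real) \<times> ('a \<Rightarrow> real) \<Rightarrow> real" where
  "norm_b_sq \<gamma> \<T> \<Omega>1 u =
     (\<Sum>T\<in>ex_elements \<T> \<Omega>1. (LINT x:T|lborel. (norm (grad_within T (L1 u) x))\<^sup>2))
     + \<gamma> * Gamma_weighted \<T> \<Omega>1 (L1 u) (L1 u)"

text \<open>\<open>D\<close> is the reference shape of the subdomain: \<open>\<Omega>1\<close> may be any congruent copy of \<open>D\<close> in \<open>\<Omega>\<close>.
  Constants that depend on \<open>D\<close> but neither on \<open>\<T>\<close> nor on \<open>\<Omega>1\<close> are thus independent of the mesh size
  and of the location of \<open>\<Gamma>\<close> in the triangulation.\<close>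

definition admissible_configuration ::
    "nat \<Rightarrow> real \<Rightarrow> 'a::euclidean_space set \<Rightarrow> 'a set \<Rightarrow> 'a set set \<Rightarrow> 'a set \<Rightarrow> bool" where
  "admissible_configuration k \<sigma> \<Omega> D \<T> \<Omega>1 \<longleftrightarrow>
     triangulation_of \<T> \<Omega> \<and> shape_regular \<sigma> \<T> \<and>
     congruent_sets D \<Omega>1 \<and> \<Omega>1 \<subseteq> \<Omega> \<and>
     mesh_nodes k \<T> \<inter> frontier \<Omega>1 = {}"

end

theory Submission
  imports Defs
begin

text \<open>The second equivalence follows from the first one by the assumed equivalence of the two norms, since
  both components are themselves admissible pairs. In the first one the upper bound is the triangle
  inequality, and for the lower bound it suffices to control \<open>u\<^sup>\<Gamma>\<close> by \<open>u = u\<^sup>- + u\<^sup>\<Gamma>\<close>.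

  On the extended domain \<open>u\<^sup>\<Gamma>\<close> lives on elements \<open>T\<close> that contain a node outside \<open>\<Omega>\<^sub>1\<close>; these are cut, and
  there \<open>u\<^sup>\<Gamma>\<close> is determined by the values of \<open>u\<close> at such nodes \<open>j\<close>. By scaling, its contribution to the norm
  is bounded by \<open>h\<^sup>d\<^sup>-\<^sup>2 u(j)\<^sup>2\<close>. The boundary \<open>\<Gamma>\<close> has measure at least \<open>c h\<^sup>d\<^sup>-\<^sup>1\<close> in a ball of radius \<open>\<rho> = c h\<close>
  around a point of \<open>T \<inter> \<Gamma>\<close>, and if \<open>c\<close> is small, all cut elements met there have size comparable to \<open>h\<close> and
  share a vertex with \<open>T\<close>. Hence \<open>u(j)\<close> differs from the values of \<open>u\<close> on this part of \<open>\<Gamma>\<close> by at most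
  oscillations on two elements, which an inverse inequality bounds by \<open>h\<^sup>1\<^sup>-\<^sup>d\<^sup>/\<^sup>2\<close> times the norm of the
  gradient. Summation uses that these patches overlap finitely often. As mesh size and \<open>\<Gamma>\<close> enter only through
  shape regularity, the cone condition at a fixed scale and the diameter of \<open>\<Omega>\<close>, no smallness of
  the mesh size is needed.\<close>

section \<open>Uniform cone condition\<close>

text \<open>Two obstacles shape the proof. First, around a vertex on the boundary of \<Omega> the
  elements of a shape regular mesh may fall into groups that touch only in that vertex, and then
  sharing the vertex says nothing about their relative sizes. Since \<Gamma> may come near such a
  vertex or touch the boundary of \<Omega>, sizes are compared along chains of elements with common
  edges (\<open>cluster\<close>), and a path through \<open>\<Omega>1\<close> shows that all
  elements which \<Gamma> meets near a given cut element belong to one chain. Second, some objects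
  are given by descriptions whose meaning has to be earned. \<open>nodal_basis\<close> is a definite
  description, so Lagrange basis functions with zero boundary values must be shown to exist and to
  be unique for every degree. \<open>hausdorff_measure\<close> is a \<open>measure_of\<close>, so
  its values are known only once the outer measure is shown to be additive on Borel sets. Every
  constant is a term in data that are fixed before any mesh is chosen.\<close>

text \<open>The local graph property of a smooth boundary in a form that is invariant under isometries and
  needs no implicit function. The cone has half angle 60 degrees; any fixed angle below 90 degrees would do.\<close>

definition uniform_cone :: "real \<Rightarrow> 'a::euclidean_space set \<Rightarrow> bool" where
  "uniform_cone r0 S \<longleftrightarrow> r0 > 0 \<and> (\<forall>p\<in>frontier S. \<exists>\<xi>. norm \<xi> = 1 \<and>
     (\<forall>y\<in>frontier S \<inter> ball p r0. \<forall>w. w \<noteq> 0 \<longrightarrow> norm w < r0 \<longrightarrow> norm w / 2 \<le> \<xi> \<bullet> w \<longrightarrow>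
        y + w \<in> S \<and> y - w \<notin> closure S))"

lemma C_k_on_gradient:
  assumes "C_k_on (Suc 0) U \<psi>" "x \<in> U"
  shows "(\<psi> has_derivative (\<lambda>h. grad_within UNIV \<psi> x \<bullet> h)) (at x)"
    and "continuous_on U (grad_within UNIV \<psi>)"
proof -
  have d: "(\<psi> has_derivative frechet_derivative \<psi> (at x)) (at x)"
    using assms by (simp add: frechet_derivative_works)
  have "frechet_derivative \<psi> (at x) h = grad_within UNIV \<psi> x \<bullet> h" for h
  proof -
    have lin: "linear (frechet_derivative \<psi> (at x))"
      using d has_derivative_linear by blast
    have "frechet_derivative \<psi> (at x) h = frechet_derivative \<psi> (at x) (\<Sum>b\<in>Basis. (h \<bullet> b) *\<^sub>R b)"
      by (simp add: euclidean_representation)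
    also have "\<dots> = (\<Sum>b\<in>Basis. (h \<bullet> b) * frechet_derivative \<psi> (at x) b)"
      using lin by (simp add: linear_sum linear_scale o_def)
    also have "\<dots> = grad_within UNIV \<psi> x \<bullet> h"
      unfolding grad_within_def inner_sum_left by (intro sum.cong) (auto simp: inner_commute)
    finally show ?thesis .
  qed
  then show "(\<psi> has_derivative (\<lambda>h. grad_within UNIV \<psi> x \<bullet> h)) (at x)"
    using d by presburger
  show "continuous_on U (grad_within UNIV \<psi>)"
    using assms unfolding grad_within_def by (auto intro!: continuous_intros)
qed

text \<open>Near \<open>p\<close> the gradient of \<open>\<psi>\<close> stays within
  \<open>g / 4\<close> of \<open>G p\<close>, while a vector \<open>w\<close> of the cone around
  \<open>- G p / g\<close> satisfies \<open>G p \<bullet> w \<le> - g * norm w / 2\<close>. By the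
  mean value theorem \<open>\<psi>\<close> strictly decreases along \<open>w\<close>. Any deviation
  below \<open>g / 2\<close> would do.\<close>

lemma local_cone:
  fixes D :: "'a::euclidean_space set"
  assumes D: "open D" and p: "p \<in> frontier D" "p \<in> U" and sdf: "smooth_defining_function D U \<psi>"
  shows "\<exists>d>0. \<exists>\<xi>. norm \<xi> = 1 \<and>
     (\<forall>y\<in>frontier D \<inter> ball p d. \<forall>w. w \<noteq> 0 \<longrightarrow> norm w < d \<longrightarrow> norm w / 2 \<le> \<xi> \<bullet> w \<longrightarrow>
        y + w \<in> D \<and> y - w \<notin> closure D)"
proof -
  define G where "G = grad_within UNIV \<psi>"
  have U: "open U" and C1: "C_k_on (Suc 0) U \<psi>" and Gnz: "\<And>x. x \<in> U \<Longrightarrow> G x \<noteq> 0"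
    and DU: "D \<inter> U = {x\<in>U. \<psi> x < 0}"
    using sdf unfolding smooth_defining_function_def G_def by blast+
  have der: "(\<psi> has_derivative (\<lambda>h. G x \<bullet> h)) (at x)" if "x \<in> U" for x
    using C_k_on_gradient(1)[OF C1 that] by (simp add: G_def)
  have contG: "continuous_on U G"
    using C_k_on_gradient(2)[OF C1 p(2)] by (simp add: G_def)
  have cont\<psi>: "continuous_on U \<psi>"
    using der by (meson continuous_at_imp_continuous_on has_derivative_continuous)
  define g where "g = norm (G p)"
  have g: "g > 0" using Gnz p(2) by (simp add: g_def)
  have "isCont G p" using contG U p(2) by (simp add: continuous_on_eq_continuous_at)
  then obtain d1 where d1: "d1 > 0" "\<And>x. dist x p < d1 \<Longrightarrow> dist (G x) (G p) < g / 4"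
    unfolding continuous_at_eps_delta using g by (metis zero_less_divide_iff zero_less_numeral)
  obtain d2 where d2: "d2 > 0" "ball p d2 \<subseteq> U" using U p(2) open_contains_ball by blast
  \<comment> \<open>Halving leaves room for \<open>y + w\<close> and \<open>y - w\<close>, which
    stay within \<open>2 * d\<close> of \<open>p\<close>.\<close>
  define d where "d = min d1 d2 / 2"
  define \<xi> where "\<xi> = - (1 / g) *\<^sub>R G p"
  have n\<xi>: "norm \<xi> = 1" using g by (simp add: \<xi>_def g_def)
  \<comment> \<open>As \<open>D\<close> is open, \<open>y\<close> is not in \<open>D\<close>, so
    \<open>\<psi>\<close> is nonnegative at \<open>y\<close>. A positive value would give a
    neighbourhood of \<open>y\<close> that misses \<open>D\<close>.\<close>
  have zero: "\<psi> y = 0" if "y \<in> frontier D" "y \<in> U" for y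
  proof -
    have "y \<notin> D" using that(1) D by (simp add: frontier_def interior_open)
    then have ge: "\<psi> y \<ge> 0" using DU that(2) by fastforce
    have "\<psi> y \<le> 0"
    proof (rule ccontr)
      assume "\<not> \<psi> y \<le> 0"
      then have pos: "\<psi> y > 0" by simp
      have op: "open {x\<in>U. 0 < \<psi> x}"
        using continuous_open_preimage[OF cont\<psi> U, of "{0<..}"]
        by (simp add: vimage_def Int_def conj_commute)
      have "{x\<in>U. 0 < \<psi> x} \<inter> D = {}"
    proof (rule equals0I)
      fix z assume "z \<in> {x\<in>U. 0 < \<psi> x} \<inter> D"
      then have "z \<in> D \<inter> U" "0 < \<psi> z" by auto
      then show False unfolding DU by simp
    qed
      moreover have "y \<in> closure D" using that(1) by (simp add: frontier_def)
      ultimately show False using pos that(2) op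
        using open_Int_closure_eq_empty by blast
    qed
    with ge show ?thesis by simp
  qed
  have key: "\<psi> (a + w) < \<psi> a"
    if a: "a \<in> ball p d2" "dist a p < d1" "a + w \<in> ball p d2" "dist (a+w) p < d1" 
      and w: "w \<noteq> 0" "norm w / 2 \<le> \<xi> \<bullet> w" for a w
  proof -
    have seg: "a + t *\<^sub>R w \<in> ball p (min d1 d2)" if t: "0 \<le> t" "t \<le> 1" for t
    proof -
      have "a + t *\<^sub>R w = (1 - t) *\<^sub>R a + t *\<^sub>R (a + w)"
        by (simp add: algebra_simps)
      moreover have "a \<in> ball p (min d1 d2)" "a + w \<in> ball p (min d1 d2)"
        using a by (auto simp: dist_commute)
      ultimately show ?thesis
        using convexD_alt[OF convex_ball] t by metis
    qed
    have "((\<lambda>t. \<psi> (a + t *\<^sub>R w)) has_derivative (\<lambda>h. G (a + t *\<^sub>R w) \<bullet> (h *\<^sub>R w))) (at t)"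
      if "0 \<le> t" "t \<le> 1" for t
    proof -
      have *: "a + t *\<^sub>R w \<in> U" using seg[OF that] d2(2) by auto
      have inn: "((\<lambda>t. a + t *\<^sub>R w) has_derivative (\<lambda>h. h *\<^sub>R w)) (at t)"
        by (auto intro!: derivative_eq_intros)
      show ?thesis
        using has_derivative_compose[OF inn der[OF *]] .
    qed
    then have fd: "((\<lambda>t. \<psi> (a + t *\<^sub>R w)) has_field_derivative (G (a + t *\<^sub>R w) \<bullet> w)) (at t)"
      if "0 \<le> t" "t \<le> 1" for t
      using that unfolding has_field_derivative_def by (simp add: mult_commute_abs)
    obtain z where z: "0 < z" "z < 1" 
      "\<psi> (a + 1 *\<^sub>R w) - \<psi> (a + 0 *\<^sub>R w) = (1 - 0) * (G (a + z *\<^sub>R w) \<bullet> w)"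
      using MVT2[of 0 1 "\<lambda>t. \<psi> (a + t *\<^sub>R w)" "\<lambda>t. G (a + t *\<^sub>R w) \<bullet> w"] fd by auto
    have "dist (G (a + z *\<^sub>R w)) (G p) < g / 4"
      using seg[of z] z by (intro d1(2)) (simp add: dist_commute)
    then have "norm (G (a + z *\<^sub>R w) - G p) * norm w \<le> g / 4 * norm w"
      by (intro mult_right_mono) (auto simp: dist_norm)
    then have "\<bar>(G (a + z *\<^sub>R w) - G p) \<bullet> w\<bar> \<le> g / 4 * norm w"
      using Cauchy_Schwarz_ineq2 order_trans by blast
    moreover have "G p \<bullet> w = - g * (\<xi> \<bullet> w)" using g by (simp add: \<xi>_def)
    moreover have "g * (norm w / 2) \<le> g * (\<xi> \<bullet> w)" using w g by simp
    ultimately have "G (a + z *\<^sub>R w) \<bullet> w \<le> g / 4 * norm w - g * norm w / 2"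
      unfolding inner_diff_left abs_le_iff by linarith
    also have "\<dots> < 0" using g w by simp
    finally show ?thesis using z by simp
  qed
  show ?thesis
  proof (intro exI[of _ d] conjI exI[of _ \<xi>] ballI allI impI)
    show "d > 0" using d1 d2 by (simp add: d_def)
    show "norm \<xi> = 1" by fact
  next
    fix y w assume y: "y \<in> frontier D \<inter> ball p d" and w: "w \<noteq> 0" "norm w < d" "norm w / 2 \<le> \<xi> \<bullet> w"
    have dy: "dist p y < d" using y by simp
    have dd: "2 * d \<le> d1" "2 * d \<le> d2" by (auto simp: d_def)
    have d0: "0 < d" using d1 d2 by (simp add: d_def)
    have yp: "dist p (y + w) < 2 * d" "dist p (y - w) < 2 * d"
      using dy w(2) norm_triangle_ineq4[of "p - y" w] norm_triangle_ineq[of "p - y" w]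
      by (simp_all add: dist_norm diff_diff_eq algebra_simps)
    have yU: "y \<in> U" "y + w \<in> U" "y - w \<in> U" 
      using d2(2) dy yp dd d0 by auto
    have y0: "\<psi> y = 0" using zero y yU by blast
    have "\<psi> (y + w) < \<psi> y"
      by (rule key) (use dy yp dd d0 w in \<open>auto simp: dist_commute\<close>)
    then have "y + w \<in> D" using y0 yU DU by auto
    moreover have "\<psi> (y - w + w) < \<psi> (y - w)"
      by (rule key) (use dy yp dd d0 w in \<open>auto simp: dist_commute\<close>)
    then have pos: "\<psi> (y - w) > 0" using y0 by simp
    have op: "open {x\<in>U. 0 < \<psi> x}"
        using continuous_open_preimage[OF cont\<psi> U, of "{0<..}"]
        by (simp add: vimage_def Int_def conj_commute)
    have "{x\<in>U. 0 < \<psi> x} \<inter> D = {}"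
    proof (rule equals0I)
      fix z assume "z \<in> {x\<in>U. 0 < \<psi> x} \<inter> D"
      then have "z \<in> D \<inter> U" "0 < \<psi> z" by auto
      then show False unfolding DU by simp
    qed
    then have "y - w \<notin> closure D" using pos yU op
      using open_Int_closure_eq_empty by blast
    ultimately show "y + w \<in> D" "y - w \<notin> closure D" by auto
  qed
qed

text \<open>Compactness, as for a Lebesgue number: the covering balls have half the radius of the
  local cones, so a ball of radius \<open>r0\<close> around any frontier point fits into one of the
  full balls.\<close>

lemma smooth_boundary_uniform_cone:
  fixes D :: "'a::euclidean_space set"
  assumes D: "open D" "bounded D" "smooth_boundary D"
  shows "\<exists>r0. uniform_cone r0 D"
proof -
  have "\<exists>d>0. \<exists>\<xi>. norm \<xi> = 1 \<and>
     (\<forall>y\<in>frontier D \<inter> ball p d. \<forall>w. w \<noteq> 0 \<longrightarrow> norm w < d \<longrightarrow> norm w / 2 \<le> \<xi> \<bullet> w \<longrightarrow>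
        y + w \<in> D \<and> y - w \<notin> closure D)" if p: "p \<in> frontier D" for p
  proof -
    obtain U \<psi> where "p \<in> U" "smooth_defining_function D U \<psi>"
      using D(3) p unfolding smooth_boundary_def by blast
    then show ?thesis by (rule local_cone[OF D(1) p])
  qed
  then obtain d \<xi> where d: "\<And>p. p \<in> frontier D \<Longrightarrow> d p > 0"
    and \<xi>: "\<And>p. p \<in> frontier D \<Longrightarrow> norm (\<xi> p) = 1"
    and cone: "\<And>p y w. p \<in> frontier D \<Longrightarrow> y\<in>frontier D \<inter> ball p (d p) \<Longrightarrow> w \<noteq> 0 \<Longrightarrow> norm w < d p \<Longrightarrow>
       norm w / 2 \<le> \<xi> p \<bullet> w \<Longrightarrow> y + w \<in> D \<and> y - w \<notin> closure D"
    by metis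
  have "compact (frontier D)" using D(2) by (simp add: compact_frontier_bounded)
  moreover have "frontier D \<subseteq> (\<Union>p\<in>frontier D. ball p (d p / 2))"
    using d by (force simp: )
  ultimately obtain P where P: "P \<subseteq> frontier D" "finite P" "frontier D \<subseteq> (\<Union>p\<in>P. ball p (d p / 2))"
    using compactE_image[of "frontier D" "frontier D" "\<lambda>p. ball p (d p / 2)"] by auto
  \<comment> \<open>The inserted 1 is the value for an empty cover.\<close>
  define r0 where "r0 = Min (insert 1 ((\<lambda>p. d p / 2) ` P))"
  have r0: "r0 > 0" using P d by (auto simp: r0_def)
  have r0_le: "r0 \<le> d p / 2" if "p \<in> P" for p
    unfolding r0_def using P(2) that by (intro Min_le) auto
  have "\<exists>\<xi>. norm \<xi> = 1 \<and>
     (\<forall>y\<in>frontier D \<inter> ball q r0. \<forall>w. w \<noteq> 0 \<longrightarrow> norm w < r0 \<longrightarrow> norm w / 2 \<le> \<xi> \<bullet> w \<longrightarrow>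
        y + w \<in> D \<and> y - w \<notin> closure D)" if q: "q \<in> frontier D" for q
  proof -
    obtain p where p: "p \<in> P" "dist p q < d p / 2" using P(3) q by auto
    have dp: "d p > 0" "r0 \<le> d p / 2" "p \<in> frontier D" using d p P r0_le by auto
    have "y + w \<in> D \<and> y - w \<notin> closure D" 
      if y: "y \<in> frontier D \<inter> ball q r0" and w: "w \<noteq> 0" "norm w < r0" "norm w / 2 \<le> \<xi> p \<bullet> w" for y w
    proof (rule cone[OF dp(3) _ w(1) _ w(3)])
      have "dist p y < d p" using y p dp dist_triangle[of p y q] by auto
      then show "y \<in> frontier D \<inter> ball p (d p)" using y by auto
      show "norm w < d p" using w dp by linarith
    qed
    then show ?thesis using \<xi>[OF dp(3)] by blast
  qed
  then show ?thesis using r0 unfolding uniform_cone_def by blast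
qed

text \<open>An isometry carries closure, interior and frontier along and turns the axis
  \<open>\<xi>\<close> into \<open>f \<xi>\<close>. So the radius \<open>r0\<close> of the reference
  shape serves for every position of \<Gamma>.\<close>

lemma uniform_cone_congruent:
  fixes D :: "'a::euclidean_space set"
  assumes "uniform_cone r0 D" "congruent_sets D S"
  shows "uniform_cone r0 S"
proof -
  obtain f c where f: "orthogonal_transformation f" and S: "S = (\<lambda>x. c + f x) ` D"
    using assms(2) unfolding congruent_sets_def by auto
  have lin: "linear f" and inj: "inj f" and surj: "surj f"
    using f by (auto simp: orthogonal_transformation_linear orthogonal_transformation_inj orthogonal_transformation_surj)
  have img: "(\<lambda>x. c + f x) ` A = (+) c ` (f ` A)" for A by (simp add: image_image)
  have cl: "closure S = (\<lambda>x. c + f x) ` closure D"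
    unfolding S img closure_translation closure_injective_linear_image[OF lin inj, symmetric] ..
  have int: "interior S = (\<lambda>x. c + f x) ` interior D"
    unfolding S img interior_translation 
    using interior_bijective_linear_image[OF lin] inj surj by (metis bij_def)
  have inj': "inj (\<lambda>x. c + f x)" using inj by (simp add: inj_def)
  have fr: "frontier S = (\<lambda>x. c + f x) ` frontier D"
    unfolding frontier_def cl int using inj' by (metis image_set_diff)
  show ?thesis unfolding uniform_cone_def
  proof (intro conjI ballI)
    show "0 < r0" using assms(1) by (simp add: uniform_cone_def)
    fix q assume "q \<in> frontier S"
    then obtain p where p: "p \<in> frontier D" "q = c + f p" using fr by auto
    obtain \<xi> where \<xi>: "norm \<xi> = 1" and 
     cone: "\<And>y w. y\<in>frontier D \<inter> ball p r0 \<Longrightarrow> w \<noteq> 0 \<Longrightarrow> norm w < r0 \<Longrightarrow> norm w / 2 \<le> \<xi> \<bullet> w \<Longrightarrow>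
        y + w \<in> D \<and> y - w \<notin> closure D"
      using assms(1) p(1) unfolding uniform_cone_def by blast
    show "\<exists>\<xi>. norm \<xi> = 1 \<and>
           (\<forall>y\<in>frontier S \<inter> ball q r0. \<forall>w. w \<noteq> 0 \<longrightarrow> norm w < r0 \<longrightarrow> norm w / 2 \<le> \<xi> \<bullet> w \<longrightarrow> y + w \<in> S \<and> y - w \<notin> closure S)"
    proof (intro exI[of _ "f \<xi>"] conjI ballI allI impI)
      show "norm (f \<xi>) = 1" using f \<xi> by (simp add: orthogonal_transformation_norm)
      fix y w assume y: "y \<in> frontier S \<inter> ball q r0" and w: "w \<noteq> 0" "norm w < r0" "norm w / 2 \<le> f \<xi> \<bullet> w"
      obtain y' where y': "y' \<in> frontier D" "y = c + f y'" using y fr by auto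
      obtain w' where w': "w = f w'" using surj by (metis surjD)
      have nw: "norm w = norm w'" using f by (simp add: w' orthogonal_transformation_norm)
      have "dist p y' < r0"
        using y y' p by (simp add: dist_norm flip: linear_diff[OF lin]) (simp add: orthogonal_transformation_norm[OF f])
      moreover have "f \<xi> \<bullet> w = \<xi> \<bullet> w'" using f by (simp add: w' orthogonal_transformation_def)
      ultimately have "y' + w' \<in> D \<and> y' - w' \<notin> closure D"
        using cone[of y' w'] y' w nw by (metis IntI mem_ball norm_eq_zero)
      moreover have "y + w = c + f (y' + w')" "y - w = c + f (y' - w')"
        by (simp_all add: y' w' linear_add[OF lin] linear_diff[OF lin])
      ultimately show "y + w \<in> S" "y - w \<notin> closure S"
        using inj_image_mem_iff[OF inj', of "y' - w'" "closure D"] by (simp_all add: S flip: cl)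
    qed
  qed
qed

section \<open>Hausdorff measure\<close>

definition hweight :: "nat \<Rightarrow> 'a::euclidean_space set \<Rightarrow> ennreal" where
  "hweight m C = ennreal (unit_ball_vol (real m) * (diameter C / 2) ^ m)"

definition hcovers :: "real \<Rightarrow> 'a::euclidean_space set \<Rightarrow> (nat \<Rightarrow> 'a set) set" where
  "hcovers \<delta> A = {C. A \<subseteq> (\<Union>i. C i) \<and> (\<forall>i. bounded (C i) \<and> diameter (C i) \<le> \<delta>)}"

lemma hausdorff_pre_alt: "hausdorff_pre m \<delta> A = (INF C\<in>hcovers \<delta> A. \<Sum>i. hweight m (C i))"
  by (simp add: hausdorff_pre_def hcovers_def hweight_def)

definition hausdorff_outer :: "nat \<Rightarrow> 'a::euclidean_space set \<Rightarrow> ennreal" where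
  "hausdorff_outer m A = (SUP \<delta>\<in>{0<..}. hausdorff_pre m \<delta> A)"

text \<open>For \<open>m = 0\<close> the empty set would have weight 1, since
  \<open>0 ^ 0 = 1\<close>. Hence \<open>m \<ge> 1\<close> is assumed wherever covers are padded
  with empty sets.\<close>

lemma hweight_empty [simp]: "m \<ge> 1 \<Longrightarrow> hweight m {} = 0"
  by (simp add: hweight_def)

lemma hausdorff_pre_le:
  assumes "C \<in> hcovers \<delta> A"
  shows "hausdorff_pre m \<delta> A \<le> (\<Sum>i. hweight m (C i))"
  unfolding hausdorff_pre_alt by (rule INF_lower[OF assms])

lemma hausdorff_pre_mono: "A \<subseteq> B \<Longrightarrow> hausdorff_pre m \<delta> A \<le> hausdorff_pre m \<delta> B"
  unfolding hausdorff_pre_alt by (rule INF_superset_mono) (auto simp: hcovers_def)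

lemma hausdorff_pre_antimono: "\<delta> \<le> \<delta>' \<Longrightarrow> hausdorff_pre m \<delta>' A \<le> hausdorff_pre m \<delta> A"
  unfolding hausdorff_pre_alt by (rule INF_superset_mono) (auto simp: hcovers_def intro: order_trans)

lemma hausdorff_pre_le_outer: "\<delta> > 0 \<Longrightarrow> hausdorff_pre m \<delta> A \<le> hausdorff_outer m A"
  unfolding hausdorff_outer_def by (rule SUP_upper) simp

lemma hausdorff_outer_mono: "A \<subseteq> B \<Longrightarrow> hausdorff_outer m A \<le> hausdorff_outer m B"
  unfolding hausdorff_outer_def by (intro SUP_mono) (meson hausdorff_pre_mono)

lemma hausdorff_outer_empty:
  assumes "m \<ge> 1"
  shows "hausdorff_outer m ({} :: 'a::euclidean_space set) = 0"
proof -
  have "hausdorff_pre m \<delta> ({} :: 'a set) \<le> 0" if "\<delta> > 0" for \<delta>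
    using hausdorff_pre_le[of "\<lambda>_. {}" \<delta> "{} :: 'a set" m] assms that by (simp add: hcovers_def)
  then show ?thesis unfolding hausdorff_outer_def by (simp add: SUP_eq_iff)
qed

text \<open>An optimal cover need not exist, so each \<open>A i\<close> receives one that is optimal
  up to \<open>e * (1/2) ^ Suc i\<close>. The resulting double sequence is enumerated by
  \<open>prod_decode\<close>.\<close>

lemma hausdorff_pre_UN_le:
  "hausdorff_pre m \<delta> (\<Union>i. A i) \<le> (\<Sum>i. hausdorff_pre m \<delta> (A i))"
proof (cases "(\<Sum>i. hausdorff_pre m \<delta> (A i)) < \<infinity>")
  case True
  have fin: "hausdorff_pre m \<delta> (A i) < \<infinity>" for i
    using True by (meson ennreal_suminf_lessD infinity_ennreal_def leD leI order.strict_trans1)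
  show ?thesis
  proof (rule ennreal_le_epsilon)
    fix e :: real assume e: "e > 0"
    have "\<exists>C\<in>hcovers \<delta> (A i). (\<Sum>j. hweight m (C j)) \<le> hausdorff_pre m \<delta> (A i) + ennreal (e * (1/2) ^ Suc i)" for i
    proof -
      have "hausdorff_pre m \<delta> (A i) < hausdorff_pre m \<delta> (A i) + ennreal (e * (1/2) ^ Suc i)"
        using fin[of i] e ennreal_add_left_cancel_less[of "hausdorff_pre m \<delta> (A i)" 0] by (simp add: ennreal_zero_less_mult_iff)
      then show ?thesis
        unfolding hausdorff_pre_alt INF_less_iff by (meson less_imp_le)
    qed
    then obtain C where C: "\<And>i. C i \<in> hcovers \<delta> (A i)"
      "\<And>i. (\<Sum>j. hweight m (C i j)) \<le> hausdorff_pre m \<delta> (A i) + ennreal (e * (1/2) ^ Suc i)"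
      by metis
    define E where "E n = case_prod C (prod_decode n)" for n
    have "E \<in> hcovers \<delta> (\<Union>i. A i)"
    proof -
      have "(\<Union>i. A i) \<subseteq> (\<Union>n. E n)"
      proof
        fix x assume "x \<in> (\<Union>i. A i)"
        then obtain i j where "x \<in> C i j" using C(1) unfolding hcovers_def by blast
        then have "x \<in> E (prod_encode (i, j))" by (simp add: E_def)
        then show "x \<in> (\<Union>n. E n)" by blast
      qed
      then show ?thesis using C(1) by (auto simp: hcovers_def E_def split: prod.split)
    qed
    then have "hausdorff_pre m \<delta> (\<Union>i. A i) \<le> (\<Sum>n. hweight m (E n))" by (rule hausdorff_pre_le)
    also have "\<dots> = (\<Sum>i. \<Sum>j. hweight m (C i j))"
      unfolding E_def by (rule suminf_ennreal_2dimen) (auto split: prod.split)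
    also have "\<dots> \<le> (\<Sum>i. hausdorff_pre m \<delta> (A i) + ennreal (e * (1/2) ^ Suc i))"
      using C(2) by (intro suminf_le) auto
    also have "\<dots> = (\<Sum>i. hausdorff_pre m \<delta> (A i)) + (\<Sum>i. ennreal (e * (1/2) ^ Suc i))"
      by (rule suminf_add[symmetric]) auto
    also have "(\<Sum>i. ennreal (e * (1/2) ^ Suc i)) = ennreal e"
      using sums_mult[OF power_half_series, of e] e by (intro suminf_ennreal_eq) auto
    finally show "hausdorff_pre m \<delta> (\<Union>i. A i) \<le> (\<Sum>i. hausdorff_pre m \<delta> (A i)) + ennreal e" .
  qed
qed (simp add: not_less_iff_gr_or_eq top_unique)

lemma hausdorff_outer_UN_le:
  "hausdorff_outer m (\<Union>i. A i) \<le> (\<Sum>i. hausdorff_outer m (A i))"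
proof -
  have "hausdorff_pre m \<delta> (\<Union>i. A i) \<le> (\<Sum>i. hausdorff_outer m (A i))" if "\<delta> > 0" for \<delta>
    using hausdorff_pre_UN_le[of m \<delta> A] hausdorff_pre_le_outer[OF that]
    by (meson order_trans suminf_le summableI)
  then show ?thesis unfolding hausdorff_outer_def[of m "\<Union>i. A i"] by (intro SUP_least) auto
qed

lemma hausdorff_outer_Un_le:
  assumes "m \<ge> 1"
  shows "hausdorff_outer m (A \<union> B) \<le> hausdorff_outer m A + hausdorff_outer m B"
proof -
  have "hausdorff_outer m (\<Union>i. binaryset A B i) \<le> (\<Sum>i. hausdorff_outer m (binaryset A B i))"
    by (rule hausdorff_outer_UN_le)
  moreover have "(\<Sum>i. hausdorff_outer m (binaryset A B i)) = hausdorff_outer m A + hausdorff_outer m B"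
    by (rule suminf_binaryset_eq[where f = "hausdorff_outer m", OF hausdorff_outer_empty[OF assms]])
  ultimately show ?thesis by (simp add: UN_binaryset_eq)
qed

text \<open>In a cover by sets of diameter below \<open>e\<close> no set meets both \<open>A\<close>
  and \<open>B\<close>, so the cover splits into two. The scales \<open>\<delta>\<close> and
  \<open>\<delta>'\<close> are independent, which lets the two suprema be taken one after the
  other.\<close>

lemma hausdorff_outer_separated:
  assumes m: "m \<ge> 1" and e: "e > 0" and sep: "\<And>x y. x \<in> A \<Longrightarrow> y \<in> B \<Longrightarrow> e \<le> dist x y"
  shows "hausdorff_outer m A + hausdorff_outer m B \<le> hausdorff_outer m (A \<union> B)"
proof -
  have *: "hausdorff_pre m \<delta> A + hausdorff_pre m \<delta>' B \<le> hausdorff_outer m (A \<union> B)"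
    if "\<delta> > 0" "\<delta>' > 0" for \<delta> \<delta>'
  proof -
    define d where "d = Min {\<delta>, \<delta>', e / 2}"
    have d: "d > 0" "d \<le> \<delta>" "d \<le> \<delta>'" "d < e" using that e by (auto simp: d_def)
    have "hausdorff_pre m d A + hausdorff_pre m d B \<le> hausdorff_pre m d (A \<union> B)"
      unfolding hausdorff_pre_alt[of m d "A \<union> B"]
    proof (rule INF_greatest)
      fix C assume C: "C \<in> hcovers d (A \<union> B)"
      define CA where "CA i = (if C i \<inter> A = {} then {} else C i)" for i
      define CB where "CB i = (if C i \<inter> B = {} then {} else C i)" for i
      have "CA \<in> hcovers d A" 
        using C d(1) unfolding hcovers_def CA_def by auto blast
      moreover have "CB \<in> hcovers d B" 
        using C d(1) unfolding hcovers_def CB_def by auto blast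
      ultimately have "hausdorff_pre m d A + hausdorff_pre m d B \<le>
          (\<Sum>i. hweight m (CA i)) + (\<Sum>i. hweight m (CB i))"
        by (intro add_mono hausdorff_pre_le)
      also have "\<dots> = (\<Sum>i. hweight m (CA i) + hweight m (CB i))"
        by (rule suminf_add) auto
      also have "\<dots> \<le> (\<Sum>i. hweight m (C i))"
      proof (rule suminf_le)
        fix i
        have "C i \<inter> A = {} \<or> C i \<inter> B = {}"
        proof (rule ccontr)
          assume "\<not> ?thesis"
          then obtain x y where "x \<in> C i" "x \<in> A" "y \<in> C i" "y \<in> B" by auto
          moreover have "bounded (C i)" "diameter (C i) \<le> d" using C by (auto simp: hcovers_def)
          ultimately show False using sep[of x y] diameter_bounded_bound[of "C i" x y] d by auto
        qed
        then show "hweight m (CA i) + hweight m (CB i) \<le> hweight m (C i)"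
          using m by (auto simp: CA_def CB_def)
      qed auto
      finally show "hausdorff_pre m d A + hausdorff_pre m d B \<le> (\<Sum>i. hweight m (C i))" .
    qed
    then show ?thesis
      using hausdorff_pre_antimono[OF d(2), of m A] hausdorff_pre_antimono[OF d(3), of m B]
        hausdorff_pre_le_outer[OF d(1), of m "A \<union> B"] by (meson add_mono order_trans)
  qed
  have "hausdorff_outer m A + hausdorff_pre m \<delta>' B \<le> hausdorff_outer m (A \<union> B)" if "\<delta>' > 0" for \<delta>'
    unfolding hausdorff_outer_def[of m A]
    by (subst ennreal_SUP_add_left[symmetric]) (use * that in \<open>auto intro!: SUP_least\<close>)
  then show ?thesis
    unfolding hausdorff_outer_def[of m B]
    by (subst ennreal_SUP_add_right) (auto intro!: SUP_least)
qed

lemma hausdorff_outer_separated_sum: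
  assumes m: "m \<ge> 1" and "finite I" and e: "e > 0"
    and "\<And>i j x y. i \<in> I \<Longrightarrow> j \<in> I \<Longrightarrow> i \<noteq> j \<Longrightarrow> x \<in> A i \<Longrightarrow> y \<in> A j \<Longrightarrow> e \<le> dist x y"
  shows "(\<Sum>i\<in>I. hausdorff_outer m (A i)) \<le> hausdorff_outer m (\<Union>i\<in>I. A i)"
  using assms(2,4)
proof (induction I)
  case (insert i I)
  have "(\<Sum>j\<in>insert i I. hausdorff_outer m (A j)) \<le> hausdorff_outer m (A i) + hausdorff_outer m (\<Union>j\<in>I. A j)"
  proof -
    have "(\<Sum>j\<in>I. hausdorff_outer m (A j)) \<le> hausdorff_outer m (\<Union>j\<in>I. A j)"
      by (rule insert.IH) (use insert.prems in blast)
    then show ?thesis using insert.hyps by (simp add: add_left_mono)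
  qed
  also have "\<dots> \<le> hausdorff_outer m (A i \<union> (\<Union>j\<in>I. A j))"
    by (rule hausdorff_outer_separated[OF m e]) (use insert.hyps(2) insert.prems in auto)
  finally show ?case by simp
qed simp

section \<open>Additivity of the Hausdorff measure on Borel sets\<close>

lemma ennreal_tail_tendsto_zero:
  fixes f :: "nat \<Rightarrow> ennreal"
  assumes "(\<Sum>i. f i) < \<infinity>"
  shows "(\<lambda>N. \<Sum>i. f (i + N)) \<longlonglongrightarrow> 0"
proof -
  have fin: "f i < \<infinity>" for i
    using assms by (meson ennreal_suminf_lessD infinity_ennreal_def leD leI order.strict_trans1)
  define g where "g i = enn2real (f i)" for i
  have fg: "f i = ennreal (g i)" "g i \<ge> 0" for i using fin[of i] by (auto simp: g_def less_top)
  have s: "summable g"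
    using assms fg by (intro summable_suminf_not_top) auto
  have "(\<Sum>i. f (i + N)) = ennreal (\<Sum>i. g (i + N))" for N
    unfolding fg(1) using fg(2) s by (intro suminf_ennreal2) (auto simp: summable_iff_shift)
  moreover have "(\<lambda>N. \<Sum>i. g (i + N)) \<longlonglongrightarrow> 0"
    by (rule suminf_exist_split2[OF s])
  then have "(\<lambda>N. ennreal (\<Sum>i. g (i + N))) \<longlonglongrightarrow> ennreal 0"
    by (intro tendsto_ennrealI)
  ultimately show ?thesis by simp
qed

text \<open>The layers of points at distance between \<open>1/(n+2)\<close> and \<open>1/(n+1)\<close> from \<open>F\<close> have positive distance from each
  other for \<open>n\<close> of equal parity, so their measures are summable when \<open>A\<close> has finite measure.\<close>

lemma hausdorff_outer_closed_split:
  fixes F A :: "'a::euclidean_space set"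
  assumes m: "m \<ge> 1" and F: "closed F" "F \<noteq> {}"
  shows "hausdorff_outer m (A \<inter> F) + hausdorff_outer m (A - F) \<le> hausdorff_outer m A"
proof (cases "hausdorff_outer m A < \<infinity>")
  case True
  define H where "H = (hausdorff_outer m :: 'a set \<Rightarrow> ennreal)"
  have mono: "H B \<le> H C" if "B \<subseteq> C" for B C unfolding H_def by (rule hausdorff_outer_mono[OF that])
  define d where "d x = infdist x F" for x
  have dL: "\<bar>d x - d y\<bar> \<le> dist x y" for x y 
    unfolding d_def using infdist_triangle_abs[of x F y] by simp
  have d0: "d x = 0 \<longleftrightarrow> x \<in> F" for x unfolding d_def using F by (simp add: in_closed_iff_infdist_zero)
  have dnn: "d x \<ge> 0" for x by (simp add: d_def infdist_nonneg)
  define R where "R n = {x\<in>A. 1 / real (n + 2) < d x \<and> d x \<le> 1 / real (n + 1)}" for n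
  define G where "G N = {x\<in>A. 1 / real (N + 1) < d x}" for N
  have half: "(\<Sum>n<N. H (R (2 * n + b))) \<le> H A" for N b
  proof -
    \<comment> \<open>For \<open>i < j\<close> the layers \<open>2 * i + b\<close> and
      \<open>2 * j + b\<close> are at least \<open>1 / (2 * i + b + 2) - 1 / (2 * i + b + 3)\<close>
      apart. This decreases in \<open>i\<close>, so its value at \<open>N\<close> serves for all
      pairs at once.\<close>
    define e where "e = 1 / real (2 * N + b + 2) - 1 / real (2 * N + b + 3)"
    have "(\<Sum>n<N. H (R (2 * n + b))) \<le> H (\<Union>n<N. R (2 * n + b))"
      unfolding H_def
    proof (rule hausdorff_outer_separated_sum[OF m, of _ e])
      show "e > 0" unfolding e_def by (simp add: divide_strict_left_mono)
      have *: "e \<le> dist x y" if "i < j" "j < N" and x: "x \<in> R (2 * i + b)" and y: "y \<in> R (2 * j + b)" for i j x y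
      proof -
        have "e \<le> 1 / real (2 * i + b + 2) - 1 / real (2 * i + b + 3)"
        proof -
          have *: "1 / real (n + 2) - 1 / real (n + 3) = 1 / (real (n + 2) * real (n + 3))" for n
            by (simp add: field_simps)
          have "real (2 * i + b + 2) * real (2 * i + b + 3) \<le> real (2 * N + b + 2) * real (2 * N + b + 3)"
            using that by (intro mult_mono) auto
          then show ?thesis
            unfolding e_def * by (intro divide_left_mono) auto
        qed
        also have "1 / real (2 * i + b + 3) \<ge> 1 / real (2 * j + b + 1)"
          using that by (intro divide_left_mono) auto
        then have "1 / real (2 * i + b + 2) - 1 / real (2 * i + b + 3) \<le> 1 / real (2 * i + b + 2) - 1 / real (2 * j + b + 1)"
          by simp
        also have "\<dots> \<le> d x - d y" using x y by (simp add: R_def)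
        also have "\<dots> \<le> dist x y" using dL[of x y] by simp
        finally show ?thesis .
      qed
      show "e \<le> dist x y" if "i \<in> {..<N}" "j \<in> {..<N}" "i \<noteq> j" "x \<in> R (2 * i + b)" "y \<in> R (2 * j + b)" for i j x y
        using *[of i j x y] *[of j i y x] that by (cases i j rule: linorder_cases) (auto simp: dist_commute)
    qed auto
    also have "\<dots> \<le> H A" by (rule mono) (auto simp: R_def)
    finally show ?thesis .
  qed
  have "(\<Sum>n<N. H (R n)) \<le> H A + H A" for N
  proof -
    have "(\<Sum>n<N. H (R n)) \<le> (\<Sum>n<2 * N. H (R n))" by (rule sum_mono2) auto
    also have "\<dots> = (\<Sum>n<N. H (R (2 * n))) + (\<Sum>n<N. H (R (2 * n + 1)))"
      by (induction N) (auto simp: algebra_simps)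
    also have "\<dots> \<le> H A + H A" using half[of 0 N] half[of 1 N] by (intro add_mono) (simp_all only: add_0_right)
    finally show ?thesis .
  qed
  then have "(\<Sum>n. H (R n)) \<le> H A + H A"
    by (intro suminf_le_const) auto
  also have "\<dots> < \<infinity>" using True by (simp add: H_def)
  finally have tail: "(\<lambda>N. \<Sum>i. H (R (i + N))) \<longlonglongrightarrow> 0"
    by (rule ennreal_tail_tendsto_zero)
  have "H (A \<inter> F) + H (A - F) \<le> H A + (\<Sum>i. H (R (i + N)))" for N
  proof -
    \<comment> \<open>The set \<open>G N\<close> keeps distance \<open>1 / (N + 1)\<close> from
      \<open>F\<close>, so the measure is additive on it and \<open>A \<inter> F\<close>. The layers
      from \<open>N\<close> on form the rest, whose measure tends to 0.\<close>
    have "A - F \<subseteq> G N \<union> (\<Union>i. R (i + N))"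
    proof
      fix x assume x: "x \<in> A - F"
      then have "d x > 0" using d0[of x] dnn[of x] by auto
      show "x \<in> G N \<union> (\<Union>i. R (i + N))"
      proof (cases "1 / real (N + 1) < d x")
        case False
        define P where "P i \<longleftrightarrow> 1 / real (i + N + 2) < d x" for i
        obtain n where "inverse (real (Suc n)) < d x" using \<open>d x > 0\<close> reals_Archimedean by blast
        moreover have "1 / real (n + N + 2) \<le> inverse (real (Suc n))" by (simp add: field_simps)
        ultimately have "P n" by (simp add: P_def)
        define i where "i = (LEAST i. P i)"
        have "P i" unfolding i_def using \<open>P n\<close> by (rule LeastI)
        moreover have "d x \<le> 1 / real (i + N + 1)"
        proof (cases i)
          case 0 then show ?thesis using False by simp
        next
          case (Suc i')
          then have "\<not> P i'" unfolding i_def by (metis lessI not_less_Least)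
          then show ?thesis using Suc by (simp add: P_def)
        qed
        ultimately have "x \<in> R (i + N)" using x by (simp add: R_def P_def)
        then show ?thesis by blast
      qed (use x in \<open>auto simp: G_def\<close>)
    qed
    then have "H (A - F) \<le> H (G N \<union> (\<Union>i. R (i + N)))" by (rule mono)
    also have "\<dots> \<le> H (G N) + H (\<Union>i. R (i + N))" unfolding H_def by (rule hausdorff_outer_Un_le[OF m])
    also have "\<dots> \<le> H (G N) + (\<Sum>i. H (R (i + N)))"
      unfolding H_def by (intro add_left_mono hausdorff_outer_UN_le)
    finally have "H (A \<inter> F) + H (A - F) \<le> (H (A \<inter> F) + H (G N)) + (\<Sum>i. H (R (i + N)))"
      by (simp add: add.assoc add_left_mono)
    also have "H (A \<inter> F) + H (G N) \<le> H (A \<inter> F \<union> G N)"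
      unfolding H_def
    proof (rule hausdorff_outer_separated[OF m, of "1 / real (N + 1)"])
      fix x y assume "x \<in> A \<inter> F" "y \<in> G N"
      then have "d x = 0" "d y > 1 / real (N + 1)" using d0[of x] by (simp_all add: G_def)
      then show "1 / real (N + 1) \<le> dist x y" using dL[of x y] by linarith
    qed simp
    also have "H (A \<inter> F \<union> G N) \<le> H A" by (rule mono) (auto simp: G_def)
    finally show ?thesis by (simp add: add_right_mono)
  qed
  moreover have "(\<lambda>N. H A + (\<Sum>i. H (R (i + N)))) \<longlonglongrightarrow> H A + 0"
    by (intro tendsto_intros tail)
  ultimately have "H (A \<inter> F) + H (A - F) \<le> H A + 0"
    by (intro Lim_bounded2[where N=0]) auto
  then show ?thesis by (simp add: H_def)
qed (simp add: not_less_iff_gr_or_eq top_unique)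

text \<open>\<open>measure_of\<close> yields the zero measure unless the given set function is a
  measure on the generated sigma-algebra. By Caratheodory's theorem it is one here, since closed
  sets, and therefore all Borel sets, split every set additively.\<close>

lemma emeasure_hausdorff_measure:
  fixes A :: "'a::euclidean_space set"
  assumes m: "m \<ge> 1" and A: "A \<in> sets borel"
  shows "emeasure (hausdorff_measure m) A = hausdorff_outer m A"
proof -
  define H where "H = (hausdorff_outer m :: 'a set \<Rightarrow> ennreal)"
  interpret P: sigma_algebra UNIV "Pow UNIV :: 'a set set" by (rule sigma_algebra_Pow)
  have oms: "outer_measure_space (Pow UNIV) H"
    unfolding outer_measure_space_def
  proof (intro conjI)
    show "positive (Pow UNIV) H" by (simp add: positive_def H_def hausdorff_outer_empty[OF m])
    show "increasing (Pow UNIV) H" by (auto simp: increasing_def H_def intro: hausdorff_outer_mono)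
    show "countably_subadditive (Pow UNIV) H"
      by (auto simp: countably_subadditive_def H_def intro: hausdorff_outer_UN_le)
  qed
  define L where "L = lambda_system UNIV (Pow UNIV) H"
  have ms: "measure_space UNIV L H" unfolding L_def by (rule P.caratheodory_lemma[OF oms])
  have closed_L: "F \<in> L" if F: "closed F" for F
  proof (cases "F = {}")
    case True
    then show ?thesis unfolding L_def P.lambda_system_eq using hausdorff_outer_empty[OF m, where 'a='a] by (simp add: H_def)
  next
    case False
    have "H (A \<inter> F) + H (A - F) = H A" for A
    proof (rule antisym)
      show "H (A \<inter> F) + H (A - F) \<le> H A" 
        unfolding H_def by (rule hausdorff_outer_closed_split[OF m F False])
      have "H A = H ((A \<inter> F) \<union> (A - F))" by (rule arg_cong[where f=H]) auto
      also have "\<dots> \<le> H (A \<inter> F) + H (A - F)" unfolding H_def by (rule hausdorff_outer_Un_le[OF m])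
      finally show "H A \<le> H (A \<inter> F) + H (A - F)" .
    qed
    then show ?thesis unfolding L_def P.lambda_system_eq by simp
  qed
  have "sigma_algebra UNIV L" using ms by (simp add: measure_space_def)
  then have "sigma_sets UNIV (Collect closed) \<subseteq> L"
    by (intro sigma_algebra.sigma_sets_subset) (auto intro: closed_L)
  then have sub: "sets borel \<subseteq> L" by (simp add: borel_eq_closed)
  have "measure_space UNIV (sets (borel :: 'a measure)) H"
    using measure_down[OF ms _ sub] sets.sigma_algebra_axioms[of borel] by simp
  then have pc: "positive (sets (borel :: 'a measure)) H" "countably_additive (sets (borel :: 'a measure)) H"
    by (auto simp: measure_space_def)
  have eq: "hausdorff_measure m = measure_of UNIV (sets borel) H"
    unfolding hausdorff_measure_def H_def hausdorff_outer_def ..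
  have "sets (hausdorff_measure m :: 'a measure) = sets borel"
    unfolding eq using sets.sigma_sets_eq[of "borel :: 'a measure"] by simp
  then show ?thesis
    using emeasure_measure_of[OF eq, of A] pc A by (simp add: H_def)
qed

lemma sets_surface_measure [simp, measurable_cong]: "sets surface_measure = sets borel"
  unfolding surface_measure_def hausdorff_measure_def
  using sets.sigma_sets_eq[of "borel :: 'a measure"] by simp

lemma space_surface_measure [simp]: "space surface_measure = UNIV"
  using sets_eq_imp_space_eq[OF sets_surface_measure] by simp

lemma emeasure_surface_measure:
  fixes A :: "'a::euclidean_space set"
  assumes "DIM('a) \<ge> 2" "A \<in> sets borel"
  shows "emeasure surface_measure A = hausdorff_outer (DIM('a) - 1) A"
  unfolding surface_measure_def using assms by (intro emeasure_hausdorff_measure) auto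

section \<open>Surface measure of boundaries with a cone condition\<close>

lemma emeasure_cball_eq:
  fixes c :: "'a::euclidean_space"
  assumes "r \<ge> 0"
  shows "emeasure lborel (cball c r) = ennreal (unit_ball_vol (DIM('a)) * r ^ DIM('a))"
  using emeasure_cball[OF assms, of c] by simp

text \<open>Volume comparison. Centres at distance \<open>2 * r\<close> only make the open balls
  disjoint, so these are measured.\<close>

lemma packing_card:
  fixes Q :: "'a::euclidean_space set"
  assumes "finite Q" "r > 0" "R \<ge> 0"
    and sep: "\<And>q q'. q \<in> Q \<Longrightarrow> q' \<in> Q \<Longrightarrow> q \<noteq> q' \<Longrightarrow> 2 * r \<le> dist q q'"
    and sub: "\<And>q. q \<in> Q \<Longrightarrow> cball q r \<subseteq> cball c R"
  shows "real (card Q) * r ^ DIM('a) \<le> R ^ DIM('a)"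
proof -
  let ?v = "unit_ball_vol (real DIM('a))"
  have v: "?v > 0" by simp
  have ms: "measure lborel (ball q s) = ?v * s ^ DIM('a)" if "s > 0" for q :: 'a and s
    using content_ball[of s q] that by simp
  have disj: "disjoint_family_on (\<lambda>q. ball q r) Q"
    unfolding disjoint_family_on_def
  proof (intro ballI impI)
    fix q q' assume "q \<in> Q" "q' \<in> Q" "q \<noteq> q'"
    then have "r + r \<le> dist q q'" using sep[of q q'] by simp
    then show "ball q r \<inter> ball q' r = {}" by (rule disjoint_ballI)
  qed
  have "measure lborel (\<Union>q\<in>Q. ball q r) = (\<Sum>q\<in>Q. measure lborel (ball q r))"
  proof (rule measure_finite_Union[OF assms(1) _ disj])
    show "emeasure lborel (ball q r) \<noteq> \<infinity>" for q using emeasure_lborel_ball_finite[of q r] by simp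
  qed auto
  also have "\<dots> = real (card Q) * (?v * r ^ DIM('a))" using ms[OF assms(2)] by simp
  finally have "real (card Q) * (?v * r ^ DIM('a)) = measure lborel (\<Union>q\<in>Q. ball q r)" by simp
  also have "\<dots> \<le> measure lborel (cball c R)"
  proof (rule measure_mono_fmeasurable)
    show "(\<Union>q\<in>Q. ball q r) \<subseteq> cball c R" using sub ball_subset_cball by fastforce
    show "cball c R \<in> fmeasurable lborel" using emeasure_lborel_cball_finite[of c R] by (auto intro!: fmeasurableI)
    show "(\<Union>q\<in>Q. ball q r) \<in> sets lborel" by (auto intro!: borel_open)
  qed
  also have "\<dots> = ?v * R ^ DIM('a)" using content_cball[OF assms(3), of c] by simp
  finally have "?v * (real (card Q) * r ^ DIM('a)) \<le> ?v * R ^ DIM('a)" by (simp add: mult_ac)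
  then show ?thesis using v by (simp add: mult_le_cancel_left)
qed

text \<open>A separated set of largest cardinality is also a net: a point outside all balls could be
  added. The bound \<open>N\<close> guarantees that a largest one exists. This turns a count of
  separated points into a cover.\<close>

lemma maximal_separated_set:
  fixes A :: "'a::metric_space set"
  assumes bound: "\<And>Y. finite Y \<Longrightarrow> Y \<subseteq> A \<Longrightarrow> (\<And>y y'. y \<in> Y \<Longrightarrow> y' \<in> Y \<Longrightarrow> y \<noteq> y' \<Longrightarrow> s \<le> dist y y') \<Longrightarrow> card Y \<le> N"
    and s: "s > 0"
  obtains Y where "finite Y" "Y \<subseteq> A" "\<And>y y'. y \<in> Y \<Longrightarrow> y' \<in> Y \<Longrightarrow> y \<noteq> y' \<Longrightarrow> s \<le> dist y y'"
    "A \<subseteq> (\<Union>y\<in>Y. cball y s)"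
proof -
  define P where "P Y \<longleftrightarrow> finite Y \<and> Y \<subseteq> A \<and> (\<forall>y\<in>Y. \<forall>y'\<in>Y. y \<noteq> y' \<longrightarrow> s \<le> dist y y')" for Y
  have "P {}" by (simp add: P_def)
  moreover have "\<forall>Y. P Y \<longrightarrow> card Y < Suc N" using bound by (simp add: P_def less_Suc_eq_le)
  ultimately obtain Y where Y: "P Y" "\<And>Y'. P Y' \<Longrightarrow> card Y' \<le> card Y"
    using ex_has_greatest_nat[of P "{}" card "Suc N"] by auto
  have "A \<subseteq> (\<Union>y\<in>Y. cball y s)"
  proof
    fix a assume a: "a \<in> A"
    show "a \<in> (\<Union>y\<in>Y. cball y s)"
    proof (rule ccontr)
      assume "\<not> ?thesis"
      then have far: "\<And>y. y \<in> Y \<Longrightarrow> s < dist y a" by auto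
      then have "a \<notin> Y" using s by force
      have "P (insert a Y)"
        unfolding P_def
      proof (intro conjI ballI impI)
        fix y y' assume "y \<in> insert a Y" "y' \<in> insert a Y" "y \<noteq> y'"
        then show "s \<le> dist y y'"
          using far[of y] far[of y'] Y(1) unfolding P_def by (auto simp: dist_commute less_imp_le)
      qed (use Y(1) a in \<open>auto simp: P_def\<close>)
      then have "card (insert a Y) \<le> card Y" by (rule Y(2))
      then show False using \<open>a \<notin> Y\<close> Y(1) by (simp add: P_def)
    qed
  qed
  with Y(1) show thesis by (intro that[of Y]) (simp_all add: P_def)
qed

lemma hausdorff_pre_finite_cover:
  assumes m: "m \<ge> 1" and "finite Y" and d: "\<delta> \<ge> 0" and "A \<subseteq> (\<Union>y\<in>Y. C y)"
    and C: "\<And>y. y \<in> Y \<Longrightarrow> bounded (C y) \<and> diameter (C y) \<le> \<delta>"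
  shows "hausdorff_pre m \<delta> A \<le> (\<Sum>y\<in>Y. hweight m (C y))"
proof -
  obtain f where f: "bij_betw f {..<card Y} Y"
    using ex_bij_betw_nat_finite[OF assms(2)] by (auto simp: atLeast0LessThan)
  define E where "E i = (if i < card Y then C (f i) else {})" for i
  have fY: "f i \<in> Y" if "i < card Y" for i using f that by (auto simp: bij_betw_def)
  have "A \<subseteq> (\<Union>i. E i)"
  proof
    fix a assume "a \<in> A"
    then obtain y where "y \<in> Y" "a \<in> C y" using assms(4) by auto
    moreover obtain i where "i < card Y" "y = f i" using f \<open>y \<in> Y\<close> by (auto simp: bij_betw_def)
    ultimately show "a \<in> (\<Union>i. E i)" by (auto simp: E_def)
  qed
  then have "E \<in> hcovers \<delta> A" using C fY d by (auto simp: hcovers_def E_def)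
  then have "hausdorff_pre m \<delta> A \<le> (\<Sum>i. hweight m (E i))" by (rule hausdorff_pre_le)
  also have "\<dots> = (\<Sum>i<card Y. hweight m (E i))"
    by (rule suminf_finite) (auto simp: E_def hweight_empty[OF m])
  also have "\<dots> = (\<Sum>i<card Y. hweight m (C (f i)))" by (rule sum.cong) (auto simp: E_def)
  also have "\<dots> = (\<Sum>y\<in>Y. hweight m (C y))" by (rule sum.reindex_bij_betw[OF f])
  finally show ?thesis .
qed

lemma uniform_coneE:
  assumes "uniform_cone r0 S" "p \<in> frontier S"
  obtains \<xi> where "norm \<xi> = 1"
    "\<And>y w. y \<in> frontier S \<Longrightarrow> dist p y < r0 \<Longrightarrow> w \<noteq> 0 \<Longrightarrow> norm w < r0 \<Longrightarrow> norm w / 2 \<le> \<xi> \<bullet> w \<Longrightarrow> y + w \<in> S"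
    "\<And>y w. y \<in> frontier S \<Longrightarrow> dist p y < r0 \<Longrightarrow> w \<noteq> 0 \<Longrightarrow> norm w < r0 \<Longrightarrow> norm w / 2 \<le> \<xi> \<bullet> w \<Longrightarrow> y - w \<notin> closure S"
proof -
  obtain \<xi> where *: "norm \<xi> = 1" "\<forall>y\<in>frontier S \<inter> ball p r0. \<forall>w. w \<noteq> 0 \<longrightarrow> norm w < r0 \<longrightarrow> norm w / 2 \<le> \<xi> \<bullet> w \<longrightarrow>
        y + w \<in> S \<and> y - w \<notin> closure S"
    using assms unfolding uniform_cone_def by blast
  show thesis
    by (rule that[OF *(1)]; use *(2) in \<open>simp\<close>)
qed

text \<open>No secant of the boundary lies in the cone. Hence for \<open>s\<close>-separated boundary points \<open>y\<close> the balls of radius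
  \<open>s/3\<close> around \<open>y + n s \<xi>\<close> are disjoint, and their volumes bound the number of the points.\<close>

lemma hausdorff_outer_frontier_upper:
  fixes S :: "'a::euclidean_space set"
  assumes d: "DIM('a) \<ge> 2" and cone: "uniform_cone r0 S" and S: "open S"
    and p: "p \<in> frontier S" and \<rho>: "0 < \<rho>" "\<rho> \<le> r0 / 2"
  shows "hausdorff_outer (DIM('a) - 1) (frontier S \<inter> ball p \<rho>) \<le>
    ennreal (9 ^ DIM('a) * unit_ball_vol (real (DIM('a) - 1)) * \<rho> ^ (DIM('a) - 1))"
proof -
  let ?m = "DIM('a) - 1" let ?A = "frontier S \<inter> ball p \<rho>"
  obtain \<xi> where \<xi>: "norm \<xi> = 1" and 
    cn: "\<And>y w. y \<in> frontier S \<Longrightarrow> dist p y < r0 \<Longrightarrow> w \<noteq> 0 \<Longrightarrow> norm w < r0 \<Longrightarrow> norm w / 2 \<le> \<xi> \<bullet> w \<Longrightarrow> y + w \<in> S"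
    by (rule uniform_coneE[OF cone p]) (rule that)
  have dS: "DIM('a) = Suc ?m" using d by simp
  have nd: "frontier S \<inter> S = {}" using S by (simp add: frontier_disjoint_eq)
  have half: "\<xi> \<bullet> (y' - y) < norm (y' - y) / 2" if "y \<in> ?A" "y' \<in> ?A" "y \<noteq> y'" for y y'
  proof (rule ccontr)
    assume "\<not> ?thesis"
    moreover have "norm (y' - y) < r0"
      using that \<rho> dist_triangle2[of y' y p] by (simp add: dist_commute flip: dist_norm)
    ultimately have "y + (y' - y) \<in> S" using that \<rho> by (intro cn) auto
    then show False using nd that by auto
  qed
  have count: "real (card Y) * s ^ ?m \<le> 9 ^ DIM('a) * \<rho> ^ ?m"
    if Y: "finite Y" "Y \<subseteq> ?A" "\<And>y y'. y \<in> Y \<Longrightarrow> y' \<in> Y \<Longrightarrow> y \<noteq> y' \<Longrightarrow> s \<le> dist y y'"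
      and s: "0 < s" "s \<le> \<rho>" for Y s
  proof -
    \<comment> \<open>Shifts by \<open>n * s\<close> with \<open>n \<le> M\<close> have length at
      most \<open>\<rho>\<close>, so all balls lie in a ball of radius \<open>3 * \<rho>\<close>.
      That \<open>(M + 1) * s\<close> exceeds \<open>\<rho>\<close> later trades one power of
      \<open>s\<close> for one of \<open>\<rho>\<close> and lowers the exponent from
      \<open>DIM('a)\<close> to \<open>DIM('a) - 1\<close>.\<close>
    define M where "M = nat \<lfloor>\<rho> / s\<rfloor>"
    have M: "real M * s \<le> \<rho>" "\<rho> < (real M + 1) * s"
    proof -
      have r: "real M = of_int \<lfloor>\<rho> / s\<rfloor>" using s \<rho> by (simp add: M_def)
      have "real M \<le> \<rho> / s" "\<rho> / s < real M + 1" unfolding r by linarith+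
      then show "real M * s \<le> \<rho>" "\<rho> < (real M + 1) * s" using s by (simp_all add: field_simps)
    qed
    define q where "q = (\<lambda>(y, n). y + (real n * s) *\<^sub>R \<xi>)"
    have sepq: "2 * s / 3 \<le> dist (q (y, n)) (q (y', n'))" if "y \<in> Y" "y' \<in> Y" "(y, n) \<noteq> (y', n')" for y y' n n'
    proof (cases "y = y'")
      case True
      then have "n \<noteq> n'" using that by auto
      then have "1 \<le> \<bar>real n - real n'\<bar>" by linarith
      moreover have "q (y, n) - q (y', n') = ((real n - real n') * s) *\<^sub>R \<xi>"
        using True by (simp add: q_def algebra_simps)
      then have "dist (q (y, n)) (q (y', n')) = \<bar>real n - real n'\<bar> * s"
        using s \<xi> by (simp add: dist_norm abs_mult)
      moreover have "s \<le> \<bar>real n - real n'\<bar> * s" using calculation(1) s by simp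
      ultimately show ?thesis using s by simp
    next
      case False
      define w where "w = y - y'"
      define t where "t = (real n - real n') * s"
      have dw: "dist (q (y, n)) (q (y', n')) = norm (w + t *\<^sub>R \<xi>)"
        by (simp add: dist_norm q_def w_def t_def algebra_simps)
      have "\<xi> \<bullet> w < norm w / 2" "\<xi> \<bullet> (- w) < norm w / 2"
        using half[OF subsetD[OF Y(2) that(2)] subsetD[OF Y(2) that(1)]]
          half[OF subsetD[OF Y(2) that(1)] subsetD[OF Y(2) that(2)]] False
        by (auto simp: w_def norm_minus_commute)
      \<comment> \<open>Minimising over \<open>t\<close> leaves
        \<open>(norm w)\<^sup>2 - (\<xi> \<bullet> w)\<^sup>2\<close>, which is at least 3/4 of
        \<open>(norm w)\<^sup>2\<close>. The separation 2/3 needs only 4/9.\<close>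
      then have "(\<xi> \<bullet> w)\<^sup>2 \<le> (norm w / 2)\<^sup>2" by (intro power2_le_iff_abs_le[THEN iffD2]) auto
      moreover have "(norm (w + t *\<^sub>R \<xi>))\<^sup>2 = (norm w)\<^sup>2 + 2 * t * (\<xi> \<bullet> w) + t\<^sup>2"
        unfolding power2_norm_eq_inner using \<xi>
        by (simp add: inner_add_left inner_add_right inner_commute norm_eq_1 power2_eq_square)
      moreover have "0 \<le> (t + \<xi> \<bullet> w)\<^sup>2" by simp
      ultimately have "3 / 4 * (norm w)\<^sup>2 \<le> (norm (w + t *\<^sub>R \<xi>))\<^sup>2"
        by (simp add: power2_eq_square algebra_simps)
      moreover have "s \<le> norm w" using Y(3)[OF that(1,2) False] by (simp add: w_def dist_norm)
      then have "s\<^sup>2 \<le> (norm w)\<^sup>2" using s by (intro power_mono) auto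
      ultimately have "(2 * s / 3)\<^sup>2 \<le> (norm (w + t *\<^sub>R \<xi>))\<^sup>2"
      proof (elim rev_mp, intro impI)
        assume that: "3 / 4 * (norm w)\<^sup>2 \<le> (norm (w + t *\<^sub>R \<xi>))\<^sup>2" "s\<^sup>2 \<le> (norm w)\<^sup>2"
        have "(2 * s / 3)\<^sup>2 = 4 / 9 * s\<^sup>2" by (simp add: power2_eq_square)
        with that zero_le_power2[of s] show ?thesis by linarith
      qed
      then have "2 * s / 3 \<le> norm (w + t *\<^sub>R \<xi>)" by (rule power2_le_imp_le) simp
      then show ?thesis by (simp add: dw)
    qed
    have "inj_on q (Y \<times> {..M})"
    proof (rule inj_onI)
      fix a b assume ab: "a \<in> Y \<times> {..M}" "b \<in> Y \<times> {..M}" "q a = q b"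
      show "a = b"
      proof (rule ccontr)
        assume "a \<noteq> b"
        then have "2 * s / 3 \<le> dist (q a) (q b)"
          using sepq[of "fst a" "fst b" "snd a" "snd b"] ab(1,2) by (simp add: mem_Times_iff)
        then show False using ab(3) s by simp
      qed
    qed
    then have cq: "card (q ` (Y \<times> {..M})) = card Y * (M + 1)"
      using Y(1) by (simp add: card_image card_cartesian_product)
    have "real (card (q ` (Y \<times> {..M}))) * (s / 3) ^ DIM('a) \<le> (3 * \<rho>) ^ DIM('a)"
    proof (rule packing_card[where c = p])
      show "cball z (s / 3) \<subseteq> cball p (3 * \<rho>)" if z: "z \<in> q ` (Y \<times> {..M})" for z
      proof
        fix u assume u: "u \<in> cball z (s / 3)"
        obtain y n where yn: "y \<in> Y" "n \<le> M" "z = y + (real n * s) *\<^sub>R \<xi>" using z by (auto simp: q_def)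
        have "dist y z = real n * s" using yn \<xi> s by (simp add: dist_norm)
        also have "\<dots> \<le> real M * s" using yn s by simp
        finally have "dist y z \<le> \<rho>" using M by simp
        moreover have "dist p y < \<rho>" using yn Y(2) by auto
        moreover have "dist p u \<le> dist p y + dist y z + dist z u" 
          using dist_triangle[of p u y] dist_triangle[of y u z] by linarith
        ultimately show "u \<in> cball p (3 * \<rho>)" using u s by auto
      qed
    next
      fix z z' assume "z \<in> q ` (Y \<times> {..M})" "z' \<in> q ` (Y \<times> {..M})" and ne: "z \<noteq> z'"
      then obtain y n y' n' where z: "y \<in> Y" "y' \<in> Y" "z = q (y, n)" "z' = q (y', n')" by auto
      then show "2 * (s / 3) \<le> dist z z'" using sepq[of y y' n n'] ne by auto
    qed (use Y s \<rho> in auto)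
    then have a: "real (card Y) * (real M + 1) * s ^ DIM('a) \<le> 9 ^ DIM('a) * \<rho> ^ DIM('a)"
    proof (rule rev_mp, intro impI)
      assume that: "real (card (q ` (Y \<times> {..M}))) * (s / 3) ^ DIM('a) \<le> (3 * \<rho>) ^ DIM('a)"
      \<comment> \<open>One factor 3 per dimension comes from the large radius
        \<open>3 * \<rho>\<close>, the other from the small radius \<open>s / 3\<close>.\<close>
      have "(9::real) ^ DIM('a) = 3 ^ DIM('a) * 3 ^ DIM('a)" by (simp flip: power_mult_distrib)
      then show ?thesis using that unfolding cq power_divide power_mult_distrib
        by (simp add: divide_le_eq algebra_simps)
    qed
    have "real (card Y) * s ^ ?m * \<rho> \<le> real (card Y) * s ^ ?m * ((real M + 1) * s)"
      using M(2) s by (intro mult_left_mono) auto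
    also have "\<dots> = real (card Y) * (real M + 1) * s ^ DIM('a)"
      by (subst (2) dS) (simp only: power_Suc mult_ac)
    also have "\<dots> \<le> 9 ^ DIM('a) * \<rho> ^ DIM('a)" by (rule a)
    also have "\<dots> = (9 ^ DIM('a) * \<rho> ^ ?m) * \<rho>"
      by (subst (2) dS) (simp only: power_Suc mult_ac)
    finally show ?thesis using \<rho> by simp
  qed
  show ?thesis unfolding hausdorff_outer_def
  proof (rule SUP_least)
    fix \<delta> :: real assume "\<delta> \<in> {0<..}" then have \<delta>: "\<delta> > 0" by simp
    define s where "s = min \<rho> (\<delta> / 2)"
    have s: "0 < s" "s \<le> \<rho>" "2 * s \<le> \<delta>" using \<delta> \<rho> by (auto simp: s_def)
    obtain Y where Y: "finite Y" "Y \<subseteq> ?A" "\<And>y y'. y \<in> Y \<Longrightarrow> y' \<in> Y \<Longrightarrow> y \<noteq> y' \<Longrightarrow> s \<le> dist y y'"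
      "?A \<subseteq> (\<Union>y\<in>Y. cball y s)"
    proof (rule maximal_separated_set[of ?A s "nat \<lceil>9 ^ DIM('a) * \<rho> ^ ?m / s ^ ?m\<rceil>", OF _ s(1)])
      fix Y assume "finite Y" "Y \<subseteq> ?A" "\<And>y y'. y \<in> Y \<Longrightarrow> y' \<in> Y \<Longrightarrow> y \<noteq> y' \<Longrightarrow> s \<le> dist y y'"
      then have "real (card Y) * s ^ ?m \<le> 9 ^ DIM('a) * \<rho> ^ ?m" using count[of Y s] s by blast
      then have "real (card Y) \<le> 9 ^ DIM('a) * \<rho> ^ ?m / s ^ ?m" using s by (simp add: field_simps)
      then show "card Y \<le> nat \<lceil>9 ^ DIM('a) * \<rho> ^ ?m / s ^ ?m\<rceil>" by linarith
    qed (rule that)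
    have "hausdorff_pre ?m \<delta> ?A \<le> (\<Sum>y\<in>Y. hweight ?m (cball y s))"
      by (rule hausdorff_pre_finite_cover) (use d Y \<delta> s in auto)
    also have "\<dots> = ennreal (\<Sum>y\<in>Y. unit_ball_vol (real ?m) * s ^ ?m)"
      using s by (subst sum_ennreal[symmetric]) (auto simp: hweight_def intro!: sum.cong)
    also have "\<dots> = ennreal (unit_ball_vol (real ?m) * (real (card Y) * s ^ ?m))"
      by (simp add: mult_ac)
    also have "\<dots> \<le> ennreal (unit_ball_vol (real ?m) * (9 ^ DIM('a) * \<rho> ^ ?m))"
      using count[OF Y(1-3) s(1,2)] by (intro ennreal_leI mult_left_mono) auto
    finally show "hausdorff_pre ?m \<delta> ?A \<le> ennreal (9 ^ DIM('a) * unit_ball_vol (real ?m) * \<rho> ^ ?m)"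
      by (simp add: mult_ac)
  qed
qed

text \<open>The points that reach \<open>C\<close> by a shift of length at most
  \<open>\<rho>\<close> along \<open>\<xi>\<close> need not form a measurable set, hence the
  superset \<open>W\<close>. They lie within \<open>2 * \<eta>\<close> of the points
  \<open>c - n * \<eta> * \<xi>\<close>, and the factor 5 comes from
  \<open>2 * N + 1 \<le> 5 * \<rho> / \<eta>\<close>, the number of these points.\<close>

lemma thickened_segment_volume:
  fixes C :: "'a::euclidean_space set"
  assumes \<xi>: "norm \<xi> = 1" and C: "bounded C" "diameter C \<le> \<eta>" and \<eta>: "0 < \<eta>" "\<eta> \<le> \<rho>"
  obtains W where "W \<in> sets lborel" "{z. \<exists>s. \<bar>s\<bar> \<le> \<rho> \<and> z + s *\<^sub>R \<xi> \<in> C} \<subseteq> W"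
    "emeasure lborel W \<le> ennreal (unit_ball_vol (real DIM('a)) * 2 ^ DIM('a) * 5 * \<rho> * \<eta> ^ (DIM('a) - 1))"
proof (cases "C = {}")
  case True
  show thesis by (rule that[of "{}"]) (use True in auto)
next
  case False
  then obtain c where c: "c \<in> C" by auto
  define N where "N = \<lceil>\<rho> / \<eta>\<rceil>"
  have N: "of_int N * \<eta> \<ge> \<rho>" "of_int N \<le> 2 * (\<rho> / \<eta>)" "N \<ge> 1"
  proof -
    have 1: "1 \<le> \<rho> / \<eta>" using \<eta> by (simp add: field_simps)
    have "\<rho> / \<eta> \<le> of_int N" unfolding N_def by linarith
    then show "of_int N * \<eta> \<ge> \<rho>" using \<eta> by (simp add: field_simps)
    have "of_int N < \<rho> / \<eta> + 1" unfolding N_def by linarith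
    then show "of_int N \<le> 2 * (\<rho> / \<eta>)" using 1 by linarith
    show "N \<ge> 1" using \<open>\<rho> / \<eta> \<le> of_int N\<close> 1 by linarith
  qed
  define W where "W = (\<Union>n\<in>{-N..N}. cball (c - (of_int n * \<eta>) *\<^sub>R \<xi>) (2 * \<eta>))"
  show thesis
  proof (rule that)
    show "W \<in> sets lborel" by (simp add: W_def)
    show "{z. \<exists>s. \<bar>s\<bar> \<le> \<rho> \<and> z + s *\<^sub>R \<xi> \<in> C} \<subseteq> W"
    proof
      fix z assume "z \<in> {z. \<exists>s. \<bar>s\<bar> \<le> \<rho> \<and> z + s *\<^sub>R \<xi> \<in> C}"
      then obtain s where s: "\<bar>s\<bar> \<le> \<rho>" "z + s *\<^sub>R \<xi> \<in> C" by auto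
      define n where "n = \<lfloor>s / \<eta>\<rfloor>"
      have n: "of_int n * \<eta> \<le> s" "s \<le> (of_int n + 1) * \<eta>"
      proof -
        have "of_int n \<le> s / \<eta>" "s / \<eta> \<le> of_int n + 1" unfolding n_def by linarith+
        then show "of_int n * \<eta> \<le> s" "s \<le> (of_int n + 1) * \<eta>" using \<eta> by (simp_all add: field_simps)
      qed
      have "s \<le> of_int N * \<eta>" "- (of_int N * \<eta>) \<le> s" using s N by linarith+
      then have "s / \<eta> \<le> of_int N" "of_int (-N) \<le> s / \<eta>" using \<eta> by (simp_all add: field_simps)
      then have nN: "n \<in> {-N..N}" unfolding n_def by (simp add: le_floor_iff floor_le_iff)
      have "dist (c - (of_int n * \<eta>) *\<^sub>R \<xi>) z = norm ((c - (z + s *\<^sub>R \<xi>)) + (s - of_int n * \<eta>) *\<^sub>R \<xi>)"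
        by (simp add: dist_norm algebra_simps)
      also have "\<dots> \<le> norm (c - (z + s *\<^sub>R \<xi>)) + norm ((s - of_int n * \<eta>) *\<^sub>R \<xi>)" by (rule norm_triangle_ineq)
      also have "norm ((s - of_int n * \<eta>) *\<^sub>R \<xi>) \<le> \<eta>"
        unfolding norm_scaleR \<xi> using n by (simp add: abs_le_iff algebra_simps)
      also have "norm (c - (z + s *\<^sub>R \<xi>)) \<le> \<eta>"
        using diameter_bounded_bound[OF C(1) c s(2)] C(2) by (simp add: dist_norm)
      finally show "z \<in> W" using nN by (auto simp: W_def)
    qed
    have "emeasure lborel W \<le> (\<Sum>n\<in>{-N..N}. emeasure lborel (cball (c - (of_int n * \<eta>) *\<^sub>R \<xi>) (2 * \<eta>)))"
      unfolding W_def by (rule emeasure_subadditive_finite) auto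
    also have "\<dots> = ennreal (\<Sum>n\<in>{-N..N}. unit_ball_vol (real DIM('a)) * (2 * \<eta>) ^ DIM('a))"
      using \<eta> by (subst sum_ennreal[symmetric]) (auto simp: emeasure_cball_eq)
    also have "(\<Sum>n\<in>{-N..N}. unit_ball_vol (real DIM('a)) * (2 * \<eta>) ^ DIM('a)) =
        (2 * of_int N + 1) * (unit_ball_vol (real DIM('a)) * (2 * \<eta>) ^ DIM('a))"
      using N by simp
    also have "\<dots> \<le> (5 * (\<rho> / \<eta>)) * (unit_ball_vol (real DIM('a)) * (2 * \<eta>) ^ DIM('a))"
    proof (intro mult_right_mono)
      have "1 \<le> \<rho> / \<eta>" using \<eta> by (simp add: field_simps)
      then show "2 * of_int N + 1 \<le> 5 * (\<rho> / \<eta>)" using N(2) by linarith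
    qed (use \<eta> in auto)
    also have "\<dots> = unit_ball_vol (real DIM('a)) * 2 ^ DIM('a) * 5 * \<rho> * (\<eta> ^ DIM('a) / \<eta>)"
      by (simp add: power_mult_distrib)
    also have "\<eta> ^ DIM('a) / \<eta> = \<eta> ^ (DIM('a) - 1)"
      using \<eta> power_diff[of \<eta> 1 "DIM('a)"] by (simp add: DIM_ge_Suc0)
    finally show "emeasure lborel W \<le> ennreal (unit_ball_vol (real DIM('a)) * 2 ^ DIM('a) * 5 * \<rho> * \<eta> ^ (DIM('a) - 1))"
      by (simp add: ennreal_leI)
  qed
qed

text \<open>Lines in the axis direction of the cone cross the boundary, so thickening a cover of the
  boundary by segments in this direction covers a ball.\<close>

lemma hausdorff_outer_frontier_lower:
  assumes d: "DIM('a::euclidean_space) \<ge> 2"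
  obtains c where "c > 0" "\<And>(S :: 'a set) r0 x \<rho>. uniform_cone r0 S \<Longrightarrow> x \<in> frontier S \<Longrightarrow>
    0 < \<rho> \<Longrightarrow> \<rho> \<le> r0 \<Longrightarrow> ennreal (c * \<rho> ^ (DIM('a) - 1)) \<le> hausdorff_outer (DIM('a) - 1) (frontier S \<inter> ball x \<rho>)"
proof -
  let ?d = "DIM('a)" let ?m = "?d - 1"
  define v where "v = unit_ball_vol (real ?d)" define u where "u = unit_ball_vol (real ?m)"
  have vu: "v > 0" "u > 0" by (simp_all add: v_def u_def)
  have hw: "hweight ?m C = ennreal (u * (diameter C / 2) ^ ?m)" for C :: "'a set"
    by (simp add: hweight_def u_def)
  have dS: "?d = Suc ?m" using d by simp
  define K where "K = v * 2 ^ ?d * 5"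
  have K: "K > 0" by (simp add: K_def vu)
  \<comment> \<open>Converts the volume factor \<open>K\<close> into a multiple of
    \<open>hweight\<close>, whose normalisation is \<open>u * (diameter C / 2) ^ m\<close>.\<close>
  define K' where "K' = K * 2 ^ ?m / u"
  have K': "K' > 0" using K vu by (simp add: K'_def)
  define c where "c = v * (1/8) ^ ?d / K'"
  show thesis
  proof (rule that)
    show "c > 0" using K' vu by (simp add: c_def)
    fix S :: "'a set" and r0 x \<rho>
    assume cone: "uniform_cone r0 S" and x: "x \<in> frontier S" and \<rho>: "0 < \<rho>" "\<rho> \<le> r0"
    let ?A = "frontier S \<inter> ball x \<rho>"
    obtain \<xi> where \<xi>: "norm \<xi> = 1" and 
      c1: "\<And>y w. y \<in> frontier S \<Longrightarrow> dist x y < r0 \<Longrightarrow> w \<noteq> 0 \<Longrightarrow> norm w < r0 \<Longrightarrow> norm w / 2 \<le> \<xi> \<bullet> w \<Longrightarrow> y + w \<in> S" and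
      c2: "\<And>y w. y \<in> frontier S \<Longrightarrow> dist x y < r0 \<Longrightarrow> w \<noteq> 0 \<Longrightarrow> norm w < r0 \<Longrightarrow> norm w / 2 \<le> \<xi> \<bullet> w \<Longrightarrow> y - w \<notin> closure S"
      by (rule uniform_coneE[OF cone x]) (rule that)
    have cross: "\<exists>s. \<bar>s\<bar> \<le> \<rho> \<and> z + s *\<^sub>R \<xi> \<in> ?A" if z: "z \<in> cball x (\<rho> / 8)" for z
    proof -
      define e where "e = z - x"
      have e: "norm e \<le> \<rho> / 8" using z by (simp add: e_def dist_norm norm_minus_commute)
      \<comment> \<open>For \<open>norm f \<le> \<rho> / 8\<close> the vector
        \<open>t *\<^sub>R \<xi> + f\<close> has norm at most \<open>\<rho> / 2\<close> and axial
        component at least \<open>\<rho> / 4\<close>. So 3/8 and 1/8 just meet the cone condition,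
        and the ends of the segment lie on different sides of the frontier.\<close>
      define t where "t = 3 * \<rho> / 8"
      have nt: "norm (t *\<^sub>R \<xi>) = t" using \<xi> \<rho> by (simp add: t_def)
      have \<xi>\<xi>: "\<xi> \<bullet> \<xi> = 1" using \<xi> by (simp add: norm_eq_1)
      have eb: "\<bar>\<xi> \<bullet> e\<bar> \<le> norm e" using Cauchy_Schwarz_ineq2[of \<xi> e] \<xi> by simp
      have *: "norm (t *\<^sub>R \<xi> + f) \<le> \<rho> / 2" "norm (t *\<^sub>R \<xi> + f) / 2 \<le> \<xi> \<bullet> (t *\<^sub>R \<xi> + f)" "t *\<^sub>R \<xi> + f \<noteq> 0"
        if f: "norm f \<le> \<rho> / 8" for f
      proof -
        have fb: "\<bar>\<xi> \<bullet> f\<bar> \<le> norm f" using Cauchy_Schwarz_ineq2[of \<xi> f] \<xi> by simp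
        have n1: "norm (t *\<^sub>R \<xi> + f) \<le> t + norm f" using norm_triangle_ineq[of "t *\<^sub>R \<xi>" f] nt by simp
        then show "norm (t *\<^sub>R \<xi> + f) \<le> \<rho> / 2" using f by (simp add: t_def)
        have n2: "t - norm f \<le> \<xi> \<bullet> (t *\<^sub>R \<xi> + f)" using fb by (simp add: inner_add_right \<xi>\<xi>)
        show "norm (t *\<^sub>R \<xi> + f) / 2 \<le> \<xi> \<bullet> (t *\<^sub>R \<xi> + f)" using n1 n2 f by (simp add: t_def)
        have "0 < \<xi> \<bullet> (t *\<^sub>R \<xi> + f)" using n2 f \<rho> by (simp add: t_def)
        then show "t *\<^sub>R \<xi> + f \<noteq> 0" by force
      qed
      have r0: "r0 > 0" "\<rho> / 2 < r0" using \<rho> by auto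
      have "x + (t *\<^sub>R \<xi> + e) \<in> S"
        by (rule c1) (use x *[OF e] r0 in auto)
      then have in1: "z + t *\<^sub>R \<xi> \<in> S" by (simp add: e_def algebra_simps)
      have "x - (t *\<^sub>R \<xi> + (- e)) \<notin> closure S"
        by (rule c2) (use x *[of "- e"] e r0 in auto)
      then have in2: "z + (- t) *\<^sub>R \<xi> \<notin> S" using closure_subset by (auto simp: e_def algebra_simps)
      define L where "L = (\<lambda>s. z + s *\<^sub>R \<xi>) ` {-t..t}"
      have t0: "t > 0" using \<rho> by (simp add: t_def)
      have "connected L" unfolding L_def by (intro connected_continuous_image continuous_intros) auto
      moreover have "z + t *\<^sub>R \<xi> \<in> L" "z + (- t) *\<^sub>R \<xi> \<in> L" using t0 unfolding L_def by (auto intro!: imageI simp del: scaleR_minus_left)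
      then have "L \<inter> S \<noteq> {}" "L - S \<noteq> {}" using in1 in2 by blast+
      ultimately have "L \<inter> frontier S \<noteq> {}" by (rule connected_Int_frontier)
      then obtain s where s: "-t \<le> s" "s \<le> t" "z + s *\<^sub>R \<xi> \<in> frontier S" by (auto simp: L_def)
      have "dist x (z + s *\<^sub>R \<xi>) = norm (e + s *\<^sub>R \<xi>)" by (simp add: dist_norm e_def norm_minus_commute algebra_simps)
      also have "\<dots> \<le> norm e + \<bar>s\<bar>" using norm_triangle_ineq[of e "s *\<^sub>R \<xi>"] \<xi> by simp
      also have "\<dots> < \<rho>" using s e \<rho> by (simp add: t_def)
      finally show ?thesis using s \<rho> by (intro exI[of _ s]) (auto simp: t_def)
    qed
    have "ennreal (c * \<rho> ^ ?m) \<le> hausdorff_pre ?m \<rho> ?A"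
      unfolding hausdorff_pre_alt
    proof (rule INF_greatest)
      fix C assume C: "C \<in> hcovers \<rho> ?A"
      have "ennreal (v * (\<rho> / 8) ^ ?d) \<le> ennreal (K' * \<rho>) * (\<Sum>i. hweight ?m (C i))"
      proof (rule ennreal_le_epsilon)
        fix \<epsilon> :: real assume \<epsilon>: "\<epsilon> > 0"
        \<comment> \<open>Covering sets may have diameter 0, whereas thickening needs a positive
          size. The replacement values \<open>\<tau> i\<close> add up to an error of at most
          \<open>\<epsilon>\<close>, and \<open>\<tau> i \<le> 1\<close> makes their powers
          harmless.\<close>
        define \<tau> where "\<tau> i = min (min 1 \<rho>) (\<epsilon> / (K * \<rho>) * (1/2) ^ Suc i)" for i :: nat
        have \<tau>: "0 < \<tau> i" "\<tau> i \<le> \<rho>" "\<tau> i \<le> 1" "\<tau> i \<le> \<epsilon> / (K * \<rho>) * (1/2) ^ Suc i" for i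
          using \<epsilon> K \<rho> by (auto simp: \<tau>_def)
        define \<eta> where "\<eta> i = max (diameter (C i)) (\<tau> i)" for i
        have Ci: "bounded (C i)" "diameter (C i) \<le> \<rho>" for i using C by (auto simp: hcovers_def)
        have "\<exists>W. W \<in> sets lborel \<and> {z. \<exists>s. \<bar>s\<bar> \<le> \<rho> \<and> z + s *\<^sub>R \<xi> \<in> C i} \<subseteq> W \<and>
           emeasure lborel W \<le> ennreal (K * \<rho> * \<eta> i ^ ?m)" for i
          by (rule thickened_segment_volume[OF \<xi> Ci(1), of i "\<eta> i" \<rho>])
             (use \<tau>[of i] Ci[of i] in \<open>auto simp: \<eta>_def K_def v_def\<close>)
        then have "\<forall>i. \<exists>W. W \<in> sets lborel \<and> {z. \<exists>s. \<bar>s\<bar> \<le> \<rho> \<and> z + s *\<^sub>R \<xi> \<in> C i} \<subseteq> W \<and>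
           emeasure lborel W \<le> ennreal (K * \<rho> * \<eta> i ^ ?m)" by (rule allI)
        from choice[OF this] obtain W where "\<forall>i. W i \<in> sets lborel \<and>
           {z. \<exists>s. \<bar>s\<bar> \<le> \<rho> \<and> z + s *\<^sub>R \<xi> \<in> C i} \<subseteq> W i \<and> emeasure lborel (W i) \<le> ennreal (K * \<rho> * \<eta> i ^ ?m)"
          by (rule exE)
        then have W: "\<And>i. W i \<in> sets lborel" "\<And>i. {z. \<exists>s. \<bar>s\<bar> \<le> \<rho> \<and> z + s *\<^sub>R \<xi> \<in> C i} \<subseteq> W i"
           "\<And>i. emeasure lborel (W i) \<le> ennreal (K * \<rho> * \<eta> i ^ ?m)"
          by simp_all
        have "cball x (\<rho> / 8) \<subseteq> (\<Union>i. W i)"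
        proof
          fix z assume "z \<in> cball x (\<rho> / 8)"
          then obtain s where s: "\<bar>s\<bar> \<le> \<rho>" "z + s *\<^sub>R \<xi> \<in> ?A" using cross by blast
          then obtain i where "z + s *\<^sub>R \<xi> \<in> C i" using C unfolding hcovers_def by blast
          then show "z \<in> (\<Union>i. W i)" using s W(2)[of i] by blast
        qed
        then have "emeasure lborel (cball x (\<rho> / 8)) \<le> emeasure lborel (\<Union>i. W i)"
          using W(1) by (intro emeasure_mono) auto
        also have "\<dots> \<le> (\<Sum>i. emeasure lborel (W i))"
          using W(1) by (intro emeasure_subadditive_countably) auto
        also have "\<dots> \<le> (\<Sum>i. ennreal (K' * \<rho>) * hweight ?m (C i) + ennreal (\<epsilon> * (1/2) ^ Suc i))"
        proof (rule suminf_le)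
          fix i
          have dn: "0 \<le> diameter (C i)" using diameter_ge_0[OF Ci(1)] .
          have "\<eta> i ^ ?m \<le> diameter (C i) ^ ?m + \<tau> i ^ ?m"
            using dn \<tau>(1)[of i] by (auto simp: \<eta>_def max_def)
          also have "\<tau> i ^ ?m \<le> \<tau> i"
            using \<tau>[of i] d power_decreasing[of 1 ?m "\<tau> i"] by simp
          also have "\<tau> i \<le> \<epsilon> / (K * \<rho>) * (1/2) ^ Suc i" by (rule \<tau>(4))
          finally have "K * \<rho> * \<eta> i ^ ?m \<le> K * \<rho> * (diameter (C i) ^ ?m + \<epsilon> / (K * \<rho>) * (1/2) ^ Suc i)"
            using K \<rho> by (intro mult_left_mono) auto
          also have "\<dots> = K' * \<rho> * (u * (diameter (C i) / 2) ^ ?m) + \<epsilon> * (1/2) ^ Suc i"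
            using K \<rho> vu by (simp add: K'_def power_divide distrib_left del: power_Suc)
          finally have "ennreal (K * \<rho> * \<eta> i ^ ?m) \<le> ennreal (K' * \<rho> * (u * (diameter (C i) / 2) ^ ?m) + \<epsilon> * (1/2) ^ Suc i)"
            by (rule ennreal_leI)
          also have "\<dots> = ennreal (K' * \<rho>) * hweight ?m (C i) + ennreal (\<epsilon> * (1/2) ^ Suc i)"
            unfolding hw using K' \<rho> vu dn \<epsilon> by (simp add: ennreal_plus ennreal_mult)
          finally show "emeasure lborel (W i) \<le> ennreal (K' * \<rho>) * hweight ?m (C i) + ennreal (\<epsilon> * (1/2) ^ Suc i)"
            using W(3)[of i] by (rule order_trans[rotated])
        qed auto
        also have "\<dots> = (\<Sum>i. ennreal (K' * \<rho>) * hweight ?m (C i)) + (\<Sum>i. ennreal (\<epsilon> * (1/2) ^ Suc i))"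
          by (rule suminf_add[symmetric]) auto
        also have "(\<Sum>i. ennreal (\<epsilon> * (1/2) ^ Suc i)) = ennreal \<epsilon>"
          using sums_mult[OF power_half_series, of \<epsilon>] \<epsilon> by (intro suminf_ennreal_eq) auto
        also have "(\<Sum>i. ennreal (K' * \<rho>) * hweight ?m (C i)) = ennreal (K' * \<rho>) * (\<Sum>i. hweight ?m (C i))"
          by (rule ennreal_suminf_cmult)
        finally show "ennreal (v * (\<rho> / 8) ^ ?d) \<le> ennreal (K' * \<rho>) * (\<Sum>i. hweight ?m (C i)) + ennreal \<epsilon>"
          using \<rho> by (simp add: emeasure_cball_eq v_def)
      qed
      moreover have "ennreal (v * (\<rho> / 8) ^ ?d) = ennreal (K' * \<rho>) * ennreal (c * \<rho> ^ ?m)"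
      proof -
        have "v * (\<rho> / 8) ^ ?d = (K' * \<rho>) * (c * \<rho> ^ ?m)"
        proof -
          have "\<rho> ^ ?d = \<rho> * \<rho> ^ ?m" by (subst dS) (rule power_Suc)
          then show ?thesis using K' by (simp add: c_def power_divide)
        qed
        then show ?thesis using K' \<rho> vu by (simp add: ennreal_mult[symmetric] c_def)
      qed
      ultimately have "ennreal (K' * \<rho>) * ennreal (c * \<rho> ^ ?m) \<le> ennreal (K' * \<rho>) * (\<Sum>i. hweight ?m (C i))"
        by simp
      then show "ennreal (c * \<rho> ^ ?m) \<le> (\<Sum>i. hweight ?m (C i))"
        using K' \<rho> by (subst (asm) ennreal_mult_le_mult_iff) auto
    qed
    also have "\<dots> \<le> hausdorff_outer ?m ?A" by (rule hausdorff_pre_le_outer[OF \<rho>(1)])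
    finally show "ennreal (c * \<rho> ^ ?m) \<le> hausdorff_outer ?m ?A" .
  qed
qed

text \<open>If \<open>h \<le> r0 / 4\<close>, one ball of radius \<open>2 * h\<close> around a point
  of the intersection suffices. Otherwise the whole frontier is covered by a number of balls that
  depends on \<Omega> and \<open>r0\<close> only, and \<open>r0 < 4 * h\<close> lets
  \<open>h\<close> absorb their radius.\<close>

lemma surface_frontier_upper:
  fixes \<Omega> :: "'a::euclidean_space set"
  assumes d: "DIM('a) \<ge> 2" and \<Omega>: "bounded \<Omega>" and r0: "r0 > 0"
  obtains C where "C > 0" "\<And>S A. uniform_cone r0 S \<Longrightarrow> open S \<Longrightarrow> S \<subseteq> \<Omega> \<Longrightarrow> compact A \<Longrightarrow> diameter A > 0 \<Longrightarrow>
    emeasure surface_measure (A \<inter> frontier S) \<le> ennreal (C * diameter A ^ (DIM('a) - 1))"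
proof -
  let ?m = "DIM('a) - 1"
  define U where "U = 9 ^ DIM('a) * unit_ball_vol (real ?m)"
  have U: "U > 0" by (simp add: U_def)
  have "compact (closure \<Omega>)" using \<Omega> by simp
  moreover have "closure \<Omega> \<subseteq> (\<Union>z\<in>closure \<Omega>. ball z (r0 / 4))" using r0 by auto
  ultimately obtain Z where Z: "Z \<subseteq> closure \<Omega>" "finite Z" "closure \<Omega> \<subseteq> (\<Union>z\<in>Z. ball z (r0 / 4))"
    using compactE_image[of "closure \<Omega>" "closure \<Omega>" "\<lambda>z. ball z (r0/4)"] by auto
  define C where "C = (real (card Z) + 1) * U * 2 ^ ?m"
  have C: "C > 0" using U by (simp add: C_def add_nonneg_pos)
  show thesis
  proof (rule that[OF C])
    fix S A :: "'a set"
    assume cone: "uniform_cone r0 S" and S: "open S" "S \<subseteq> \<Omega>" and A: "compact A" "diameter A > 0"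
    define h where "h = diameter A"
    have h: "h > 0" using A by (simp add: h_def)
    have meas: "frontier S \<inter> B \<in> sets borel" if "B \<in> sets borel" for B using that by auto
    have up: "emeasure surface_measure (frontier S \<inter> ball p \<rho>) \<le> ennreal (U * \<rho> ^ ?m)"
      if "p \<in> frontier S" "0 < \<rho>" "\<rho> \<le> r0 / 2" for p \<rho>
      using hausdorff_outer_frontier_upper[OF d cone S(1) that] emeasure_surface_measure[OF d meas[of "ball p \<rho>"]]
      by (simp add: U_def)
    have C1: "U * 2 ^ ?m * h ^ ?m \<le> C * h ^ ?m" 
      unfolding C_def using U h by (intro mult_right_mono) auto
    show "emeasure surface_measure (A \<inter> frontier S) \<le> ennreal (C * diameter A ^ ?m)"
    proof (cases "A \<inter> frontier S = {}")
      case False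
      then obtain p where p: "p \<in> A" "p \<in> frontier S" by auto
      show ?thesis
      proof (cases "h \<le> r0 / 4")
        case True
        have "A \<inter> frontier S \<subseteq> frontier S \<inter> ball p (2 * h)"
          using diameter_bounded_bound[OF compact_imp_bounded[OF A(1)] p(1)] h by (force simp: h_def)
        then have "emeasure surface_measure (A \<inter> frontier S) \<le> emeasure surface_measure (frontier S \<inter> ball p (2 * h))"
          by (intro emeasure_mono) auto
        also have "\<dots> \<le> ennreal (U * (2 * h) ^ ?m)" using True h p by (intro up) auto
        also have "\<dots> \<le> ennreal (C * h ^ ?m)" using C1 by (intro ennreal_leI) (simp add: power_mult_distrib mult_ac)
        finally show ?thesis by (simp add: h_def)
      next
        case False
        have "frontier S \<subseteq> closure \<Omega>" using S(2) using closure_mono[of S \<Omega>] by (auto simp: frontier_def)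
        then have "A \<inter> frontier S \<subseteq> (\<Union>z\<in>Z. frontier S \<inter> ball z (r0 / 4))" using Z(3) by blast
        then have "emeasure surface_measure (A \<inter> frontier S) \<le> emeasure surface_measure (\<Union>z\<in>Z. frontier S \<inter> ball z (r0 / 4))"
          using Z(2) by (intro emeasure_mono) (auto intro!: sets.finite_UN meas simp del: UN_simps)
        also have "\<dots> \<le> (\<Sum>z\<in>Z. emeasure surface_measure (frontier S \<inter> ball z (r0 / 4)))"
          using Z(2) by (intro emeasure_subadditive_finite) auto
        also have "\<dots> \<le> (\<Sum>z\<in>Z. ennreal (U * (r0 / 2) ^ ?m))"
        proof (rule sum_mono)
          fix z
          show "emeasure surface_measure (frontier S \<inter> ball z (r0 / 4)) \<le> ennreal (U * (r0 / 2) ^ ?m)"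
          proof (cases "frontier S \<inter> ball z (r0 / 4) = {}")
            case False
            then obtain q where q: "q \<in> frontier S" "dist z q < r0 / 4" by auto
            have "ball z (r0 / 4) \<subseteq> ball q (r0 / 2)"
            proof
              fix y assume "y \<in> ball z (r0 / 4)"
              then show "y \<in> ball q (r0 / 2)" using q dist_triangle[of q y z] by (simp add: dist_commute)
            qed
            then have "emeasure surface_measure (frontier S \<inter> ball z (r0 / 4)) \<le> emeasure surface_measure (frontier S \<inter> ball q (r0 / 2))"
              by (intro emeasure_mono) auto
            also have "\<dots> \<le> ennreal (U * (r0 / 2) ^ ?m)" using q r0 by (intro up) auto
            finally show ?thesis .
          qed auto
        qed
        also have "\<dots> = ennreal (real (card Z) * (U * (r0 / 2) ^ ?m))"
          using U r0 by (simp add: ennreal_mult ennreal_of_nat_eq_real_of_nat)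
        also have "\<dots> \<le> ennreal (C * h ^ ?m)"
        proof (rule ennreal_leI)
          have "(r0 / 2) ^ ?m \<le> (2 * h) ^ ?m" using False r0 by (intro power_mono) auto
          then have "real (card Z) * (U * (r0 / 2) ^ ?m) \<le> (real (card Z) + 1) * (U * (2 * h) ^ ?m)"
            using U r0 h by (intro mult_mono) auto
          then show "real (card Z) * (U * (r0 / 2) ^ ?m) \<le> C * h ^ ?m" by (simp add: C_def power_mult_distrib mult_ac)
        qed
        finally show ?thesis by (simp add: h_def)
      qed
    qed auto
  qed
qed

section \<open>Polynomials\<close>

definition multi_indices :: "nat \<Rightarrow> ('a::euclidean_space \<Rightarrow> nat) set" where
  "multi_indices k = {\<alpha> \<in> Basis \<rightarrow>\<^sub>E {..k}. (\<Sum>b\<in>Basis. \<alpha> b) \<le> k}"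

definition monomial_fun :: "('a::euclidean_space \<Rightarrow> nat) \<Rightarrow> 'a \<Rightarrow> real" where
  "monomial_fun \<alpha> x = (\<Prod>b\<in>Basis. (x \<bullet> b) ^ \<alpha> b)"

lemma polynomials_alt:
  "polynomials k = {p. \<exists>c. \<forall>x. p x = (\<Sum>\<alpha>\<in>multi_indices k. c \<alpha> * monomial_fun \<alpha> x)}"
  unfolding polynomials_def multi_indices_def monomial_fun_def ..

lemma finite_multi_indices: "finite (multi_indices k)"
  unfolding multi_indices_def by (rule finite_subset[OF _ finite_PiE[of Basis "\<lambda>_. {..k}"]]) auto

lemma multi_indices_mono: "k \<le> l \<Longrightarrow> multi_indices k \<subseteq> multi_indices l"
  unfolding multi_indices_def by (auto simp: PiE_iff)

lemma monomial_in_polynomials: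
  assumes "\<alpha> \<in> multi_indices k"
  shows "(\<lambda>x. c * monomial_fun \<alpha> x) \<in> polynomials k"
  unfolding polynomials_alt
proof (intro CollectI exI allI)
  fix x
  show "c * monomial_fun \<alpha> x = (\<Sum>\<beta>\<in>multi_indices k. (if \<beta> = \<alpha> then c else 0) * monomial_fun \<beta> x)"
    using assms by (simp add: finite_multi_indices if_distrib[of "\<lambda>y. y * _"] cong: if_cong)
qed

lemma polynomials_add:
  assumes "p \<in> polynomials k" "q \<in> polynomials k"
  shows "(\<lambda>x. p x + q x) \<in> polynomials k"
proof -
  obtain c d where "\<And>x. p x = (\<Sum>\<alpha>\<in>multi_indices k. c \<alpha> * monomial_fun \<alpha> x)"
    "\<And>x. q x = (\<Sum>\<alpha>\<in>multi_indices k. d \<alpha> * monomial_fun \<alpha> x)"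
    using assms unfolding polynomials_alt by auto
  then show ?thesis unfolding polynomials_alt
    by (intro CollectI exI[of _ "\<lambda>\<alpha>. c \<alpha> + d \<alpha>"]) (simp add: distrib_right sum.distrib)
qed

lemma polynomials_cmult:
  assumes "p \<in> polynomials k"
  shows "(\<lambda>x. a * p x) \<in> polynomials k"
proof -
  obtain c where "\<And>x. p x = (\<Sum>\<alpha>\<in>multi_indices k. c \<alpha> * monomial_fun \<alpha> x)"
    using assms unfolding polynomials_alt by auto
  then show ?thesis unfolding polynomials_alt
    by (intro CollectI exI[of _ "\<lambda>\<alpha>. a * c \<alpha>"]) (simp add: sum_distrib_left mult.assoc)
qed

lemma polynomials_mono:
  assumes "p \<in> polynomials k" "k \<le> l"
  shows "p \<in> polynomials l"
proof -
  obtain c where c: "\<And>x. p x = (\<Sum>\<alpha>\<in>multi_indices k. c \<alpha> * monomial_fun \<alpha> x)"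
    using assms unfolding polynomials_alt by auto
  have "p x = (\<Sum>\<alpha>\<in>multi_indices l. (if \<alpha> \<in> multi_indices k then c \<alpha> else 0) * monomial_fun \<alpha> x)" for x
    unfolding c using multi_indices_mono[OF assms(2)]
    by (intro sum.mono_neutral_cong_left finite_multi_indices) auto
  then show ?thesis unfolding polynomials_alt
    by (intro CollectI exI[of _ "\<lambda>\<alpha>. if \<alpha> \<in> multi_indices k then c \<alpha> else 0"]) blast
qed

lemma polynomials_const: "(\<lambda>x :: 'a::euclidean_space. c) \<in> polynomials k"
proof -
  have "(\<lambda>b\<in>Basis. 0) \<in> multi_indices k" by (auto simp: multi_indices_def PiE_iff)
  then have "(\<lambda>x::'a. c * monomial_fun (\<lambda>b\<in>Basis. 0) x) \<in> polynomials k" by (rule monomial_in_polynomials)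
  moreover have "monomial_fun (\<lambda>b\<in>Basis. 0) x = 1" for x :: 'a
    unfolding monomial_fun_def by (rule prod.neutral) simp
  ultimately show ?thesis by simp
qed

lemma polynomials_sum:
  assumes "\<And>i. i \<in> I \<Longrightarrow> p i \<in> polynomials k"
  shows "(\<lambda>x. \<Sum>i\<in>I. p i x) \<in> polynomials k"
  using assms
proof (induction I rule: infinite_finite_induct)
  case (insert i I)
  then show ?case using polynomials_add[of "p i" k "\<lambda>x. \<Sum>i\<in>I. p i x"] by simp
qed (auto intro: polynomials_const)

lemma monomial_fun_upd_Suc:
  assumes "b \<in> Basis"
  shows "monomial_fun (\<alpha>(b := Suc (\<alpha> b))) x = (x \<bullet> b) * monomial_fun \<alpha> x"
  unfolding monomial_fun_def
  by (subst (1 2) prod.remove[OF finite_Basis assms]) (auto intro!: prod.cong)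

lemma sum_Basis_upd_Suc:
  fixes \<alpha> :: "'a::euclidean_space \<Rightarrow> nat"
  assumes "b \<in> Basis"
  shows "(\<Sum>c\<in>Basis. (\<alpha>(b := Suc (\<alpha> b))) c) = Suc (\<Sum>c\<in>Basis. \<alpha> c)"
  by (subst (1 2) sum.remove[OF finite_Basis assms]) (auto intro!: sum.cong)

lemma multi_indices_upd_Suc:
  assumes "\<alpha> \<in> multi_indices k" "b \<in> Basis"
  shows "\<alpha>(b := Suc (\<alpha> b)) \<in> multi_indices (Suc k)"
proof -
  have "\<alpha> \<in> Basis \<rightarrow>\<^sub>E {..k}" "sum \<alpha> Basis \<le> k" using assms by (auto simp: multi_indices_def)
  moreover have "\<alpha>(b := Suc (\<alpha> b)) \<in> Basis \<rightarrow>\<^sub>E {..Suc k}"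
    using calculation(1) assms(2) by (auto simp: PiE_iff extensional_def le_Suc_eq)
  moreover have "(\<Sum>c\<in>Basis. (\<alpha>(b := Suc (\<alpha> b))) c) \<le> Suc k"
    unfolding sum_Basis_upd_Suc[OF assms(2)] using calculation(2) by simp
  ultimately show ?thesis unfolding multi_indices_def by blast
qed

lemma polynomials_mult_coord:
  assumes "p \<in> polynomials k" "b \<in> Basis"
  shows "(\<lambda>x. (x \<bullet> b) * p x) \<in> polynomials (Suc k)"
proof -
  obtain c where c: "\<And>x. p x = (\<Sum>\<alpha>\<in>multi_indices k. c \<alpha> * monomial_fun \<alpha> x)"
    using assms unfolding polynomials_alt by auto
  have "(\<lambda>x. (x \<bullet> b) * p x) = (\<lambda>x. \<Sum>\<alpha>\<in>multi_indices k. c \<alpha> * monomial_fun (\<alpha>(b := Suc (\<alpha> b))) x)"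
    by (simp add: fun_eq_iff c sum_distrib_left monomial_fun_upd_Suc[OF assms(2)] mult.left_commute)
  also have "\<dots> \<in> polynomials (Suc k)"
    by (intro polynomials_sum monomial_in_polynomials multi_indices_upd_Suc assms)
  finally show ?thesis .
qed

lemma polynomials_mult_affine:
  fixes u :: "'a::euclidean_space"
  assumes "p \<in> polynomials k"
  shows "(\<lambda>x. (a + u \<bullet> x) * p x) \<in> polynomials (Suc k)"
proof -
  have "(\<lambda>x. (a + u \<bullet> x) * p x) = (\<lambda>x. a * p x + (\<Sum>b\<in>Basis. (u \<bullet> b) * ((x \<bullet> b) * p x)))"
    by (subst euclidean_inner) (simp add: fun_eq_iff algebra_simps sum_distrib_right sum_distrib_left)
  also have "\<dots> \<in> polynomials (Suc k)"
    by (intro polynomials_add polynomials_cmult polynomials_sum polynomials_mult_coord assms polynomials_mono[OF assms]) auto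
  finally show ?thesis .
qed

lemma polynomials_prod_affine:
  assumes "finite I"
  shows "(\<lambda>x. \<Prod>i\<in>I. (a i + u i \<bullet> x)) \<in> polynomials (card I)"
  using assms
proof induction
  case (insert i I)
  then show ?case using polynomials_mult_affine[of "\<lambda>x. \<Prod>i\<in>I. (a i + u i \<bullet> x)" "card I" "a i" "u i"] by simp
qed (simp add: polynomials_const)

text \<open>Each monomial is built by multiplying with one coordinate at a time. The predicate
  carries the degree bound, so that the degree can be tracked through the induction.\<close>

lemma polynomials_induct [consumes 1, case_names const add mult]:
  assumes p: "p \<in> polynomials k"
    and const: "\<And>k c. Q k (\<lambda>_. c)"
    and add: "\<And>k f g. Q k f \<Longrightarrow> Q k g \<Longrightarrow> Q k (\<lambda>x. f x + g x)"
    and mult: "\<And>k f b. f \<in> polynomials k \<Longrightarrow> Q k f \<Longrightarrow> b \<in> Basis \<Longrightarrow> Q (Suc k) (\<lambda>x. (x \<bullet> b) * f x)"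
  shows "Q k p"
proof -
  have mon: "Q k (\<lambda>x. a * monomial_fun \<alpha> x)" if "\<alpha> \<in> multi_indices k" for k \<alpha> a
    using that
  proof (induction "\<Sum>b\<in>Basis. \<alpha> b" arbitrary: \<alpha> k)
    case 0
    then have "monomial_fun \<alpha> x = 1" for x by (simp add: monomial_fun_def)
    then show ?case using const[of k a] by simp
  next
    case (Suc n)
    then obtain b where b: "b \<in> Basis" "\<alpha> b \<noteq> 0" by (metis sum.neutral nat.distinct(1))
    then obtain m where m: "\<alpha> b = Suc m" by (metis not0_implies_Suc)
    define \<beta> where "\<beta> = \<alpha>(b := m)"
    have \<alpha>: "\<alpha> = \<beta>(b := Suc (\<beta> b))" by (simp add: \<beta>_def m[symmetric])
    have s: "Suc n = Suc (\<Sum>c\<in>Basis. \<beta> c)" using Suc.hyps(2) sum_Basis_upd_Suc[OF b(1), of \<beta>] by (simp flip: \<alpha>)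
    obtain l where l: "k = Suc l" using Suc.prems Suc.hyps(2) by (cases k) (auto simp: multi_indices_def)
    have ext: "\<alpha> \<in> Basis \<rightarrow>\<^sub>E {..k}" "sum \<alpha> Basis \<le> k" using Suc.prems by (auto simp: multi_indices_def)
    have sl: "sum \<beta> Basis \<le> l" using s Suc.hyps(2) ext(2) l by simp
    have "\<beta> c \<le> l" if "c \<in> Basis" for c
      using member_le_sum[of c Basis \<beta>] that sl by simp
    then have "\<beta> \<in> Basis \<rightarrow>\<^sub>E {..l}" using ext(1) b by (auto simp: \<beta>_def PiE_iff extensional_def)
    then have \<beta>: "\<beta> \<in> multi_indices l" using sl by (simp add: multi_indices_def)
    then have "Q l (\<lambda>x. a * monomial_fun \<beta> x)" using s by (intro Suc.hyps(1)) auto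
    then have "Q (Suc l) (\<lambda>x. (x \<bullet> b) * (a * monomial_fun \<beta> x))"
      by (intro mult monomial_in_polynomials \<beta> b)
    then show ?case unfolding l by (subst \<alpha>) (simp add: monomial_fun_upd_Suc[OF b(1)] mult.left_commute)
  qed
  obtain c where c: "\<And>x. p x = (\<Sum>\<alpha>\<in>multi_indices k. c \<alpha> * monomial_fun \<alpha> x)"
    using p unfolding polynomials_alt by auto
  have "Q k (\<lambda>x. \<Sum>\<alpha>\<in>A. c \<alpha> * monomial_fun \<alpha> x)" if "finite A" "A \<subseteq> multi_indices k" for A
    using that
  proof induction
    case (insert \<alpha> A)
    then have "Q k (\<lambda>x. c \<alpha> * monomial_fun \<alpha> x)" "Q k (\<lambda>x. \<Sum>\<alpha>\<in>A. c \<alpha> * monomial_fun \<alpha> x)"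
      using mon by auto
    then show ?case using insert.hyps add by simp
  qed (simp add: const)
  moreover have "p = (\<lambda>x. \<Sum>\<alpha>\<in>multi_indices k. c \<alpha> * monomial_fun \<alpha> x)" using c by blast
  ultimately show ?thesis using finite_multi_indices by blast
qed

section \<open>Gradients, finite differences and inverse inequalities\<close>

lemma polynomials_has_gradient:
  assumes "p \<in> polynomials k"
  shows "\<exists>g. (\<forall>x. (p has_derivative (\<lambda>h. g x \<bullet> h)) (at x)) \<and> (\<forall>b\<in>Basis. (\<lambda>x. g x \<bullet> b) \<in> polynomials k)"
  using assms
proof (induction rule: polynomials_induct)
  case (const k c)
  then show ?case by (intro exI[of _ "\<lambda>_. 0"]) (auto intro: polynomials_const)
next
  case (add k f g)
  then obtain f' g' where "\<forall>x. (f has_derivative (\<lambda>h. f' x \<bullet> h)) (at x)" "\<forall>b\<in>Basis. (\<lambda>x. f' x \<bullet> b) \<in> polynomials k"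
    "\<forall>x. (g has_derivative (\<lambda>h. g' x \<bullet> h)) (at x)" "\<forall>b\<in>Basis. (\<lambda>x. g' x \<bullet> b) \<in> polynomials k"
    by blast
  then show ?case
    by (intro exI[of _ "\<lambda>x. f' x + g' x"]) (auto simp: inner_add_left intro!: derivative_eq_intros polynomials_add)
next
  case (mult k f b)
  then obtain f' where f': "\<forall>x. (f has_derivative (\<lambda>h. f' x \<bullet> h)) (at x)" "\<forall>b\<in>Basis. (\<lambda>x. f' x \<bullet> b) \<in> polynomials k"
    by blast
  show ?case
  proof (intro exI[of _ "\<lambda>x. f x *\<^sub>R b + (x \<bullet> b) *\<^sub>R f' x"] conjI allI ballI)
    fix x
    have "((\<lambda>x. (x \<bullet> b) * f x) has_derivative (\<lambda>h. (x \<bullet> b) * (f' x \<bullet> h) + (h \<bullet> b) * f x)) (at x)"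
      using f'(1) by (intro has_derivative_mult) (auto intro!: derivative_eq_intros)
    then show "((\<lambda>x. (x \<bullet> b) * f x) has_derivative (\<lambda>h. (f x *\<^sub>R b + (x \<bullet> b) *\<^sub>R f' x) \<bullet> h)) (at x)"
      by (simp add: inner_add_left inner_commute[of b] mult.commute add.commute)
  next
    fix c :: 'a assume c: "c \<in> Basis"
    have "(\<lambda>x. (b \<bullet> c) * f x + (x \<bullet> b) * (f' x \<bullet> c)) \<in> polynomials (Suc k)"
      using mult f' c by (intro polynomials_add polynomials_cmult polynomials_mult_coord) (auto intro: polynomials_mono)
    then show "(\<lambda>x. (f x *\<^sub>R b + (x \<bullet> b) *\<^sub>R f' x) \<bullet> c) \<in> polynomials (Suc k)"
      by (simp add: inner_add_left mult.commute)
  qed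
qed

lemma polynomials_continuous:
  assumes "p \<in> polynomials k"
  shows "continuous_on A p"
  using polynomials_has_gradient[OF assms]
  by (meson continuous_at_imp_continuous_on has_derivative_continuous)

text \<open>The factor \<open>real i\<close> that a coordinate produces is absorbed by
  \<open>i * (n choose i) = n * (n - 1 choose i - 1)\<close>. This leaves a difference of order
  \<open>n - 1\<close> based at \<open>x + v\<close>, so the induction generalises over
  \<open>n\<close> and \<open>x\<close>.\<close>

lemma polynomials_finite_difference:
  assumes "p \<in> polynomials k" "k < n"
  shows "(\<Sum>i\<le>n. (-1) ^ i * real (n choose i) * p (x + real i *\<^sub>R v)) = 0"
  using assms
proof (induction arbitrary: n x rule: polynomials_induct)
  case (const k c)
  have "(\<Sum>i\<le>n. (-1) ^ i * real (n choose i)) = 0" using choose_alternating_sum[of n] const by simp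
  then show ?case by (simp flip: sum_distrib_right)
next
  case (add k f g)
  have "(\<Sum>i\<le>n. (-1) ^ i * real (n choose i) * (f (x + real i *\<^sub>R v) + g (x + real i *\<^sub>R v))) =
    (\<Sum>i\<le>n. (-1) ^ i * real (n choose i) * f (x + real i *\<^sub>R v)) +
    (\<Sum>i\<le>n. (-1) ^ i * real (n choose i) * g (x + real i *\<^sub>R v))"
    by (simp add: distrib_left sum.distrib)
  then show ?case using add by simp
next
  case (mult k f b)
  obtain m where m: "n = Suc m" using mult.prems by (cases n) auto
  have "(\<Sum>i\<le>n. (-1) ^ i * real (n choose i) * (((x + real i *\<^sub>R v) \<bullet> b) * f (x + real i *\<^sub>R v))) =
    (x \<bullet> b) * (\<Sum>i\<le>n. (-1) ^ i * real (n choose i) * f (x + real i *\<^sub>R v)) +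
    (v \<bullet> b) * (\<Sum>i\<le>n. (-1) ^ i * (real i * real (n choose i)) * f (x + real i *\<^sub>R v))"
    by (simp add: inner_add_left algebra_simps sum.distrib sum_distrib_left)
  also have "(\<Sum>i\<le>n. (-1) ^ i * real (n choose i) * f (x + real i *\<^sub>R v)) = 0"
    using mult.IH[of n x] mult.prems by simp
  also have "(\<Sum>i\<le>n. (-1) ^ i * (real i * real (n choose i)) * f (x + real i *\<^sub>R v)) =
    (\<Sum>i\<le>m. (-1) ^ Suc i * (real (Suc i) * real (Suc m choose Suc i)) * f (x + real (Suc i) *\<^sub>R v))"
    unfolding m sum.atMost_Suc_shift by simp
  also have "\<dots> = (\<Sum>i\<le>m. - real (Suc m) * ((-1) ^ i * real (m choose i) * f ((x + v) + real i *\<^sub>R v)))"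
  proof (rule sum.cong)
    fix i
    have "real (Suc i) * real (Suc m choose Suc i) = real (Suc m) * real (m choose i)"
      using Suc_times_binomial[of i m] by (metis of_nat_mult)
    moreover have "x + real (Suc i) *\<^sub>R v = (x + v) + real i *\<^sub>R v" by (simp add: algebra_simps)
    ultimately have "(-1) ^ Suc i * (real (Suc i) * real (Suc m choose Suc i)) * f (x + real (Suc i) *\<^sub>R v) =
      - ((-1) ^ i) * (real (Suc m) * real (m choose i)) * f ((x + v) + real i *\<^sub>R v)" by (simp only: power_Suc)
    then show "(-1) ^ Suc i * (real (Suc i) * real (Suc m choose Suc i)) * f (x + real (Suc i) *\<^sub>R v) =
       - real (Suc m) * ((-1) ^ i * real (m choose i) * f ((x + v) + real i *\<^sub>R v))"
      by (simp add: mult_ac del: of_nat_Suc)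
  qed simp
  also have "\<dots> = - real (Suc m) * (\<Sum>i\<le>m. (-1) ^ i * real (m choose i) * f ((x + v) + real i *\<^sub>R v))"
    by (rule sum_distrib_left[symmetric])
  also have "\<dots> = 0" using mult.IH[of m "x + v"] mult.prems m by simp
  finally show ?case by simp
qed

lemma nn_integral_affine_contraction:
  fixes h :: "'a::euclidean_space \<Rightarrow> ennreal"
  assumes "h \<in> borel_measurable borel" "c > 0"
  shows "(\<integral>\<^sup>+z. h (t + c *\<^sub>R z) \<partial>lborel) * ennreal (c ^ DIM('a)) = (\<integral>\<^sup>+z. h z \<partial>lborel)"
proof -
  have "(\<integral>\<^sup>+z. h z \<partial>lborel) = (\<integral>\<^sup>+z. h z \<partial>density (distr lborel borel (\<lambda>x. t + c *\<^sub>R x)) (\<lambda>_. \<bar>c\<bar> ^ DIM('a)))"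
    using lborel_affine[of c t] assms(2) by simp
  also have "\<dots> = (\<integral>\<^sup>+z. h (t + c *\<^sub>R z) * ennreal (c ^ DIM('a)) \<partial>lborel)"
    using assms by (simp add: nn_integral_density nn_integral_distr mult.commute)
  also have "\<dots> = (\<integral>\<^sup>+z. h (t + c *\<^sub>R z) \<partial>lborel) * ennreal (c ^ DIM('a))"
    using assms by (intro nn_integral_multc) auto
  finally show ?thesis by simp
qed

text \<open>The vanishing finite difference expresses \<open>q x\<close> by the values of \<open>q\<close> at equidistant points
  between \<open>x\<close> and \<open>z\<close>; averaging over \<open>z\<close> in a ball inside \<open>T\<close> gives the inverse inequality.\<close>

lemma polynomials_inverse_estimate:
  obtains C where "C > 0" "\<And>(T :: 'a::euclidean_space set) x0 r q x. convex T \<Longrightarrow> compact T \<Longrightarrow> cball x0 r \<subseteq> T \<Longrightarrow> r > 0 \<Longrightarrow>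
     q \<in> polynomials k \<Longrightarrow> x \<in> T \<Longrightarrow> (q x)\<^sup>2 * r ^ DIM('a) \<le> C * (LINT y:T|lborel. (q y)\<^sup>2)"
proof -
  define n where "n = Suc k"
  define v where "v = unit_ball_vol (real DIM('a))"
  have v: "v > 0" by (simp add: v_def)
  \<comment> \<open>Cauchy-Schwarz for the \<open>n\<close> remaining terms of the difference, each
    binomial coefficient being at most \<open>2 ^ n\<close>.\<close>
  define K where "K = real n * 4 ^ n"
  have K: "K > 0" by (simp add: K_def n_def)
  define C where "C = K * real n * real n ^ DIM('a) / v"
  show thesis
  proof (rule that)
    show "C > 0" using K v by (simp add: C_def n_def)
    fix T :: "'a set" and x0 r x and q :: "'a \<Rightarrow> real"
    assume T: "convex T" "compact T" and ball: "cball x0 r \<subseteq> T" "r > 0" and q: "q \<in> polynomials k" and x: "x \<in> T"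
    have qc: "continuous_on A q" for A by (rule polynomials_continuous[OF q])
    have Tb: "T \<in> sets borel" using T(2) by (simp add: borel_compact)
    have qb: "q \<in> borel_measurable borel" using qc by (intro borel_measurable_continuous_onI)
    define h where "h y = ennreal ((q y)\<^sup>2) * indicator T y" for y
    have hb: "h \<in> borel_measurable borel" unfolding h_def using qb Tb by measurable
    define s where "s i z = x + (real i / real n) *\<^sub>R (z - x)" for i z
    have sT: "s i z \<in> T" if "i \<in> {1..n}" "z \<in> cball x0 r" for i z
    proof -
      have "s i z = (1 - real i / real n) *\<^sub>R x + (real i / real n) *\<^sub>R z" by (simp add: s_def algebra_simps)
      then show ?thesis using that ball x convexD_alt[OF T(1) x, of z "real i / real n"] by auto
    qed
    have pw: "(q x)\<^sup>2 \<le> K * (\<Sum>i\<in>{1..n}. (q (s i z))\<^sup>2)" for z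
    proof -
      define w where "w = (1 / real n) *\<^sub>R (z - x)"
      have sw: "s i z = x + real i *\<^sub>R w" for i by (simp add: s_def w_def)
      have "{..n} = insert 0 {1..n}" by auto
      then have "q x + (\<Sum>i\<in>{1..n}. (-1) ^ i * real (n choose i) * q (s i z)) = 0"
        using polynomials_finite_difference[OF q, of n x w] by (simp add: n_def[symmetric] sw) (simp add: n_def)
      then have "(q x)\<^sup>2 = (\<Sum>i\<in>{1..n}. (-1) ^ i * real (n choose i) * q (s i z))\<^sup>2"
        by (simp add: add_eq_0_iff2 power2_eq_square)
      also have "\<dots> \<le> (\<Sum>i\<in>{1..n}. ((-1) ^ i * real (n choose i))\<^sup>2) * (\<Sum>i\<in>{1..n}. (q (s i z))\<^sup>2)"
        by (rule Cauchy_Schwarz_ineq_sum)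
      also have "\<dots> \<le> K * (\<Sum>i\<in>{1..n}. (q (s i z))\<^sup>2)"
      proof (intro mult_right_mono sum_nonneg)
        have "((-1) ^ i * real (n choose i))\<^sup>2 \<le> 4 ^ n" for i
        proof -
          have "real (n choose i) \<le> 2 ^ n" using binomial_le_pow2[of n i] by (metis of_nat_le_numeral_power_cancel_iff)
          then have "(real (n choose i))\<^sup>2 \<le> (2 ^ n)\<^sup>2" by (intro power_mono) auto
          also have "\<dots> = (4::real) ^ n" by (simp add: power2_eq_square flip: power_mult_distrib)
          finally show ?thesis by (simp add: power_mult_distrib flip: power_mult)
        qed
        then have "(\<Sum>i\<in>{1..n}. ((-1) ^ i * real (n choose i))\<^sup>2) \<le> (\<Sum>i\<in>{1..n}. 4 ^ n)" by (rule sum_mono)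
        then show "(\<Sum>i\<in>{1..n}. ((-1) ^ i * real (n choose i))\<^sup>2) \<le> K" by (simp add: K_def)
      qed auto
      finally show ?thesis .
    qed
    \<comment> \<open>The map \<open>s i\<close> contracts towards \<open>x\<close> with ratio
      \<open>i / n\<close>, at least \<open>1 / n\<close>, so the change of variables costs at most
      \<open>n ^ DIM('a)\<close>.\<close>
    have trm: "(\<integral>\<^sup>+z. h (s i z) \<partial>lborel) \<le> ennreal (real n ^ DIM('a)) * (\<integral>\<^sup>+z. h z \<partial>lborel)" if i: "i \<in> {1..n}" for i
    proof -
      define c where "c = real i / real n"
      have c: "c > 0" using i by (simp add: c_def)
      have "(\<integral>\<^sup>+z. h z \<partial>lborel) = (\<integral>\<^sup>+z. h ((1 - c) *\<^sub>R x + c *\<^sub>R z) \<partial>lborel) * ennreal (c ^ DIM('a))"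
        using nn_integral_affine_contraction[OF hb c] by simp
      moreover have "(1 - c) *\<^sub>R x + c *\<^sub>R z = s i z" for z by (simp add: s_def c_def algebra_simps)
      ultimately have "(\<integral>\<^sup>+z. h z \<partial>lborel) = (\<integral>\<^sup>+z. h (s i z) \<partial>lborel) * ennreal (c ^ DIM('a))" by simp
      then have "ennreal (real n ^ DIM('a)) * (\<integral>\<^sup>+z. h z \<partial>lborel) = (\<integral>\<^sup>+z. h (s i z) \<partial>lborel) * (ennreal (c ^ DIM('a)) * ennreal (real n ^ DIM('a)))"
        by (simp add: mult_ac)
      moreover have "ennreal (c ^ DIM('a)) * ennreal (real n ^ DIM('a)) = ennreal (real i ^ DIM('a))"
      proof -
        have "c ^ DIM('a) * real n ^ DIM('a) = real i ^ DIM('a)" using i by (simp add: c_def flip: power_mult_distrib)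
        then show ?thesis using c by (simp flip: ennreal_mult)
      qed
      moreover have "1 \<le> ennreal (real i ^ DIM('a))" using i by simp
      ultimately show ?thesis using mult_left_mono[of 1 "ennreal (real i ^ DIM('a))" "\<integral>\<^sup>+z. h (s i z) \<partial>lborel"] by simp
    qed
    have "ennreal ((q x)\<^sup>2) * indicator (cball x0 r) z \<le> ennreal K * (\<Sum>i\<in>{1..n}. h (s i z))" for z
    proof (cases "z \<in> cball x0 r")
      case True
      then have "(\<Sum>i\<in>{1..n}. h (s i z)) = (\<Sum>i\<in>{1..n}. ennreal ((q (s i z))\<^sup>2))"
        using sT by (intro sum.cong) (auto simp: h_def)
      also have "\<dots> = ennreal (\<Sum>i\<in>{1..n}. (q (s i z))\<^sup>2)" by (rule sum_ennreal) auto
      finally have "ennreal K * (\<Sum>i\<in>{1..n}. h (s i z)) = ennreal (K * (\<Sum>i\<in>{1..n}. (q (s i z))\<^sup>2))"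
        using K by (simp add: ennreal_mult sum_nonneg)
      then show ?thesis using True pw[of z] by (simp add: ennreal_leI)
    qed simp
    then have "(\<integral>\<^sup>+z. ennreal ((q x)\<^sup>2) * indicator (cball x0 r) z \<partial>lborel) \<le> (\<integral>\<^sup>+z. ennreal K * (\<Sum>i\<in>{1..n}. h (s i z)) \<partial>lborel)"
      by (rule nn_integral_mono)
    also have "\<dots> = ennreal K * (\<Sum>i\<in>{1..n}. \<integral>\<^sup>+z. h (s i z) \<partial>lborel)"
    proof -
      have sb: "(\<lambda>z. h (s i z)) \<in> borel_measurable borel" for i
        unfolding s_def using hb by measurable
      show ?thesis using sb by (subst nn_integral_cmult) (auto simp: nn_integral_sum)
    qed
    also have "\<dots> \<le> ennreal K * (\<Sum>i\<in>{1..n}. ennreal (real n ^ DIM('a)) * (\<integral>\<^sup>+z. h z \<partial>lborel))"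
      using trm by (intro mult_left_mono sum_mono) auto
    also have "\<dots> = ennreal (K * real n * real n ^ DIM('a)) * (\<integral>\<^sup>+z. h z \<partial>lborel)"
      using K by (simp add: ennreal_mult ennreal_of_nat_eq_real_of_nat mult_ac)
    also have "(\<integral>\<^sup>+z. ennreal ((q x)\<^sup>2) * indicator (cball x0 r) z \<partial>lborel) = ennreal ((q x)\<^sup>2 * (v * r ^ DIM('a)))"
      using ball(2) emeasure_cball[of r x0] by (simp add: nn_integral_cmult_indicator v_def ennreal_mult)
    also have "(\<integral>\<^sup>+z. h z \<partial>lborel) = ennreal (LINT y:T|lborel. (q y)\<^sup>2)"
    proof -
      have int: "integrable lborel (\<lambda>y. indicator T y *\<^sub>R (q y)\<^sup>2)"
        using qc T(2) by (intro borel_integrable_compact continuous_intros) auto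
      have "(\<integral>\<^sup>+z. h z \<partial>lborel) = (\<integral>\<^sup>+z. ennreal (indicator T z *\<^sub>R (q z)\<^sup>2) \<partial>lborel)"
        by (intro nn_integral_cong) (auto simp: h_def indicator_def)
      also have "\<dots> = ennreal (LINT y:T|lborel. (q y)\<^sup>2)"
        unfolding set_lebesgue_integral_def by (rule nn_integral_eq_integral[OF int]) auto
      finally show ?thesis .
    qed
    also have "ennreal (K * real n * real n ^ DIM('a)) * ennreal (LINT y:T|lborel. (q y)\<^sup>2) =
       ennreal (K * real n * real n ^ DIM('a) * (LINT y:T|lborel. (q y)\<^sup>2))"
      using K by (subst ennreal_mult) (auto simp: set_lebesgue_integral_def intro!: integral_nonneg)
    finally have "(q x)\<^sup>2 * (v * r ^ DIM('a)) \<le> K * real n * real n ^ DIM('a) * (LINT y:T|lborel. (q y)\<^sup>2)"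
      using K by (subst (asm) ennreal_le_iff) (auto simp: set_lebesgue_integral_def intro!: integral_nonneg)
    then show "(q x)\<^sup>2 * r ^ DIM('a) \<le> C * (LINT y:T|lborel. (q y)\<^sup>2)"
      using v by (simp add: C_def field_simps)
  qed
qed

text \<open>Uniqueness holds also at boundary points, since the differences of two points of \<open>T\<close> span the space.\<close>

lemma frechet_derivative_within_convex:
  fixes f :: "'a::euclidean_space \<Rightarrow> real"
  assumes T: "convex T" "interior T \<noteq> {}" "x \<in> T"
    and f: "(f has_derivative F) (at x within T)" and g: "(f has_derivative G) (at x within T)"
  shows "F = G"
proof -
  have lin: "linear F" "linear G" using f g by (auto dest: has_derivative_linear)
  have eq: "F (z - x) = G (z - x)" if z: "z \<in> T" for z
  proof -
    define \<gamma> where "\<gamma> t = x + t *\<^sub>R (z - x)" for t :: real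
    have \<gamma>T: "\<gamma> ` {0..1} \<subseteq> T"
    proof
      fix y assume "y \<in> \<gamma> ` {0..1}"
      then obtain t where t: "0 \<le> t" "t \<le> 1" "y = (1 - t) *\<^sub>R x + t *\<^sub>R z" by (auto simp: \<gamma>_def algebra_simps)
      then show "y \<in> T" using convexD_alt[OF T(1) T(3) z] by simp
    qed
    have \<gamma>0: "\<gamma> 0 = x" by (simp add: \<gamma>_def)
    have d\<gamma>: "(\<gamma> has_derivative (\<lambda>h. h *\<^sub>R (z - x))) (at 0 within {0..1})"
      unfolding \<gamma>_def by (auto intro!: derivative_eq_intros)
    have "((\<lambda>t. f (\<gamma> t)) has_vector_derivative H (z - x)) (at 0 within {0..1})"
      if H: "(f has_derivative H) (at x within T)" for H
    proof -
      have "(f has_derivative H) (at (\<gamma> 0) within \<gamma> ` {0..1})"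
        unfolding \<gamma>0 by (rule has_derivative_subset[OF H \<gamma>T])
      from has_derivative_in_compose[OF d\<gamma> this]
      have "((\<lambda>t. f (\<gamma> t)) has_derivative (\<lambda>h. H (h *\<^sub>R (z - x)))) (at 0 within {0..1})" .
      moreover have "linear H" using H by (rule has_derivative_linear)
      ultimately show ?thesis unfolding has_vector_derivative_def by (simp add: linear_scale)
    qed
    from this[OF f] this[OF g] show ?thesis
      by (intro vector_derivative_unique_within[of 0 "{0..1::real}"]) (auto simp: trivial_limit_within islimpt_Icc)
  qed
  obtain c e where c: "e > 0" "ball c e \<subseteq> T" using T(2) by (meson equals0I mem_interior)
  have "F h = G h" for h
  proof (cases "h = 0")
    case False
    define t where "t = e / (2 * norm h)"
    have t: "t > 0" "t * norm h < e" using c(1) False by (auto simp: t_def)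
    have "c \<in> T" "c + t *\<^sub>R h \<in> T" using c t by (auto simp: dist_norm)
    then have "F ((c + t *\<^sub>R h - x) - (c - x)) = G ((c + t *\<^sub>R h - x) - (c - x))"
      using linear_diff[OF lin(1), of "c + t *\<^sub>R h - x" "c - x"] linear_diff[OF lin(2), of "c + t *\<^sub>R h - x" "c - x"]
        eq[of c] eq[of "c + t *\<^sub>R h"] by (simp only:)
    then show ?thesis using t linear_scale[OF lin(1)] linear_scale[OF lin(2)] by simp
  qed (simp add: linear_0[OF lin(1)] linear_0[OF lin(2)])
  then show ?thesis by blast
qed

lemma grad_within_convex:
  assumes T: "convex T" "interior T \<noteq> {}" "x \<in> T"
    and fp: "\<And>y. y \<in> T \<Longrightarrow> f y = p y" and p: "(p has_derivative (\<lambda>h. g \<bullet> h)) (at x)"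
  shows "grad_within T f x = g"
proof -
  have "(p has_derivative (\<lambda>h. g \<bullet> h)) (at x within T)"
    using p by (rule has_derivative_at_withinI)
  then have f: "(f has_derivative (\<lambda>h. g \<bullet> h)) (at x within T)"
    by (rule has_derivative_transform[OF T(3) fp, rotated])
  then have "(f has_derivative frechet_derivative f (at x within T)) (at x within T)"
    using frechet_derivative_works differentiableI by blast
  then have "frechet_derivative f (at x within T) = (\<lambda>h. g \<bullet> h)"
    using frechet_derivative_within_convex[OF T _ f] by blast
  then show ?thesis by (simp add: grad_within_def euclidean_representation)
qed

lemma set_integral_grad_within:
  assumes "convex T" "interior T \<noteq> {}"
    "\<And>y. y \<in> T \<Longrightarrow> f y = p y" "\<And>x. (p has_derivative (\<lambda>h. g x \<bullet> h)) (at x)"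
  shows "(LINT x:T|lborel. (norm (grad_within T f x))\<^sup>2) = (LINT x:T|lborel. (norm (g x))\<^sup>2)"
  unfolding set_lebesgue_integral_def
proof (intro Bochner_Integration.integral_cong refl)
  fix x
  show "indicator T x *\<^sub>R (norm (grad_within T f x))\<^sup>2 = indicator T x *\<^sub>R (norm (g x))\<^sup>2"
    using grad_within_convex[OF assms(1,2) _ assms(3,4), of x] by (cases "x \<in> T") auto
qed

lemma norm_sq_gradient_sum: "(norm (g x))\<^sup>2 = (\<Sum>b\<in>Basis. (g x \<bullet> b)\<^sup>2)"
  unfolding power2_norm_eq_inner by (subst euclidean_inner) (simp add: power2_eq_square)

lemma polynomial_gradient_integrable:
  assumes "compact T" "\<And>b. b \<in> Basis \<Longrightarrow> (\<lambda>x. g x \<bullet> b) \<in> polynomials k"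
  shows "set_integrable lborel T (\<lambda>x. (norm (g x))\<^sup>2)"
  unfolding set_integrable_def norm_sq_gradient_sum
  by (intro borel_integrable_compact assms(1) continuous_intros polynomials_continuous[OF assms(2)])

text \<open>The mean value theorem on the segment from \<open>a\<close> to \<open>b\<close>, with
  the inverse inequality applied to each component of the gradient.\<close>

lemma polynomials_oscillation:
  obtains C where "C > 0" "\<And>(T :: 'a::euclidean_space set) x0 r p g a b. convex T \<Longrightarrow> compact T \<Longrightarrow> cball x0 r \<subseteq> T \<Longrightarrow> r > 0 \<Longrightarrow>
     (\<And>x. (p has_derivative (\<lambda>h. g x \<bullet> h)) (at x)) \<Longrightarrow> (\<And>b. b \<in> Basis \<Longrightarrow> (\<lambda>x. g x \<bullet> b) \<in> polynomials k) \<Longrightarrow>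
     a \<in> T \<Longrightarrow> b \<in> T \<Longrightarrow> (p a - p b)\<^sup>2 * r ^ DIM('a) \<le> C * (dist a b)\<^sup>2 * (LINT y:T|lborel. (norm (g y))\<^sup>2)"
proof -
  obtain C where C: "C > 0" "\<And>(T :: 'a set) x0 r q x. convex T \<Longrightarrow> compact T \<Longrightarrow> cball x0 r \<subseteq> T \<Longrightarrow> r > 0 \<Longrightarrow>
     q \<in> polynomials k \<Longrightarrow> x \<in> T \<Longrightarrow> (q x)\<^sup>2 * r ^ DIM('a) \<le> C * (LINT y:T|lborel. (q y)\<^sup>2)"
    by (rule polynomials_inverse_estimate[where k=k and 'a='a]) (rule that)
  show thesis
  proof (rule that[OF C(1)])
    fix T :: "'a set" and x0 r a b and p :: "'a \<Rightarrow> real" and g :: "'a \<Rightarrow> 'a"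
    assume T: "convex T" "compact T" and ball: "cball x0 r \<subseteq> T" "r > 0"
      and p: "\<And>x. (p has_derivative (\<lambda>h. g x \<bullet> h)) (at x)"
      and g: "\<And>b. b \<in> Basis \<Longrightarrow> (\<lambda>x. g x \<bullet> b) \<in> polynomials k" and ab: "a \<in> T" "b \<in> T"
    have gb: "(norm (g z))\<^sup>2 * r ^ DIM('a) \<le> C * (LINT y:T|lborel. (norm (g y))\<^sup>2)" if "z \<in> T" for z
    proof -
      have "(norm (g z))\<^sup>2 * r ^ DIM('a) = (\<Sum>b\<in>Basis. (g z \<bullet> b)\<^sup>2 * r ^ DIM('a))"
        by (simp add: norm_sq_gradient_sum sum_distrib_right)
      also have "\<dots> \<le> (\<Sum>b\<in>Basis. C * (LINT y:T|lborel. (g y \<bullet> b)\<^sup>2))"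
        by (intro sum_mono C(2)[OF T ball g] that)
      also have "\<dots> = C * (\<Sum>b\<in>Basis. (LINT y:T|lborel. (g y \<bullet> b)\<^sup>2))" by (simp add: sum_distrib_left)
      also have "(\<Sum>b\<in>Basis. (LINT y:T|lborel. (g y \<bullet> b)\<^sup>2)) = (LINT y:T|lborel. (\<Sum>b\<in>Basis. (g y \<bullet> b)\<^sup>2))"
        unfolding set_lebesgue_integral_def scaleR_sum_right
        by (intro Bochner_Integration.integral_sum[symmetric] borel_integrable_compact T continuous_intros
            polynomials_continuous[OF g])
      finally show ?thesis by (simp add: norm_sq_gradient_sum)
    qed
    define \<gamma> where "\<gamma> t = a + t *\<^sub>R (b - a)" for t :: real
    have \<gamma>T: "\<gamma> t \<in> T" if "0 \<le> t" "t \<le> 1" for t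
      using convexD_alt[OF T(1) ab that] by (simp add: \<gamma>_def algebra_simps)
    have fd: "((\<lambda>t. p (\<gamma> t)) has_field_derivative (g (\<gamma> t) \<bullet> (b - a))) (at t)" for t
    proof -
      have inn: "(\<gamma> has_derivative (\<lambda>h. h *\<^sub>R (b - a))) (at t)"
        unfolding \<gamma>_def by (auto intro!: derivative_eq_intros)
      have "((\<lambda>t. p (\<gamma> t)) has_derivative (\<lambda>h. g (\<gamma> t) \<bullet> (h *\<^sub>R (b - a)))) (at t)"
        using has_derivative_compose[OF inn p] .
      then show ?thesis unfolding has_field_derivative_def by (simp add: mult_commute_abs)
    qed
    obtain z where z: "0 < z" "z < 1" "p (\<gamma> 1) - p (\<gamma> 0) = (1 - 0) * (g (\<gamma> z) \<bullet> (b - a))"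
      using MVT2[of 0 1 "\<lambda>t. p (\<gamma> t)" "\<lambda>t. g (\<gamma> t) \<bullet> (b - a)"] fd by auto
    then have "p b - p a = g (\<gamma> z) \<bullet> (b - a)" by (simp add: \<gamma>_def)
    then have "\<bar>p a - p b\<bar> \<le> norm (g (\<gamma> z)) * dist a b"
      using Cauchy_Schwarz_ineq2[of "g (\<gamma> z)" "b - a"] by (simp add: dist_norm norm_minus_commute abs_minus_commute)
    then have "(p a - p b)\<^sup>2 \<le> (norm (g (\<gamma> z)) * dist a b)\<^sup>2"
      by (metis abs_ge_zero power2_abs power_mono)
    then have "(p a - p b)\<^sup>2 * r ^ DIM('a) \<le> (norm (g (\<gamma> z)) * dist a b)\<^sup>2 * r ^ DIM('a)"
      using ball by (intro mult_right_mono) auto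
    also have "\<dots> = (dist a b)\<^sup>2 * ((norm (g (\<gamma> z)))\<^sup>2 * r ^ DIM('a))" by (simp add: power_mult_distrib mult_ac)
    also have "\<dots> \<le> (dist a b)\<^sup>2 * (C * (LINT y:T|lborel. (norm (g y))\<^sup>2))"
      using z by (intro mult_left_mono gb \<gamma>T) auto
    finally show "(p a - p b)\<^sup>2 * r ^ DIM('a) \<le> C * (dist a b)\<^sup>2 * (LINT y:T|lborel. (norm (g y))\<^sup>2)"
      by (simp add: mult_ac)
  qed
qed

section \<open>Lagrange interpolation on a simplex\<close>

definition verts :: "'a::euclidean_space set \<Rightarrow> 'a set" where
  "verts T = {v. v extreme_point_of T}"

text \<open>Barycentric coordinates, taken as affine functions on the whole space instead of weights
  of a convex combination, so that they can serve as polynomial factors and have a gradient to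
  estimate.\<close>

definition bary :: "'a::euclidean_space set \<Rightarrow> 'a \<Rightarrow> 'a \<Rightarrow> real" where
  "bary T v = (SOME f. (\<exists>a u. f = (\<lambda>x. a + u \<bullet> x)) \<and> (\<forall>w\<in>verts T. f w = (if w = v then 1 else 0)))"

lemma full_simplex_verts:
  assumes "int DIM('a) simplex (T :: 'a::euclidean_space set)"
  shows "\<not> affine_dependent (verts T)" "finite (verts T)" "card (verts T) = Suc DIM('a)"
    "T = convex hull verts T" "convex T" "compact T" "interior T \<noteq> {}"
proof -
  obtain C where C: "\<not> affine_dependent C" "int (card C) = int DIM('a) + 1" "T = convex hull C"
    using assms unfolding simplex_def by blast
  have "verts T = C" unfolding verts_def C(3) using extreme_point_of_convex_hull_affine_independent[OF C(1)] by blast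
  then show "\<not> affine_dependent (verts T)" "finite (verts T)" "card (verts T) = Suc DIM('a)"
    "T = convex hull verts T" "convex T" "compact T"
    using C aff_independent_finite[OF C(1)] by (auto simp: finite_imp_compact_convex_hull)
  then show "interior T \<noteq> {}" using interior_convex_hull_eq_empty[of "verts T"] by metis
qed

lemma linear_functional_inner:
  fixes g :: "'a::euclidean_space \<Rightarrow> real"
  assumes "linear g"
  shows "g x = (\<Sum>b\<in>Basis. g b *\<^sub>R b) \<bullet> x"
proof -
  have "g x = g (\<Sum>b\<in>Basis. (x \<bullet> b) *\<^sub>R b)" by (simp add: euclidean_representation)
  also have "\<dots> = (\<Sum>b\<in>Basis. g b * (b \<bullet> x))"
    using assms by (simp add: linear_sum linear_scale o_def inner_commute mult.commute)
  finally show ?thesis by (simp add: inner_sum_left)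
qed

text \<open>With another vertex \<open>c\<close> as origin the differences to the remaining vertices
  are independent, so values on them extend to a linear functional.\<close>

lemma bary_exists:
  fixes C :: "'a::euclidean_space set"
  assumes C: "\<not> affine_dependent C" "v \<in> C" "card C \<ge> 2"
  shows "\<exists>a u. \<forall>w\<in>C. a + u \<bullet> w = (if w = v then 1 else 0)"
proof -
  have "finite C" using C(1) by (rule aff_independent_finite)
  have "C \<noteq> {v}" using C(3) by auto
  then obtain c where c: "c \<in> C" "c \<noteq> v" using C(2) by blast
  have "independent ((\<lambda>x. - c + x) ` (C - {c}))" using affine_dependent_iff_dependent2[OF c(1)] C(1) by blast
  from linear_independent_extend[OF this, of "\<lambda>y. if y = - c + v then 1 else 0 :: real"]
  obtain g :: "'a \<Rightarrow> real" where g: "linear g" "\<forall>y\<in>(\<lambda>x. - c + x) ` (C - {c}). g y = (if y = - c + v then 1 else 0)"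
    by blast
  define u where "u = (\<Sum>b\<in>Basis. g b *\<^sub>R b)"
  have u: "g x = u \<bullet> x" for x unfolding u_def by (rule linear_functional_inner[OF g(1)])
  have "- (u \<bullet> c) + u \<bullet> w = (if w = v then 1 else 0)" if "w \<in> C" for w
  proof (cases "w = c")
    case False
    then have "g (- c + w) = (if w = v then 1 else 0)" using that g(2) by auto
    then show ?thesis unfolding u inner_add_right by (simp split: if_splits)
  qed (use c in simp)
  then show ?thesis by blast
qed

context
  fixes T :: "'a::euclidean_space set"
  assumes T: "int DIM('a) simplex T"
begin

lemma card_verts_ge: "card (verts T) \<ge> 2"
  using full_simplex_verts(3)[OF T] by (simp add: Suc_le_eq)

lemma bary_props:
  assumes "v \<in> verts T"
  shows "\<exists>a u. bary T v = (\<lambda>x. a + u \<bullet> x)" "\<And>w. w \<in> verts T \<Longrightarrow> bary T v w = (if w = v then 1 else 0)"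
proof -
  obtain a u where au: "\<forall>w\<in>verts T. a + u \<bullet> w = (if w = v then 1 else 0)"
    using bary_exists[OF full_simplex_verts(1)[OF T] assms card_verts_ge] by blast
  have "\<exists>f. (\<exists>a u. f = (\<lambda>x. a + u \<bullet> x)) \<and> (\<forall>w\<in>verts T. f w = (if w = v then 1 else 0))"
    by (intro exI[of _ "\<lambda>x. a + u \<bullet> x"] conjI exI[of _ a] exI[of _ u] refl au)
  from someI_ex[OF this] have "(\<exists>a u. bary T v = (\<lambda>x. a + u \<bullet> x)) \<and> (\<forall>w\<in>verts T. bary T v w = (if w = v then 1 else 0))"
    unfolding bary_def .
  then show "\<exists>a u. bary T v = (\<lambda>x. a + u \<bullet> x)" "\<And>w. w \<in> verts T \<Longrightarrow> bary T v w = (if w = v then 1 else 0)" by auto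
qed

lemma bary_affine_comb:
  assumes "v \<in> verts T" "sum c I = 1"
  shows "bary T v (\<Sum>i\<in>I. c i *\<^sub>R y i) = (\<Sum>i\<in>I. c i * bary T v (y i))"
proof -
  obtain a u where au: "bary T v = (\<lambda>x. a + u \<bullet> x)" using bary_props(1)[OF assms(1)] by blast
  have "(\<Sum>i\<in>I. c i * bary T v (y i)) = a * sum c I + (\<Sum>i\<in>I. c i * (u \<bullet> y i))"
    unfolding au by (simp add: distrib_left sum.distrib sum_distrib_left mult.commute)
  also have "\<dots> = bary T v (\<Sum>i\<in>I. c i *\<^sub>R y i)" unfolding au by (simp add: assms(2) inner_sum_right)
  finally show ?thesis by simp
qed

lemma bary_of_comb:
  assumes "v \<in> verts T" "sum c (verts T) = 1"
  shows "bary T v (\<Sum>w\<in>verts T. c w *\<^sub>R w) = c v"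
proof -
  have "bary T v (\<Sum>w\<in>verts T. c w *\<^sub>R w) = (\<Sum>w\<in>verts T. c w * bary T v w)"
    by (rule bary_affine_comb[OF assms])
  also have "\<dots> = (\<Sum>w\<in>verts T. if w = v then c v else 0)"
    using bary_props(2)[OF assms(1)] by (intro sum.cong) auto
  also have "\<dots> = c v" using full_simplex_verts(2)[OF T] assms(1) by simp
  finally show ?thesis .
qed

lemma bary_convex2:
  assumes "v \<in> verts T"
  shows "bary T v ((1 - t) *\<^sub>R x + t *\<^sub>R y) = (1 - t) * bary T v x + t * bary T v y"
proof -
  obtain a u where au: "bary T v = (\<lambda>x. a + u \<bullet> x)" using bary_props(1)[OF assms(1)] by blast
  show ?thesis unfolding au by (simp add: inner_add_right algebra_simps)
qed

lemma bary_comb: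
  assumes "x \<in> T"
  shows "(\<Sum>v\<in>verts T. bary T v x) = 1" "x = (\<Sum>v\<in>verts T. bary T v x *\<^sub>R v)" "\<And>v. v \<in> verts T \<Longrightarrow> 0 \<le> bary T v x"
proof -
  have "x \<in> convex hull verts T" using assms full_simplex_verts(4)[OF T] by simp
  then obtain u where u: "\<forall>x\<in>verts T. 0 \<le> u x" "sum u (verts T) = 1" "(\<Sum>v\<in>verts T. u v *\<^sub>R v) = x"
    unfolding convex_hull_finite[OF full_simplex_verts(2)[OF T]] by blast
  have "bary T v x = u v" if "v \<in> verts T" for v
    using bary_of_comb[OF that u(2)] u(3) by simp
  then show "(\<Sum>v\<in>verts T. bary T v x) = 1" "x = (\<Sum>v\<in>verts T. bary T v x *\<^sub>R v)" "\<And>v. v \<in> verts T \<Longrightarrow> 0 \<le> bary T v x"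
    using u by simp_all
qed

lemma comb_in_T:
  assumes "\<And>v. v \<in> verts T \<Longrightarrow> 0 \<le> c v" "sum c (verts T) = 1"
  shows "(\<Sum>v\<in>verts T. c v *\<^sub>R v) \<in> T"
proof -
  have "(\<Sum>v\<in>verts T. c v *\<^sub>R v) \<in> convex hull verts T"
    unfolding convex_hull_finite[OF full_simplex_verts(2)[OF T]] using assms by blast
  then show ?thesis using full_simplex_verts(4)[OF T] by simp
qed

lemma verts_subset: "verts T \<subseteq> T"
  by (auto simp: verts_def extreme_point_of_def)

lemma bary_le_1:
  assumes "x \<in> T" "v \<in> verts T"
  shows "bary T v x \<le> 1"
  using member_le_sum[of v "verts T" "\<lambda>v. bary T v x"] bary_comb[OF assms(1)] assms(2) full_simplex_verts(2)[OF T] by simp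

text \<open>With weight \<open>l\<close> strictly between 0 and 1, \<open>x\<close> lies in the open
  segment between \<open>v\<close> and the point \<open>y\<close> obtained by renormalising the
  other weights. A face that contains \<open>x\<close> then contains both ends.\<close>

lemma bary_face:
  assumes F: "F face_of T" and x: "x \<in> F" and v: "v \<in> verts T" "bary T v x > 0"
  shows "v \<in> F"
proof (cases "x = v")
  case False
  have xT: "x \<in> T" using F x face_of_imp_subset by blast
  define l where "l = bary T v x"
  have l: "0 < l" "l \<le> 1" using v bary_le_1[OF xT v(1)] by (auto simp: l_def)
  have rest: "x = l *\<^sub>R v + (\<Sum>w\<in>verts T - {v}. bary T w x *\<^sub>R w)" "1 = l + (\<Sum>w\<in>verts T - {v}. bary T w x)"
    using bary_comb(1,2)[OF xT] sum.remove[OF full_simplex_verts(2)[OF T] v(1), of "\<lambda>w. bary T w x *\<^sub>R w"]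
      sum.remove[OF full_simplex_verts(2)[OF T] v(1), of "\<lambda>w. bary T w x"] by (simp_all add: l_def)
  have "l \<noteq> 1"
  proof
    assume "l = 1"
    then have "(\<Sum>w\<in>verts T - {v}. bary T w x) = 0" using rest(2) by simp
    then have "\<forall>w\<in>verts T - {v}. bary T w x = 0"
      using bary_comb(3)[OF xT] full_simplex_verts(2)[OF T] by (subst (asm) sum_nonneg_eq_0_iff) auto
    then have "(\<Sum>w\<in>verts T - {v}. bary T w x *\<^sub>R w) = 0" by (intro sum.neutral) simp
    then have "x = v" using rest(1) \<open>l = 1\<close> by simp
    then show False using False by simp
  qed
  then have l1: "l < 1" using l by simp
  define y where "y = (1 / (1 - l)) *\<^sub>R (x - l *\<^sub>R v)"
  have "y = (\<Sum>w\<in>verts T. (if w = v then 0 else bary T w x / (1 - l)) *\<^sub>R w)"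
  proof -
    have "x - l *\<^sub>R v = (\<Sum>w\<in>verts T - {v}. bary T w x *\<^sub>R w)" using rest(1) by (metis add_diff_cancel_left')
    then have "y = (\<Sum>w\<in>verts T - {v}. (bary T w x / (1 - l)) *\<^sub>R w)" by (simp add: y_def scaleR_sum_right)
    then show ?thesis
      using sum.remove[OF full_simplex_verts(2)[OF T] v(1), of "\<lambda>w. (if w = v then 0 else bary T w x / (1 - l)) *\<^sub>R w"] by simp
  qed
  also have "\<dots> \<in> T"
  proof (rule comb_in_T)
    show "0 \<le> (if w = v then 0 else bary T w x / (1 - l))" if "w \<in> verts T" for w
      using bary_comb(3)[OF xT that] l1 by simp
    have "(\<Sum>w\<in>verts T. if w = v then 0 else bary T w x / (1 - l)) = (\<Sum>w\<in>verts T - {v}. bary T w x / (1 - l))"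
      using sum.remove[OF full_simplex_verts(2)[OF T] v(1), of "\<lambda>w. if w = v then 0 else bary T w x / (1 - l)"] by simp
    also have "\<dots> = (\<Sum>w\<in>verts T - {v}. bary T w x) / (1 - l)" by (simp add: sum_divide_distrib)
    also have "\<dots> = 1" using rest(2) l1 by (simp add: field_simps)
    finally show "(\<Sum>w\<in>verts T. if w = v then 0 else bary T w x / (1 - l)) = 1" .
  qed
  finally have yT: "y \<in> T" .
  have xy: "x = (1 - l) *\<^sub>R y + l *\<^sub>R v" using l1 by (simp add: y_def)
  have "y \<noteq> v"
  proof
    assume "y = v"
    then have "x = v" using xy by (simp flip: scaleR_add_left)
    then show False using False by simp
  qed
  then have "x \<in> open_segment y v" using xy l l1 unfolding in_segment by blast
  then show ?thesis using face_ofD[OF F _ yT _ x] verts_subset v(1) by blast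
qed (use x in simp)

text \<open>A move of length \<open>r\<close> from \<open>x0\<close> along the gradient
  \<open>u\<close> raises the coordinate by \<open>norm u * r\<close>, yet its values on
  \<open>T\<close> lie between 0 and 1. Shape regularity enters through the radius
  \<open>r\<close>.\<close>

lemma bary_lipschitz:
  assumes ball: "cball x0 r \<subseteq> T" "r > 0" and v: "v \<in> verts T"
  shows "\<bar>bary T v x - bary T v y\<bar> \<le> dist x y / r"
proof -
  obtain a u where au: "bary T v = (\<lambda>x. a + u \<bullet> x)" using bary_props(1)[OF v] by blast
  have "norm u * r \<le> 1"
  proof (cases "u = 0")
    case False
    define z where "z = x0 + (r / norm u) *\<^sub>R u"
    have "dist x0 z = r" using ball(2) False by (simp add: z_def dist_norm)
    then have "z \<in> T" "x0 \<in> T" using ball by auto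
    then have "bary T v z \<le> 1" "0 \<le> bary T v x0" using bary_le_1 bary_comb(3) v by auto
    moreover have "bary T v z - bary T v x0 = norm u * r"
      unfolding au z_def using False by (simp add: inner_add_right power2_norm_eq_inner[symmetric] power2_eq_square)
    ultimately show ?thesis by simp
  qed simp
  then have nu: "norm u \<le> 1 / r" using ball(2) by (simp add: field_simps)
  have "\<bar>bary T v x - bary T v y\<bar> = \<bar>u \<bullet> (x - y)\<bar>" unfolding au by (simp add: inner_diff_right)
  also have "\<dots> \<le> norm u * norm (x - y)" by (rule Cauchy_Schwarz_ineq2)
  also have "\<dots> \<le> 1 / r * norm (x - y)" by (intro mult_right_mono nu) auto
  finally show ?thesis by (simp add: dist_norm)
qed

section \<open>Lagrange polynomials of the principal lattice\<close>

definition lattice_indices :: "nat \<Rightarrow> ('a \<Rightarrow> nat) set" where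
  "lattice_indices m = {\<alpha> \<in> verts T \<rightarrow>\<^sub>E {..m}. sum \<alpha> (verts T) = m}"

text \<open>If the entries of \<open>\<alpha>\<close> sum to \<open>k\<close>, this is the Lagrange
  basis polynomial of degree \<open>k\<close> for the lattice point with weights
  \<open>\<alpha> v / k\<close>. Smaller sums occur as intermediate stages in the expansion of
  polynomials.\<close>

definition lagrange :: "nat \<Rightarrow> ('a \<Rightarrow> nat) \<Rightarrow> 'a \<Rightarrow> real" where
  "lagrange k \<alpha> x = (\<Prod>v\<in>verts T. (real k * bary T v x) gchoose \<alpha> v)"

lemma finite_lattice_indices: "finite (lattice_indices m)"
  unfolding lattice_indices_def
  using full_simplex_verts(2)[OF T] by (intro finite_subset[OF _ finite_PiE[of "verts T" "\<lambda>_. {..m}"]]) auto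

lemma card_lattice_indices: "card (lattice_indices m) \<le> Suc m ^ Suc DIM('a)"
proof -
  have "card (lattice_indices m) \<le> card (verts T \<rightarrow>\<^sub>E {..m})"
    unfolding lattice_indices_def using full_simplex_verts(2)[OF T] by (intro card_mono finite_PiE) auto
  also have "\<dots> = Suc m ^ Suc DIM('a)"
    using full_simplex_verts(2,3)[OF T] by (subst card_PiE) auto
  finally show ?thesis .
qed

text \<open>Equality is demanded on \<open>T\<close> only, where the barycentric coordinates are
  known to sum to 1.\<close>

definition lagrange_span :: "nat \<Rightarrow> nat \<Rightarrow> ('a \<Rightarrow> real) set" where
  "lagrange_span k m = {f. \<exists>c. \<forall>x\<in>T. f x = (\<Sum>\<alpha>\<in>lattice_indices m. c \<alpha> * lagrange k \<alpha> x)}"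

lemma lagrange_span_add:
  assumes "f \<in> lagrange_span k m" "g \<in> lagrange_span k m"
  shows "(\<lambda>x. f x + g x) \<in> lagrange_span k m"
proof -
  obtain c d where "\<forall>x\<in>T. f x = (\<Sum>\<alpha>\<in>lattice_indices m. c \<alpha> * lagrange k \<alpha> x)"
    "\<forall>x\<in>T. g x = (\<Sum>\<alpha>\<in>lattice_indices m. d \<alpha> * lagrange k \<alpha> x)"
    using assms unfolding lagrange_span_def by blast
  then have "\<forall>x\<in>T. f x + g x = (\<Sum>\<alpha>\<in>lattice_indices m. (c \<alpha> + d \<alpha>) * lagrange k \<alpha> x)"
    by (simp add: distrib_right sum.distrib)
  then show ?thesis unfolding lagrange_span_def by (intro CollectI exI)
qed

lemma lagrange_span_cmult:
  assumes "f \<in> lagrange_span k m"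
  shows "(\<lambda>x. a * f x) \<in> lagrange_span k m"
proof -
  obtain c where "\<forall>x\<in>T. f x = (\<Sum>\<alpha>\<in>lattice_indices m. c \<alpha> * lagrange k \<alpha> x)"
    using assms unfolding lagrange_span_def by blast
  then have "\<forall>x\<in>T. a * f x = (\<Sum>\<alpha>\<in>lattice_indices m. (a * c \<alpha>) * lagrange k \<alpha> x)"
    by (simp add: sum_distrib_left mult.assoc)
  then show ?thesis unfolding lagrange_span_def by (intro CollectI exI)
qed

lemma lagrange_span_zero: "(\<lambda>x. 0) \<in> lagrange_span k m"
  unfolding lagrange_span_def by (auto intro!: exI[of _ "\<lambda>_. 0"])

lemma lagrange_span_sum:
  assumes "\<And>i. i \<in> I \<Longrightarrow> f i \<in> lagrange_span k m"
  shows "(\<lambda>x. \<Sum>i\<in>I. f i x) \<in> lagrange_span k m"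
  using assms
proof (induction I rule: infinite_finite_induct)
  case (insert i I)
  then show ?case using lagrange_span_add[of "f i" k m "\<lambda>x. \<Sum>i\<in>I. f i x"] by simp
qed (simp_all add: lagrange_span_zero)

lemma lagrange_in_span:
  assumes "\<alpha> \<in> lattice_indices m"
  shows "lagrange k \<alpha> \<in> lagrange_span k m"
proof -
  have "lagrange k \<alpha> x = (\<Sum>\<beta>\<in>lattice_indices m. (if \<beta> = \<alpha> then 1 else 0) * lagrange k \<beta> x)" for x
    using assms finite_lattice_indices by (simp add: if_distrib[of "\<lambda>y. y * _"] cong: if_cong)
  then show ?thesis unfolding lagrange_span_def by (intro CollectI exI ballI)
qed

lemma lagrange_span_cong:
  assumes "f \<in> lagrange_span k m" "\<And>x. x \<in> T \<Longrightarrow> g x = f x"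
  shows "g \<in> lagrange_span k m"
  using assms unfolding lagrange_span_def by auto

lemma lattice_indices_upd:
  assumes "\<alpha> \<in> lattice_indices m" "v \<in> verts T"
  shows "\<alpha>(v := Suc (\<alpha> v)) \<in> lattice_indices (Suc m)"
proof -
  have a: "\<alpha> \<in> verts T \<rightarrow>\<^sub>E {..m}" "sum \<alpha> (verts T) = m" using assms(1) by (auto simp: lattice_indices_def)
  have "(\<Sum>w\<in>verts T. (\<alpha>(v := Suc (\<alpha> v))) w) = Suc m"
    using a(2) sum.remove[OF full_simplex_verts(2)[OF T] assms(2), of \<alpha>]
      sum.remove[OF full_simplex_verts(2)[OF T] assms(2), of "\<alpha>(v := Suc (\<alpha> v))"] by simp
  moreover have "\<alpha>(v := Suc (\<alpha> v)) \<in> verts T \<rightarrow>\<^sub>E {..Suc m}"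
    using a(1) assms(2) by (auto simp: PiE_iff extensional_def le_Suc_eq)
  ultimately show ?thesis unfolding lattice_indices_def by blast
qed

text \<open>The identity \<open>t * (t gchoose a) = a * (t gchoose a) + (a + 1) * (t gchoose (a +
  1))\<close>, applied to the factor of \<open>v\<close>.\<close>

lemma lagrange_mult_bary:
  assumes "v \<in> verts T"
  shows "(real k * bary T v x) * lagrange k \<alpha> x =
    real (\<alpha> v) * lagrange k \<alpha> x + real (Suc (\<alpha> v)) * lagrange k (\<alpha>(v := Suc (\<alpha> v))) x"
proof -
  define R where "R = (\<Prod>w\<in>verts T - {v}. (real k * bary T w x) gchoose \<alpha> w)"
  define t where "t = real k * bary T v x"
  have 1: "lagrange k \<alpha> x = (t gchoose \<alpha> v) * R"
    unfolding lagrange_def R_def t_def by (rule prod.remove[OF full_simplex_verts(2)[OF T] assms])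
  have 2: "lagrange k (\<alpha>(v := Suc (\<alpha> v))) x = (t gchoose Suc (\<alpha> v)) * R"
    unfolding lagrange_def R_def t_def
    by (subst prod.remove[OF full_simplex_verts(2)[OF T] assms]) (auto intro!: prod.cong)
  have "t * (t gchoose \<alpha> v) * R = (real (\<alpha> v) * (t gchoose \<alpha> v) + real (Suc (\<alpha> v)) * (t gchoose Suc (\<alpha> v))) * R"
    using gbinomial_mult_1[of t "\<alpha> v"] by simp
  then show ?thesis unfolding 1 2 t_def[symmetric] by (simp add: algebra_simps)
qed

text \<open>Multiplication by \<open>1 = (\<Sum>\<^sub>v k \<lambda>\<^sub>v - \<alpha>\<^sub>v) / (k - m)\<close>, with \<open>\<lambda>\<^sub>v\<close> the barycentric coordinates, raises the degree.\<close>

lemma lagrange_span_Suc: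
  assumes "f \<in> lagrange_span k m" "m < k"
  shows "f \<in> lagrange_span k (Suc m)"
proof -
  obtain c where c: "\<forall>x\<in>T. f x = (\<Sum>\<alpha>\<in>lattice_indices m. c \<alpha> * lagrange k \<alpha> x)"
    using assms(1) unfolding lagrange_span_def by blast
  have "lagrange k \<alpha> \<in> lagrange_span k (Suc m)" if \<alpha>: "\<alpha> \<in> lattice_indices m" for \<alpha>
  proof -
    have "(\<lambda>x. 1 / (real k - real m) * (\<Sum>v\<in>verts T. real (Suc (\<alpha> v)) * lagrange k (\<alpha>(v := Suc (\<alpha> v))) x)) \<in> lagrange_span k (Suc m)"
      by (intro lagrange_span_cmult lagrange_span_sum lagrange_in_span lattice_indices_upd \<alpha>)
    then show ?thesis
    proof (rule lagrange_span_cong)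
      fix x assume x: "x \<in> T"
      have "(\<Sum>v\<in>verts T. real (Suc (\<alpha> v)) * lagrange k (\<alpha>(v := Suc (\<alpha> v))) x) =
        (\<Sum>v\<in>verts T. (real k * bary T v x - real (\<alpha> v)) * lagrange k \<alpha> x)"
        by (intro sum.cong refl) (simp add: left_diff_distrib lagrange_mult_bary del: of_nat_Suc)
      also have "\<dots> = (real k * (\<Sum>v\<in>verts T. bary T v x) - real (sum \<alpha> (verts T))) * lagrange k \<alpha> x"
        by (simp add: sum_distrib_left sum_distrib_right sum_subtractf left_diff_distrib)
      also have "\<dots> = (real k - real m) * lagrange k \<alpha> x"
        using \<alpha> by (simp add: bary_comb(1)[OF x] lattice_indices_def)
      finally show "lagrange k \<alpha> x = 1 / (real k - real m) * (\<Sum>v\<in>verts T. real (Suc (\<alpha> v)) * lagrange k (\<alpha>(v := Suc (\<alpha> v))) x)"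
        using assms(2) by simp
    qed
  qed
  then have "(\<lambda>x. \<Sum>\<alpha>\<in>lattice_indices m. c \<alpha> * lagrange k \<alpha> x) \<in> lagrange_span k (Suc m)"
    by (intro lagrange_span_cmult lagrange_span_sum)
  then show ?thesis by (rule lagrange_span_cong) (use c in simp)
qed

lemma lagrange_span_mult_bary:
  assumes "f \<in> lagrange_span k m" "m < k" "v \<in> verts T"
  shows "(\<lambda>x. bary T v x * f x) \<in> lagrange_span k (Suc m)"
proof -
  obtain c where c: "\<forall>x\<in>T. f x = (\<Sum>\<alpha>\<in>lattice_indices m. c \<alpha> * lagrange k \<alpha> x)"
    using assms(1) unfolding lagrange_span_def by blast
  have k: "real k \<noteq> 0" using assms(2) by simp
  have "(\<lambda>x. \<Sum>\<alpha>\<in>lattice_indices m. c \<alpha> * (1 / real k * (real (\<alpha> v) * lagrange k \<alpha> x + real (Suc (\<alpha> v)) * lagrange k (\<alpha>(v := Suc (\<alpha> v))) x))) \<in> lagrange_span k (Suc m)"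
    by (intro lagrange_span_sum lagrange_span_cmult lagrange_span_add lagrange_in_span lattice_indices_upd assms
        lagrange_span_Suc[OF lagrange_in_span])
  then show ?thesis
  proof (rule lagrange_span_cong)
    fix x assume "x \<in> T"
    have "bary T v x * f x = (\<Sum>\<alpha>\<in>lattice_indices m. c \<alpha> * (1 / real k * ((real k * bary T v x) * lagrange k \<alpha> x)))"
      using c \<open>x \<in> T\<close> k by (simp add: sum_distrib_left mult_ac)
    then show "bary T v x * f x = (\<Sum>\<alpha>\<in>lattice_indices m. c \<alpha> * (1 / real k * (real (\<alpha> v) * lagrange k \<alpha> x + real (Suc (\<alpha> v)) * lagrange k (\<alpha>(v := Suc (\<alpha> v))) x)))"
      by (simp only: lagrange_mult_bary[OF assms(3)])
  qed
qed

text \<open>A coordinate is a combination of barycentric coordinates, and multiplication by one of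
  these raises the total degree by one. For \<open>m = k\<close> this is exactness of Lagrange
  interpolation, obtained without a dimension count.\<close>

lemma polynomials_lagrange_span:
  assumes "p \<in> polynomials m" "m \<le> k"
  shows "p \<in> lagrange_span k m"
  using assms
proof (induction rule: polynomials_induct)
  case (const m c)
  then show ?case
  proof (induction m)
    case 0
    define z where "z = (\<lambda>v\<in>verts T. 0::nat)"
    have z: "z \<in> lattice_indices 0" by (auto simp: z_def lattice_indices_def)
    have "lagrange k z x = 1" for x unfolding lagrange_def by (rule prod.neutral) (simp add: z_def)
    then show ?case using lagrange_span_cmult[OF lagrange_in_span[OF z, of k], of c] by simp
  next
    case (Suc m)
    then show ?case using lagrange_span_Suc[of "\<lambda>_. c" k m] by simp
  qed
next
  case (add m f g)
  then show ?case by (intro lagrange_span_add) auto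
next
  case (mult m f b)
  then have "f \<in> lagrange_span k m" "m < k" by auto
  then have "(\<lambda>x. \<Sum>v\<in>verts T. (v \<bullet> b) * (bary T v x * f x)) \<in> lagrange_span k (Suc m)"
    by (intro lagrange_span_sum lagrange_span_cmult lagrange_span_mult_bary)
  then show ?case
  proof (rule lagrange_span_cong)
    fix x assume "x \<in> T"
    have "x \<bullet> b = (\<Sum>v\<in>verts T. bary T v x *\<^sub>R v) \<bullet> b" using bary_comb(2)[OF \<open>x \<in> T\<close>] by simp
    also have "\<dots> = (\<Sum>v\<in>verts T. bary T v x * (v \<bullet> b))" by (simp add: inner_sum_left)
    finally show "x \<bullet> b * f x = (\<Sum>v\<in>verts T. (v \<bullet> b) * (bary T v x * f x))"
      unfolding sum_distrib_right by (simp only: sum_distrib_right) (intro sum.cong refl, simp)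
  qed
qed

definition lattice_point :: "nat \<Rightarrow> ('a \<Rightarrow> nat) \<Rightarrow> 'a" where
  "lattice_point k \<alpha> = (\<Sum>v\<in>verts T. (real (\<alpha> v) / real k) *\<^sub>R v)"

lemma lattice_point_bary:
  assumes "\<alpha> \<in> lattice_indices k" "k \<ge> 1" "v \<in> verts T"
  shows "real k * bary T v (lattice_point k \<alpha>) = real (\<alpha> v)"
proof -
  have "(\<Sum>w\<in>verts T. real (\<alpha> w) / real k) = real (sum \<alpha> (verts T)) / real k" by (simp add: sum_divide_distrib)
  also have "\<dots> = 1" using assms by (simp add: lattice_indices_def)
  finally show ?thesis unfolding lattice_point_def using bary_of_comb[OF assms(3)] assms(2) by simp
qed

lemma lattice_point_in:
  assumes "\<alpha> \<in> lattice_indices k" "k \<ge> 1"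
  shows "lattice_point k \<alpha> \<in> T"
  unfolding lattice_point_def
proof (rule comb_in_T)
  have "(\<Sum>w\<in>verts T. real (\<alpha> w) / real k) = real (sum \<alpha> (verts T)) / real k" by (simp add: sum_divide_distrib)
  also have "\<dots> = 1" using assms by (simp add: lattice_indices_def del: of_nat_sum)
  finally show "(\<Sum>w\<in>verts T. real (\<alpha> w) / real k) = 1" .
qed simp

text \<open>At lattice points the factors are the integers
  \<open>\<beta> v choose \<alpha> v\<close>. Different indices with the same sum have a vertex with
  \<open>\<beta> v < \<alpha> v\<close>, where the factor vanishes.\<close>

lemma lagrange_lattice_point:
  assumes "\<alpha> \<in> lattice_indices k" "\<beta> \<in> lattice_indices k" "k \<ge> 1"
  shows "lagrange k \<alpha> (lattice_point k \<beta>) = (if \<alpha> = \<beta> then 1 else 0)"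
proof -
  have eq: "lagrange k \<alpha> (lattice_point k \<beta>) = (\<Prod>v\<in>verts T. real (\<beta> v choose \<alpha> v))"
    unfolding lagrange_def by (intro prod.cong refl) (simp add: lattice_point_bary[OF assms(2,3)] binomial_gbinomial)
  show ?thesis
  proof (cases "\<alpha> = \<beta>")
    case False
    have "\<exists>v\<in>verts T. \<beta> v < \<alpha> v"
    proof (rule ccontr)
      assume "\<not> ?thesis"
      then have le: "\<And>v. v \<in> verts T \<Longrightarrow> \<alpha> v \<le> \<beta> v" by force
      have "sum \<alpha> (verts T) = sum \<beta> (verts T)" using assms by (simp add: lattice_indices_def)
      then have "\<alpha> v = \<beta> v" if "v \<in> verts T" for v
        using sum_mono_inv[of \<alpha> "verts T" \<beta>] le that full_simplex_verts(2)[OF T] by blast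
      then have "\<alpha> = \<beta>" using assms by (intro extensionalityI[of _ "verts T"]) (auto simp: lattice_indices_def PiE_iff)
      then show False using False by simp
    qed
    then have "(\<Prod>v\<in>verts T. real (\<beta> v choose \<alpha> v)) = 0"
      using full_simplex_verts(2)[OF T] by (intro prod_zero) (auto simp: binomial_eq_0)
    then show ?thesis using False eq by simp
  next
    case True
    then show ?thesis using eq by simp
  qed
qed

lemma polynomials_unisolvent:
  assumes "p \<in> polynomials k" "k \<ge> 1" "\<And>\<alpha>. \<alpha> \<in> lattice_indices k \<Longrightarrow> p (lattice_point k \<alpha>) = 0" "x \<in> T"
  shows "p x = 0"
proof -
  obtain c where c: "\<forall>x\<in>T. p x = (\<Sum>\<alpha>\<in>lattice_indices k. c \<alpha> * lagrange k \<alpha> x)"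
    using polynomials_lagrange_span[OF assms(1) order_refl] unfolding lagrange_span_def by blast
  have "c \<beta> = 0" if \<beta>: "\<beta> \<in> lattice_indices k" for \<beta>
  proof -
    have "0 = (\<Sum>\<alpha>\<in>lattice_indices k. c \<alpha> * lagrange k \<alpha> (lattice_point k \<beta>))"
      using c lattice_point_in[OF \<beta> assms(2)] assms(3)[OF \<beta>] by simp
    also have "\<dots> = (\<Sum>\<alpha>\<in>lattice_indices k. if \<alpha> = \<beta> then c \<beta> else 0)"
      by (intro sum.cong refl) (auto simp: lagrange_lattice_point[OF _ \<beta> assms(2)])
    also have "\<dots> = c \<beta>" using \<beta> finite_lattice_indices by simp
    finally show ?thesis by simp
  qed
  then show ?thesis using c assms(4) by simp
qed

end

section \<open>Finite element functions on a triangulation\<close>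

lemma gbinomial_prod_Suc: "(t :: real) gchoose a = (\<Prod>i<a. (t - real i) / real (Suc i))"
  by (simp add: gbinomial_prod_rev fact_prod_Suc prod_dividef atLeast0LessThan)

text \<open>A single product of affine factors, of which there are \<open>k\<close> for indices of
  sum \<open>k\<close> (\<open>card_pairs\<close>). Degree and bounds are read off from it.\<close>

lemma lagrange_prod_pairs:
  assumes T: "int DIM('a) simplex (T :: 'a::euclidean_space set)"
  shows "lagrange T k \<alpha> x = (\<Prod>(v, i)\<in>(SIGMA v:verts T. {..<\<alpha> v}). (real k * bary T v x - real i) / real (Suc i))"
  unfolding lagrange_def[OF T] gbinomial_prod_Suc
  by (subst prod.Sigma) (use full_simplex_verts(2)[OF T] in auto)

lemma card_pairs:
  assumes T: "int DIM('a) simplex (T :: 'a::euclidean_space set)" and \<alpha>: "\<alpha> \<in> lattice_indices T k"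
  shows "card (SIGMA v:verts T. {..<\<alpha> v}) = k" "finite (SIGMA v:verts T. {..<\<alpha> v})"
  using full_simplex_verts(2)[OF T] \<alpha> by (auto simp: lattice_indices_def[OF T])

lemma lagrange_polynomial:
  assumes T: "int DIM('a) simplex (T :: 'a::euclidean_space set)" and \<alpha>: "\<alpha> \<in> lattice_indices T k"
  shows "lagrange T k \<alpha> \<in> polynomials k"
proof -
  have "\<forall>v. \<exists>a u. v \<in> verts T \<longrightarrow> bary T v = (\<lambda>x. a + u \<bullet> x)" using bary_props(1)[OF T] by blast
  then obtain a u where au: "\<And>v. v \<in> verts T \<Longrightarrow> bary T v = (\<lambda>x. a v + u v \<bullet> x)" by metis
  let ?I = "SIGMA v:verts T. {..<\<alpha> v}"
  have "(\<lambda>x. \<Prod>p\<in>?I. ((real k * a (fst p) - real (snd p)) / real (Suc (snd p)) + ((real k / real (Suc (snd p))) *\<^sub>R u (fst p)) \<bullet> x)) \<in> polynomials (card ?I)"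
    by (rule polynomials_prod_affine[OF card_pairs(2)[OF T \<alpha>]])
  also have "(\<lambda>x. \<Prod>p\<in>?I. ((real k * a (fst p) - real (snd p)) / real (Suc (snd p)) + ((real k / real (Suc (snd p))) *\<^sub>R u (fst p)) \<bullet> x)) = lagrange T k \<alpha>"
  proof
    fix x
    show "(\<Prod>p\<in>?I. ((real k * a (fst p) - real (snd p)) / real (Suc (snd p)) + ((real k / real (Suc (snd p))) *\<^sub>R u (fst p)) \<bullet> x)) = lagrange T k \<alpha> x"
      unfolding lagrange_prod_pairs[OF T]
      by (intro prod.cong refl) (auto simp: au add_divide_distrib diff_divide_distrib distrib_left)
  qed
  finally show ?thesis unfolding card_pairs(1)[OF T \<alpha>] .
qed

lemma lagrange_bounds:
  assumes T: "int DIM('a) simplex (T :: 'a::euclidean_space set)" and \<alpha>: "\<alpha> \<in> lattice_indices T k" and k: "k \<ge> 1"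
    and x: "x \<in> T"
  shows "\<bar>lagrange T k \<alpha> x\<bar> \<le> real k ^ k"
    and "\<And>y x0 r. y \<in> T \<Longrightarrow> cball x0 r \<subseteq> T \<Longrightarrow> r > 0 \<Longrightarrow> \<bar>lagrange T k \<alpha> x - lagrange T k \<alpha> y\<bar> \<le> real k ^ k * real k * dist x y / r"
proof -
  let ?I = "SIGMA v:verts T. {..<\<alpha> v}"
  \<comment> \<open>Division by \<open>k\<close> gives each factor modulus at most 1 on
    \<open>T\<close>, as \<open>norm_prod_diff\<close> demands. The price is the factor
    \<open>real k ^ k\<close>.\<close>
  define f where "f x p = (real k * bary T (fst p) x - real (snd p)) / real (Suc (snd p)) / real k" for x and p :: "'a \<times> nat"
  have f1: "norm (f x p) \<le> 1" if x: "x \<in> T" and p: "p \<in> ?I" for x p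
  proof -
    obtain v i where vi: "p = (v, i)" "v \<in> verts T" "i < \<alpha> v" using p by auto
    have "\<alpha> v \<le> k" using \<alpha> vi(2) by (auto simp: lattice_indices_def[OF T] PiE_iff)
    then have i: "real i \<le> real k" using vi by simp
    have "0 \<le> bary T v x" "bary T v x \<le> 1" using bary_comb(3)[OF T x vi(2)] bary_le_1[OF T x vi(2)] by auto
    then have "0 \<le> real k * bary T v x" "real k * bary T v x \<le> real k" by (auto simp: mult_left_le)
    then have *: "\<bar>real k * bary T v x - real i\<bar> \<le> real k" using i by (simp add: abs_le_iff)
    also have "\<dots> \<le> real (Suc i) * real k" using mult_right_mono[of 1 "real (Suc i)" "real k"] by simp
    finally show ?thesis using k by (simp add: f_def vi abs_divide divide_le_eq mult_ac)
  qed
  have lf: "lagrange T k \<alpha> x = real k ^ k * (\<Prod>p\<in>?I. f x p)" for x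
  proof -
    have "lagrange T k \<alpha> x = (\<Prod>p\<in>?I. real k * f x p)"
      unfolding lagrange_prod_pairs[OF T] using k by (intro prod.cong refl) (auto simp: f_def)
    then show ?thesis by (simp add: prod.distrib card_pairs(1)[OF T \<alpha>])
  qed
  have "norm (\<Prod>p\<in>?I. f x p) \<le> 1"
    unfolding prod_norm[symmetric] using f1[OF x] by (intro prod_le_1) auto
  then show "\<bar>lagrange T k \<alpha> x\<bar> \<le> real k ^ k" unfolding lf by (simp add: abs_mult mult_left_le)
  fix y x0 r assume y: "y \<in> T" and ball: "cball x0 r \<subseteq> T" "r > 0"
  have "norm ((\<Prod>p\<in>?I. f x p) - (\<Prod>p\<in>?I. f y p)) \<le> (\<Sum>p\<in>?I. norm (f x p - f y p))"
    by (rule norm_prod_diff) (use f1 x y in auto)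
  also have "\<dots> \<le> (\<Sum>p\<in>?I. dist x y / r)"
  proof (rule sum_mono)
    fix p assume "p \<in> ?I"
    then obtain v i where vi: "p = (v, i)" "v \<in> verts T" by auto
    have "f x p - f y p = (bary T v x - bary T v y) / real (Suc i)"
      using k by (simp add: f_def vi diff_divide_distrib del: of_nat_Suc)
    then have "norm (f x p - f y p) \<le> \<bar>bary T v x - bary T v y\<bar>"
      by (simp add: abs_divide divide_le_eq mult_le_cancel_left1)
    then show "norm (f x p - f y p) \<le> dist x y / r" using bary_lipschitz[OF T ball vi(2), of x y] by linarith
  qed
  also have "\<dots> = real k * dist x y / r" using card_pairs(1)[OF T \<alpha>] by simp
  finally have "\<bar>(\<Prod>p\<in>?I. f x p) - (\<Prod>p\<in>?I. f y p)\<bar> \<le> real k * dist x y / r" by simp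
  then have "real k ^ k * \<bar>(\<Prod>p\<in>?I. f x p) - (\<Prod>p\<in>?I. f y p)\<bar> \<le> real k ^ k * (real k * dist x y / r)"
    by (rule mult_left_mono) simp
  then show "\<bar>lagrange T k \<alpha> x - lagrange T k \<alpha> y\<bar> \<le> real k ^ k * real k * dist x y / r"
    unfolding lf by (simp add: abs_mult mult.assoc flip: right_diff_distrib)
qed

locale fe_mesh =
  fixes \<T> :: "'a::euclidean_space set set" and \<Omega> :: "'a set"
  assumes tri: "triangulation_of \<T> \<Omega>" and regular: "\<Omega> = interior (closure \<Omega>)"
begin

lemma fin: "finite \<T>" and full: "T \<in> \<T> \<Longrightarrow> int DIM('a) simplex T"
  and faces: "T \<in> \<T> \<Longrightarrow> T' \<in> \<T> \<Longrightarrow> (T \<inter> T') face_of T" and Un: "\<Union>\<T> = closure \<Omega>"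
  using tri by (auto simp: triangulation_of_def triangulation_def)

lemma open_dom: "open \<Omega>" using regular open_interior by metis

lemma dom_subset: "\<Omega> \<subseteq> \<Union>\<T>" using Un closure_subset by metis

lemma int_Un: "interior (\<Union>\<T>) = \<Omega>" using regular Un by simp

lemma elem_compact: "T \<in> \<T> \<Longrightarrow> compact T" and elem_convex: "T \<in> \<T> \<Longrightarrow> convex T"
  and finite_verts: "T \<in> \<T> \<Longrightarrow> finite (verts T)"
  and elem_interior: "T \<in> \<T> \<Longrightarrow> interior T \<noteq> {}"
  using full_simplex_verts[OF full] by auto

lemma elem_closed: "T \<in> \<T> \<Longrightarrow> closed T" using compact_imp_closed[OF elem_compact] .

lemma face_transfer:
  assumes "T \<in> \<T>" "T' \<in> \<T>" "x \<in> T" "x \<in> T'" "v \<in> verts T" "bary T v x \<noteq> 0"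
  shows "v \<in> verts T'"
proof -
  have pos: "bary T v x > 0" using bary_comb(3)[OF full[OF assms(1)] assms(3,5)] assms(6) by simp
  have F: "(T \<inter> T') face_of T" "(T \<inter> T') face_of T'" using faces[OF assms(1,2)] faces[OF assms(2,1)] by (auto simp: Int_commute)
  have "v \<in> T \<inter> T'" using bary_face[OF full[OF assms(1)] F(1) _ assms(5) pos] assms(3,4) by auto
  then have "v extreme_point_of (T \<inter> T')" using extreme_point_of_face[OF F(1)] assms(5) by (auto simp: verts_def)
  then show ?thesis using extreme_point_of_face[OF F(2)] by (auto simp: verts_def)
qed

text \<open>Expand \<open>x\<close> in the vertices of \<open>T'\<close>. Those of nonzero weight
  are vertices of \<open>T\<close> as well, where \<open>bary T v\<close> takes the values 0 and
  1.\<close>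

lemma bary_agree:
  assumes "T \<in> \<T>" "T' \<in> \<T>" "x \<in> T" "x \<in> T'" "v \<in> verts T" "v \<in> verts T'"
  shows "bary T v x = bary T' v x"
proof -
  have "bary T v x = bary T v (\<Sum>w\<in>verts T'. bary T' w x *\<^sub>R w)"
    using bary_comb(2)[OF full[OF assms(2)] assms(4)] by simp
  also have "\<dots> = (\<Sum>w\<in>verts T'. bary T' w x * bary T v w)"
    by (rule bary_affine_comb[OF full[OF assms(1)] assms(5) bary_comb(1)[OF full[OF assms(2)] assms(4)]])
  also have "\<dots> = (\<Sum>w\<in>verts T'. if w = v then bary T' v x else 0)"
  proof (rule sum.cong)
    fix w assume w: "w \<in> verts T'"
    show "bary T' w x * bary T v w = (if w = v then bary T' v x else 0)"
    proof (cases "bary T' w x = 0")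
      case False
      then have "w \<in> verts T" using face_transfer[OF assms(2,1,4,3) w] by simp
      then show ?thesis using bary_props(2)[OF full[OF assms(1)] assms(5), of w] by auto
    qed auto
  qed simp
  also have "\<dots> = bary T' v x" using finite_verts[OF assms(2)] assms(6) by simp
  finally show ?thesis .
qed

section \<open>Hat functions and carriers of points\<close>

definition hat :: "'a \<Rightarrow> 'a \<Rightarrow> real" where
  "hat v x = (if \<exists>T\<in>\<T>. x \<in> T \<and> v \<in> verts T then bary (SOME T. T \<in> \<T> \<and> x \<in> T \<and> v \<in> verts T) v x else 0)"

definition vertices :: "'a set" where "vertices = (\<Union>T\<in>\<T>. verts T)"

lemma finite_vertices: "finite vertices" unfolding vertices_def using fin finite_verts by blast

text \<open>By \<open>bary_agree\<close> the choice of an element in \<open>hat\<close> is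
  immaterial.\<close>

lemma hat_eq:
  assumes "T \<in> \<T>" "x \<in> T" "v \<in> verts T"
  shows "hat v x = bary T v x"
proof -
  define S where "S = (SOME T. T \<in> \<T> \<and> x \<in> T \<and> v \<in> verts T)"
  have ex: "\<exists>T. T \<in> \<T> \<and> x \<in> T \<and> v \<in> verts T" using assms by blast
  have S: "S \<in> \<T> \<and> x \<in> S \<and> v \<in> verts S" unfolding S_def by (rule someI_ex[OF ex])
  have "hat v x = bary S v x" unfolding hat_def S_def[symmetric] using ex by auto
  also have "\<dots> = bary T v x" using S assms by (intro bary_agree) auto
  finally show ?thesis .
qed

lemma hat_out:
  assumes "T \<in> \<T>" "x \<in> T" "v \<notin> verts T"
  shows "hat v x = 0"
proof (cases "\<exists>S\<in>\<T>. x \<in> S \<and> v \<in> verts S")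
  case True
  then obtain S where S: "S \<in> \<T>" "x \<in> S" "v \<in> verts S" by blast
  then have "bary S v x = 0" using face_transfer[of S T x v] assms by blast
  then show ?thesis using hat_eq[OF S] by simp
qed (auto simp: hat_def)

lemma hat_nonneg: "x \<in> \<Union>\<T> \<Longrightarrow> 0 \<le> hat v x"
  using hat_eq hat_out bary_comb(3)[OF full] by (metis UnionE order_refl)

lemma hat_comb:
  assumes "T \<in> \<T>" "x \<in> T"
  shows "(\<Sum>v\<in>verts T. hat v x) = 1" "x = (\<Sum>v\<in>verts T. hat v x *\<^sub>R v)"
  using bary_comb(1,2)[OF full[OF assms(1)] assms(2)] hat_eq[OF assms] by simp_all

lemma hat_le_1:
  assumes "T \<in> \<T>" "x \<in> T"
  shows "hat v x \<le> 1"
  using bary_le_1[OF full[OF assms(1)] assms(2)] hat_eq[OF assms] hat_out[OF assms] by (cases "v \<in> verts T") auto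

text \<open>For a point of the mesh these are the vertices of its carrier, the smallest face that
  contains it.\<close>

definition supp :: "'a \<Rightarrow> 'a set" where "supp x = {v. hat v x \<noteq> 0}"

lemma supp_subset: "T \<in> \<T> \<Longrightarrow> x \<in> T \<Longrightarrow> supp x \<subseteq> verts T"
  using hat_out by (auto simp: supp_def)

text \<open>The weights of \<open>x\<close> on its carrier are nonnegative, sum to 1 and reproduce
  \<open>x\<close>, so they describe a point of every element that has these vertices. Membership
  thus becomes combinatorial.\<close>

lemma supp_subset_imp_mem:
  assumes "x \<in> \<Union>\<T>" "T \<in> \<T>" "supp x \<subseteq> verts T"
  shows "x \<in> T"
proof -
  obtain S where S: "S \<in> \<T>" "x \<in> S" using assms(1) by blast
  have eq: "(\<Sum>v\<in>supp x. hat v x *\<^sub>R v) = (\<Sum>v\<in>verts U. hat v x *\<^sub>R v)"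
    "(\<Sum>v\<in>supp x. hat v x) = (\<Sum>v\<in>verts U. hat v x)" if "U \<in> \<T>" "supp x \<subseteq> verts U" for U
    by (intro sum.mono_neutral_left finite_verts that ballI; simp add: supp_def)+
  have "(\<Sum>v\<in>verts T. hat v x *\<^sub>R v) = x"
    using eq(1)[OF assms(2,3)] eq(1)[OF S(1) supp_subset[OF S]] hat_comb(2)[OF S, symmetric] by (metis (no_types))
  moreover have "(\<Sum>v\<in>verts T. hat v x) = 1"
    using eq(2)[OF assms(2,3)] eq(2)[OF S(1) supp_subset[OF S]] hat_comb(1)[OF S] by simp
  ultimately show ?thesis using comb_in_T[OF full[OF assms(2)], of "\<lambda>v. hat v x"] hat_nonneg[OF assms(1)] by metis
qed

lemma hat_convex_comb:
  assumes T: "T \<in> \<T>" "x \<in> T" "y \<in> T" and t: "(1 - t) *\<^sub>R x + t *\<^sub>R y \<in> T"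
  shows "hat v ((1 - t) *\<^sub>R x + t *\<^sub>R y) = (1 - t) * hat v x + t * hat v y"
proof (cases "v \<in> verts T")
  case True
  show ?thesis using hat_eq[OF T(1) _ True] T t bary_convex2[OF full[OF T(1)] True] by simp
next
  case False
  show ?thesis using hat_out[OF T(1) _ False] T t by simp
qed

lemma local_elements:
  obtains \<delta> where "\<delta> > 0" "\<And>T. T \<in> \<T> \<Longrightarrow> T \<inter> ball y \<delta> \<noteq> {} \<Longrightarrow> y \<in> T"
proof -
  define N where "N = \<Union>{T\<in>\<T>. y \<notin> T}"
  have "closed N" unfolding N_def using fin elem_closed by (intro closed_Union) auto
  then have "open (- N)" "y \<in> - N" by (auto simp: N_def)
  then obtain \<delta> where "\<delta> > 0" "ball y \<delta> \<subseteq> - N" using open_contains_ball by blast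
  then show thesis by (intro that[of \<delta>]) (auto simp: N_def)
qed

text \<open>Relatively to the face spanned by \<^term>\<open>supp x\<close>, the union of the elements around \<open>x\<close> is a
  cone with the same directions at all points of the open face.\<close>

lemma interior_of_face:
  assumes z: "z \<in> \<Omega>" and x: "x \<in> \<Union>\<T>" and sub: "supp z \<subseteq> supp x"
  shows "x \<in> \<Omega>"
proof -
  obtain T where T: "T \<in> \<T>" "x \<in> T" using x by blast
  have zU: "z \<in> \<Union>\<T>" using z dom_subset by blast
  have zT: "z \<in> S" if "S \<in> \<T>" "x \<in> S" for S
    using supp_subset_imp_mem[OF zU that(1)] supp_subset[OF that] sub by blast
  obtain e where e: "e > 0" "ball z e \<subseteq> \<Omega>" using open_dom z open_contains_ball by blast
  \<comment> \<open>The point \<open>w\<close> on the segment from \<open>z\<close> to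
    \<open>x\<close> is close enough to \<open>z\<close> to lie in \<Omega>, and all vertices of the
    carrier of \<open>x\<close> have positive weight there. Hence \<open>w\<close> and
    \<open>x\<close> lie in the same elements.\<close>
  define t where "t = min (1/2) (e / (2 * (norm (x - z) + 1)))"
  have t: "0 < t" "t < 1" using e by (auto simp: t_def add_nonneg_pos)
  define w where "w = (1 - t) *\<^sub>R z + t *\<^sub>R x"
  have "dist z w = t * norm (x - z)"
  proof -
    have "z - w = t *\<^sub>R (z - x)" by (simp add: w_def algebra_simps)
    then show ?thesis using t by (simp add: dist_norm norm_minus_commute)
  qed
  also have "\<dots> < e"
  proof -
    have "t * norm (x - z) \<le> e / (2 * (norm (x - z) + 1)) * norm (x - z)" by (intro mult_right_mono) (auto simp: t_def)
    also have "\<dots> < e" using e by (simp add: divide_less_eq add_nonneg_pos algebra_simps) (smt (verit) mult_nonneg_nonneg norm_ge_zero)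
    finally show ?thesis .
  qed
  finally have w\<Omega>: "w \<in> \<Omega>" using e by auto
  have wT: "w \<in> S" if "S \<in> \<T>" "x \<in> S" for S
    using convexD_alt[OF elem_convex[OF that(1)] zT[OF that] that(2), of t] t by (simp add: w_def)
  have hw: "hat v w = (1 - t) * hat v z + t * hat v x" for v
    unfolding w_def using hat_convex_comb[OF T(1) zT[OF T] T(2)] wT[OF T] by (simp add: w_def)
  have wpos: "hat v w > 0" if "v \<in> supp x" for v
  proof -
    have "hat v x > 0" using hat_nonneg[OF x, of v] that by (auto simp: supp_def)
    then show ?thesis unfolding hw using hat_nonneg[OF zU, of v] t by (simp add: add_nonneg_pos)
  qed
  have Tw: "x \<in> S" if "S \<in> \<T>" "w \<in> S" for S
  proof -
    have "supp x \<subseteq> supp w" using wpos by (force simp: supp_def)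
    then show ?thesis using supp_subset_imp_mem[OF x that(1)] supp_subset[OF that] by blast
  qed
  obtain d1 where d1: "d1 > 0" "\<And>T. T \<in> \<T> \<Longrightarrow> T \<inter> ball w d1 \<noteq> {} \<Longrightarrow> w \<in> T" by (rule local_elements[of w]) (rule that)
  obtain d2 where d2: "d2 > 0" "ball w d2 \<subseteq> \<Omega>" using open_dom w\<Omega> open_contains_ball by blast
  define \<delta> where "\<delta> = min d1 d2"
  have \<delta>: "\<delta> > 0" using d1 d2 by (simp add: \<delta>_def)
  have near: "\<exists>S\<in>\<T>. u \<in> S \<and> x \<in> S" if "dist w u < \<delta>" for u
  proof -
    have "u \<in> \<Omega>" using that d2 by (auto simp: \<delta>_def)
    then have "u \<in> \<Union>\<T>" using dom_subset by blast
    then obtain S where S: "S \<in> \<T>" "u \<in> S" by blast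
    then have "S \<inter> ball w d1 \<noteq> {}" using that by (auto simp: \<delta>_def)
    then show ?thesis using d1(2)[OF S(1)] Tw[OF S(1)] S by blast
  qed
  define m where "m = Min (insert 1 ((\<lambda>v. hat v x) ` supp x))"
  have fs: "finite (supp x)" using finite_subset[OF supp_subset[OF T] finite_verts[OF T(1)]] .
  have m: "0 < m"
  proof -
    have "0 < hat v x" if "v \<in> supp x" for v using hat_nonneg[OF x, of v] that by (auto simp: supp_def)
    then show ?thesis using fs by (auto simp: m_def)
  qed
  have mle: "m \<le> hat v x" if "v \<in> supp x" for v unfolding m_def using fs that by (intro Min_le) auto
  define \<eta> where "\<eta> = m"
  \<comment> \<open>The homothety with centre \<open>q\<close> and ratio
    \<open>\<eta> / (1 + \<eta>)\<close> maps \<open>w\<close> to \<open>x\<close>. It preserves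
    each element at \<open>x\<close>, because \<open>q\<close> lies in all of them, and so it
    carries a covered ball around \<open>w\<close> to a covered ball around
    \<open>x\<close>.\<close>
  define q where "q = x + \<eta> *\<^sub>R (x - w)"
  have qS: "q \<in> S" if S: "S \<in> \<T>" "x \<in> S" for S
  proof -
    have "(\<Sum>v\<in>verts S. (hat v x + \<eta> * (hat v x - hat v w)) *\<^sub>R v) =
      (\<Sum>v\<in>verts S. hat v x *\<^sub>R v) + \<eta> *\<^sub>R ((\<Sum>v\<in>verts S. hat v x *\<^sub>R v) - (\<Sum>v\<in>verts S. hat v w *\<^sub>R v))"
      unfolding sum_subtractf[symmetric] scaleR_sum_right sum.distrib[symmetric]
      by (intro sum.cong refl) (simp add: algebra_simps)
    also have "\<dots> = q"
      unfolding hat_comb(2)[OF S, symmetric] hat_comb(2)[OF S(1) wT[OF S], symmetric] q_def ..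
    finally have "q = (\<Sum>v\<in>verts S. (hat v x + \<eta> * (hat v x - hat v w)) *\<^sub>R v)" ..
    also have "\<dots> \<in> S"
    proof (rule comb_in_T[OF full[OF S(1)]])
      show "(\<Sum>v\<in>verts S. hat v x + \<eta> * (hat v x - hat v w)) = 1"
        using hat_comb(1)[OF S] hat_comb(1)[OF S(1) wT[OF S]] by (simp add: sum.distrib sum_subtractf flip: sum_distrib_left)
      fix v assume "v \<in> verts S"
      show "0 \<le> hat v x + \<eta> * (hat v x - hat v w)"
      proof (cases "v \<in> supp x")
        case True
        have "m * (hat v w - hat v x) \<le> m * 1"
          using hat_le_1[OF T(1) wT[OF T], of v] hat_nonneg[OF x, of v] m by (intro mult_left_mono) auto
        then show ?thesis using mle[OF True] by (simp add: \<eta>_def algebra_simps)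
      next
        case False
        then have "hat v x = 0" "hat v z = 0" using sub by (auto simp: supp_def)
        then show ?thesis by (simp add: hw)
      qed
    qed
    finally show ?thesis .
  qed
  have "ball x (\<delta> * \<eta> / (1 + \<eta>)) \<subseteq> \<Union>\<T>"
  proof
    fix y assume y: "y \<in> ball x (\<delta> * \<eta> / (1 + \<eta>))"
    have \<eta>: "\<eta> > 0" using m by (simp add: \<eta>_def)
    define u where "u = w + ((1 + \<eta>) / \<eta>) *\<^sub>R (y - x)"
    have "dist w u = (1 + \<eta>) / \<eta> * dist x y" using \<eta> by (simp add: u_def dist_norm norm_minus_commute)
    also have "\<dots> < (1 + \<eta>) / \<eta> * (\<delta> * \<eta> / (1 + \<eta>))" using y \<eta> by (intro mult_strict_left_mono) auto
    also have "\<dots> = \<delta>" using \<eta> by (simp add: add_pos_pos)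
    finally obtain S where S: "S \<in> \<T>" "u \<in> S" "x \<in> S" using near by blast
    have "\<eta> *\<^sub>R u = \<eta> *\<^sub>R w + (1 + \<eta>) *\<^sub>R (y - x)" using \<eta> by (simp add: u_def scaleR_add_right)
    then have "(1 + \<eta>) *\<^sub>R y = q + \<eta> *\<^sub>R u"
      by (simp add: q_def algebra_simps)
    then have "y = (1 / (1 + \<eta>)) *\<^sub>R (q + \<eta> *\<^sub>R u)"
      using \<eta> by (metis add_pos_pos divide_self_if less_numeral_extra(1) less_numeral_extra(3) scaleR_one scaleR_scaleR times_divide_eq_left mult_1)
    also have "\<dots> = (1 - \<eta> / (1 + \<eta>)) *\<^sub>R q + (\<eta> / (1 + \<eta>)) *\<^sub>R u"
    proof -
      have "1 - \<eta> / (1 + \<eta>) = 1 / (1 + \<eta>)" using \<eta> by (simp add: field_simps)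
      then show ?thesis by (simp add: scaleR_add_right)
    qed
    also have "\<dots> \<in> S" using convexD_alt[OF elem_convex[OF S(1)] qS[OF S(1,3)] S(2), of "\<eta> / (1 + \<eta>)"] \<eta> by simp
    finally show "y \<in> \<Union>\<T>" using S by blast
  qed
  moreover have "\<delta> * \<eta> / (1 + \<eta>) > 0" using \<delta> m by (simp add: \<eta>_def add_pos_pos)
  ultimately have "x \<in> interior (\<Union>\<T>)" unfolding mem_interior by blast
  then show ?thesis by (simp add: int_Un)
qed

section \<open>Lagrange nodes and the nodal basis\<close>

definition node_index :: "nat \<Rightarrow> 'a \<Rightarrow> 'a \<Rightarrow> nat" where
  "node_index k j v = nat \<lfloor>real k * hat v j\<rfloor>"

lemma simplex_nodes_lattice:
  assumes "T \<in> \<T>" "j \<in> simplex_nodes k T"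
  obtains \<alpha> where "\<alpha> \<in> lattice_indices T k" "j = lattice_point T k \<alpha>"
proof -
  obtain \<alpha> where \<alpha>: "j = (\<Sum>v\<in>verts T. (real (\<alpha> v) / real k) *\<^sub>R v)" "sum \<alpha> (verts T) = k"
    using assms(2) unfolding simplex_nodes_def verts_def by blast
  have le: "\<alpha> v \<le> k" if "v \<in> verts T" for v
    using member_le_sum[of v "verts T" \<alpha>] that finite_verts[OF assms(1)] \<alpha>(2) by simp
  show thesis
  proof (rule that)
    show "restrict \<alpha> (verts T) \<in> lattice_indices T k"
      using \<alpha>(2) le by (auto simp: lattice_indices_def[OF full[OF assms(1)]])
    show "j = lattice_point T k (restrict \<alpha> (verts T))"
      unfolding lattice_point_def[OF full[OF assms(1)]] \<alpha>(1) by (intro sum.cong) auto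
  qed
qed

lemma lattice_point_node:
  assumes "T \<in> \<T>" "\<alpha> \<in> lattice_indices T k"
  shows "lattice_point T k \<alpha> \<in> mesh_nodes k \<T>"
proof -
  have "lattice_point T k \<alpha> \<in> simplex_nodes k T"
    unfolding simplex_nodes_def lattice_point_def[OF full[OF assms(1)]] verts_def
    using assms(2) by (intro CollectI exI[of _ \<alpha>]) (auto simp: lattice_indices_def[OF full[OF assms(1)]] verts_def)
  then show ?thesis using assms(1) by (auto simp: mesh_nodes_def)
qed

lemma mesh_nodes_subset: "mesh_nodes k \<T> \<subseteq> \<Union>\<T>" if "k \<ge> 1"
proof
  fix j assume "j \<in> mesh_nodes k \<T>"
  then obtain T where T: "T \<in> \<T>" "j \<in> simplex_nodes k T" by (auto simp: mesh_nodes_def)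
  then show "j \<in> \<Union>\<T>" using simplex_nodes_lattice[OF T] lattice_point_in[OF full[OF T(1)] _ that] by (metis UnionI)
qed

text \<open>At a node the scaled weights are integers, so rounding down loses nothing. The
  multi-index is read off from the node alone, without reference to an element.\<close>

lemma node_index_eq:
  assumes "j \<in> mesh_nodes k \<T>" "k \<ge> 1"
  shows "real (node_index k j v) = real k * hat v j"
proof -
  obtain T where T: "T \<in> \<T>" "j \<in> simplex_nodes k T" using assms by (auto simp: mesh_nodes_def)
  obtain \<alpha> where \<alpha>: "\<alpha> \<in> lattice_indices T k" "j = lattice_point T k \<alpha>" by (rule simplex_nodes_lattice[OF T])
  have jT: "j \<in> T" using lattice_point_in[OF full[OF T(1)] \<alpha>(1) assms(2)] \<alpha>(2) by simp
  have "\<exists>n::nat. real k * hat v j = real n"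
  proof (cases "v \<in> verts T")
    case True
    then show ?thesis using hat_eq[OF T(1) jT True] lattice_point_bary[OF full[OF T(1)] \<alpha>(1) assms(2) True] \<alpha>(2) by auto
  next
    case False
    then show ?thesis using hat_out[OF T(1) jT] by (intro exI[of _ 0]) simp
  qed
  then show ?thesis by (auto simp: node_index_def)
qed

lemma node_lattice:
  assumes "j \<in> mesh_nodes k \<T>" "k \<ge> 1" "T \<in> \<T>" "j \<in> T"
  shows "restrict (node_index k j) (verts T) \<in> lattice_indices T k" "lattice_point T k (restrict (node_index k j) (verts T)) = j"
proof -
  have "real (sum (node_index k j) (verts T)) = real k * (\<Sum>v\<in>verts T. hat v j)"
    by (simp add: node_index_eq[OF assms(1,2)] sum_distrib_left)
  then have "real (sum (node_index k j) (verts T)) = real k" unfolding hat_comb(1)[OF assms(3,4)] by simp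
  then have s: "sum (node_index k j) (verts T) = k" by (rule of_nat_eq_iff[THEN iffD1])
  have le: "node_index k j v \<le> k" if "v \<in> verts T" for v
    using member_le_sum[of v "verts T" "node_index k j"] that finite_verts[OF assms(3)] s by simp
  show "restrict (node_index k j) (verts T) \<in> lattice_indices T k"
    using s le by (auto simp: lattice_indices_def[OF full[OF assms(3)]])
  have "lattice_point T k (restrict (node_index k j) (verts T)) = (\<Sum>v\<in>verts T. hat v j *\<^sub>R v)"
    unfolding lattice_point_def[OF full[OF assms(3)]] using assms(2)
    by (intro sum.cong refl) (simp add: node_index_eq[OF assms(1,2)])
  also have "\<dots> = j" by (rule hat_comb(2)[OF assms(3,4), symmetric])
  finally show "lattice_point T k (restrict (node_index k j) (verts T)) = j" .
qed

text \<open>One product over all vertices of the mesh, so that values on different elements agree on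
  common faces by construction. It restricts to a \<open>lagrange\<close> polynomial on elements
  that contain \<open>j\<close> and to 0 on the others.\<close>

definition node_basis :: "nat \<Rightarrow> 'a \<Rightarrow> 'a \<Rightarrow> real" where
  "node_basis k j x = (if x \<in> \<Union>\<T> then \<Prod>v\<in>vertices. (real k * hat v x) gchoose node_index k j v else 0)"

lemma node_basis_on:
  assumes "T \<in> \<T>" "x \<in> T" "j \<in> T"
  shows "node_basis k j x = lagrange T k (restrict (node_index k j) (verts T)) x"
proof -
  have "(\<Prod>v\<in>vertices. (real k * hat v x) gchoose node_index k j v) = (\<Prod>v\<in>verts T. (real k * hat v x) gchoose node_index k j v)"
  proof (rule prod.mono_neutral_right[OF finite_vertices])
    show "verts T \<subseteq> vertices" using assms(1) by (auto simp: vertices_def)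
    show "\<forall>v\<in>vertices - verts T. (real k * hat v x) gchoose node_index k j v = 1"
      using hat_out[OF assms(1,3)] by (simp add: node_index_def)
  qed
  also have "\<dots> = lagrange T k (restrict (node_index k j) (verts T)) x"
    unfolding lagrange_def[OF full[OF assms(1)]] by (intro prod.cong refl) (simp add: hat_eq[OF assms(1,2)])
  finally show ?thesis using assms(1,2) by (auto simp: node_basis_def)
qed

text \<open>The factor of \<open>v\<close> is \<open>0 gchoose n\<close> with positive
  \<open>n\<close>.\<close>

lemma node_basis_zero:
  assumes j: "j \<in> mesh_nodes k \<T>" "k \<ge> 1" and v: "hat v j \<noteq> 0" "hat v x = 0"
  shows "node_basis k j x = 0"
proof -
  have "real (node_index k j v) \<noteq> 0" using node_index_eq[OF j, of v] v j(2) by simp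
  then obtain n where n: "node_index k j v = Suc n" by (metis not0_implies_Suc of_nat_0)
  have "v \<in> vertices" using v(1) unfolding hat_def vertices_def by (auto split: if_splits)
  then have "(\<Prod>v\<in>vertices. (real k * hat v x) gchoose node_index k j v) = 0"
    using finite_vertices v(2) n by (intro prod_zero) (auto intro!: bexI[of _ v])
  then show ?thesis by (simp add: node_basis_def)
qed

lemma node_basis_off:
  assumes j: "j \<in> mesh_nodes k \<T>" "k \<ge> 1" and T: "T \<in> \<T>" "x \<in> T" "j \<notin> T"
  shows "node_basis k j x = 0"
proof -
  have "\<not> supp j \<subseteq> verts T" using supp_subset_imp_mem[of j T] mesh_nodes_subset[OF j(2)] j(1) T by blast
  then obtain v where "hat v j \<noteq> 0" "v \<notin> verts T" by (auto simp: supp_def)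
  then show ?thesis using node_basis_zero[OF j] hat_out[OF T(1,2)] by blast
qed

lemma node_basis_polynomial:
  assumes j: "j \<in> mesh_nodes k \<T>" "k \<ge> 1" and T: "T \<in> \<T>"
  shows "\<exists>p\<in>polynomials k. \<forall>x\<in>T. node_basis k j x = p x"
proof (cases "j \<in> T")
  case True
  show ?thesis
    using lagrange_polynomial[OF full[OF T] node_lattice(1)[OF j T True]] node_basis_on[OF T _ True] by blast
next
  case False
  show ?thesis
    using node_basis_off[OF j T _ False] polynomials_const[of 0 k] by (intro bexI[of _ "\<lambda>_. 0"]) auto
qed

lemma piecewise_polynomial_continuous:
  assumes "\<forall>T\<in>\<T>. \<exists>p\<in>polynomials k. \<forall>x\<in>T. v x = p x"
  shows "continuous_on (closure \<Omega>) v"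
proof -
  have c: "continuous_on T v" if "T \<in> \<T>" for T
  proof -
    from assms that have "\<exists>p\<in>polynomials k. \<forall>x\<in>T. v x = p x" by (rule bspec)
    then obtain p where p: "p \<in> polynomials k" "\<forall>x\<in>T. v x = p x" by (rule bexE)
    have "continuous_on T p" by (rule polynomials_continuous[OF p(1)])
    then show ?thesis by (rule continuous_on_eq) (use p(2) in simp)
  qed
  have "continuous_on (\<Union>T\<in>\<T>. T) v"
    by (rule continuous_on_closed_Union[OF fin elem_closed c])
  then show ?thesis using Un by simp
qed

text \<open>The boundary condition is the delicate point. If \<open>x\<close> is in the mesh but not
  in \<Omega>, its carrier misses a vertex of the carrier of \<open>j\<close>, since otherwise
  \<open>interior_of_face\<close> would place \<open>x\<close> in \<Omega>. The factor of that
  vertex vanishes.\<close>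

lemma node_basis_fe:
  assumes j: "j \<in> I0 k \<Omega> \<T>" and k: "k \<ge> 1"
  shows "node_basis k j \<in> fe_space k \<Omega> \<T>"
proof -
  have jn: "j \<in> mesh_nodes k \<T>" "j \<in> \<Omega>" using j by (auto simp: I0_def)
  have p: "\<forall>T\<in>\<T>. \<exists>p\<in>polynomials k. \<forall>x\<in>T. node_basis k j x = p x" using node_basis_polynomial[OF jn(1) k] by blast
  have "node_basis k j x = 0" if x: "x \<notin> \<Omega>" for x
  proof (cases "x \<in> \<Union>\<T>")
    case True
    then have "\<not> supp j \<subseteq> supp x" using interior_of_face[OF jn(2) True] x by blast
    then obtain v where "hat v j \<noteq> 0" "hat v x = 0" by (auto simp: supp_def)
    then show ?thesis by (rule node_basis_zero[OF jn(1) k])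
  qed (simp add: node_basis_def)
  then show ?thesis unfolding fe_space_def using p piecewise_polynomial_continuous[OF p] by blast
qed

lemma node_basis_kronecker:
  assumes j: "j \<in> mesh_nodes k \<T>" and i: "i \<in> mesh_nodes k \<T>" and k: "k \<ge> 1"
  shows "node_basis k j i = (if i = j then 1 else 0)"
proof -
  obtain T where T: "T \<in> \<T>" "i \<in> T" using i mesh_nodes_subset[OF k] by blast
  show ?thesis
  proof (cases "j \<in> T")
    case True
    have "node_basis k j i = lagrange T k (restrict (node_index k j) (verts T)) (lattice_point T k (restrict (node_index k i) (verts T)))"
      using node_basis_on[OF T True] node_lattice(2)[OF i k T] by simp
    also have "\<dots> = (if restrict (node_index k j) (verts T) = restrict (node_index k i) (verts T) then 1 else 0)"
      by (rule lagrange_lattice_point[OF full[OF T(1)] node_lattice(1)[OF j k T(1) True] node_lattice(1)[OF i k T] k])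
    also have "(restrict (node_index k j) (verts T) = restrict (node_index k i) (verts T)) = (i = j)"
      using node_lattice(2)[OF j k T(1) True] node_lattice(2)[OF i k T] by metis
    finally show ?thesis by simp
  next
    case False
    then show ?thesis using node_basis_off[OF j k T False] T by auto
  qed
qed

lemma fe_space_unisolvent:
  assumes v: "v \<in> fe_space k \<Omega> \<T>" "w \<in> fe_space k \<Omega> \<T>" and k: "k \<ge> 1"
    and eq: "\<And>i. i \<in> I0 k \<Omega> \<T> \<Longrightarrow> v i = w i"
  shows "v = w"
proof
  fix x
  show "v x = w x"
  proof (cases "x \<in> \<Omega>")
    case True
    then obtain T where T: "T \<in> \<T>" "x \<in> T" using dom_subset by blast
    obtain p q where p: "p \<in> polynomials k" "\<forall>x\<in>T. v x = p x" and q: "q \<in> polynomials k" "\<forall>x\<in>T. w x = q x"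
      using v T(1) unfolding fe_space_def by blast
    have d: "(\<lambda>x. p x + (-1) * q x) \<in> polynomials k" by (intro polynomials_add polynomials_cmult p q)
    have "p x + (-1) * q x = 0"
    proof (rule polynomials_unisolvent[OF full[OF T(1)] d k _ T(2)])
      fix \<alpha> assume \<alpha>: "\<alpha> \<in> lattice_indices T k"
      let ?z = "lattice_point T k \<alpha>"
      have "?z \<in> T" by (rule lattice_point_in[OF full[OF T(1)] \<alpha> k])
      moreover have "v ?z = w ?z"
      proof (cases "?z \<in> \<Omega>")
        case True
        then show ?thesis using lattice_point_node[OF T(1) \<alpha>] by (intro eq) (simp add: I0_def)
      next
        case False
        then show ?thesis using v by (simp add: fe_space_def)
      qed
      ultimately show "p ?z + (-1) * q ?z = 0" using p q by simp
    qed
    then show ?thesis using p q T by simp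
  next
    case False
    then show ?thesis using v by (simp add: fe_space_def)
  qed
qed

text \<open>Existence by \<open>node_basis_fe\<close> and uniqueness by
  \<open>fe_space_unisolvent\<close> give the definite description its meaning.\<close>

lemma nodal_basis_eq:
  assumes j: "j \<in> I0 k \<Omega> \<T>" and k: "k \<ge> 1"
  shows "nodal_basis k \<Omega> \<T> j = node_basis k j"
  unfolding nodal_basis_def
proof (rule the_equality)
  have kr: "\<forall>i\<in>I0 k \<Omega> \<T>. node_basis k j i = (if i = j then 1 else 0)"
    using node_basis_kronecker[OF _ _ k] j by (simp add: I0_def)
  then show "node_basis k j \<in> fe_space k \<Omega> \<T> \<and> (\<forall>i\<in>I0 k \<Omega> \<T>. node_basis k j i = (if i = j then 1 else 0))"
    using node_basis_fe[OF j k] by blast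
  fix v assume v: "v \<in> fe_space k \<Omega> \<T> \<and> (\<forall>i\<in>I0 k \<Omega> \<T>. v i = (if i = j then 1 else 0))"
  show "v = node_basis k j"
    by (rule fe_space_unisolvent[OF _ node_basis_fe[OF j k] k]) (use v kr in auto)
qed

lemma finite_I0: "k \<ge> 1 \<Longrightarrow> finite (I0 k \<Omega> \<T>)"
proof -
  assume k: "k \<ge> 1"
  have "mesh_nodes k \<T> \<subseteq> (\<Union>T\<in>\<T>. lattice_point T k ` lattice_indices T k)"
  proof
    fix j assume "j \<in> mesh_nodes k \<T>"
    then obtain T where T: "T \<in> \<T>" "j \<in> simplex_nodes k T" by (auto simp: mesh_nodes_def)
    obtain \<alpha> where "\<alpha> \<in> lattice_indices T k" "j = lattice_point T k \<alpha>" by (rule simplex_nodes_lattice[OF T])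
    then show "j \<in> (\<Union>T\<in>\<T>. lattice_point T k ` lattice_indices T k)" using T by blast
  qed
  then have "finite (mesh_nodes k \<T>)"
    by (rule finite_subset) (use fin finite_lattice_indices[OF full] in auto)
  then show ?thesis by (simp add: I0_def)
qed

lemma card_nodes_elem:
  assumes T: "T \<in> \<T>" and k: "k \<ge> 1"
  shows "card (I0 k \<Omega> \<T> \<inter> T) \<le> Suc k ^ Suc DIM('a)" 
proof -
  have "I0 k \<Omega> \<T> \<inter> T \<subseteq> lattice_point T k ` lattice_indices T k"
  proof
    fix j assume "j \<in> I0 k \<Omega> \<T> \<inter> T"
    then have "j \<in> mesh_nodes k \<T>" "j \<in> T" by (auto simp: I0_def)
    from node_lattice[OF this(1) k T this(2)] show "j \<in> lattice_point T k ` lattice_indices T k" by (metis imageI)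
  qed
  then have "card (I0 k \<Omega> \<T> \<inter> T) \<le> card (lattice_indices T k)"
    using finite_lattice_indices[OF full[OF T]] by (meson card_image_le card_mono finite_imageI order_trans)
  also have "\<dots> \<le> Suc k ^ Suc DIM('a)" by (rule card_lattice_indices[OF full[OF T]])
  finally show ?thesis .
qed

text \<open>Only nodes in \<open>T\<close> contribute on \<open>T\<close>, and their number is
  bounded in terms of \<open>k\<close> and the dimension. The exponent \<open>Suc k\<close> covers
  both the bound \<open>real k ^ k\<close> for values and its multiple by \<open>k\<close> for
  differences.\<close>

lemma nodal_combination_bounds:
  assumes T: "T \<in> \<T>" and k: "k \<ge> 1" and J: "J \<subseteq> I0 k \<Omega> \<T>" and M: "\<And>j. j \<in> J \<Longrightarrow> j \<in> T \<Longrightarrow> \<bar>c j\<bar> \<le> M" "M \<ge> 0"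
    and x: "x \<in> T"
  defines "K \<equiv> real (Suc k ^ Suc DIM('a)) * real k ^ Suc k"
  shows "\<bar>\<Sum>j\<in>J. c j * node_basis k j x\<bar> \<le> K * M"
    and "\<And>y x0 r. y \<in> T \<Longrightarrow> cball x0 r \<subseteq> T \<Longrightarrow> r > 0 \<Longrightarrow>
      \<bar>(\<Sum>j\<in>J. c j * node_basis k j x) - (\<Sum>j\<in>J. c j * node_basis k j y)\<bar> \<le> K * M * dist x y / r"
proof -
  have fJ: "finite J" using finite_subset[OF J finite_I0[OF k]] .
  have restr: "(\<Sum>j\<in>J. c j * node_basis k j x) = (\<Sum>j\<in>J \<inter> T. c j * node_basis k j x)" if "x \<in> T" for x
    by (rule sum.mono_neutral_right[OF fJ]) (use J that node_basis_off[OF _ k T that] in \<open>auto simp: I0_def\<close>)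
  have cardJ: "real (card (J \<inter> T)) \<le> real (Suc k ^ Suc DIM('a))"
  proof -
    have "card (J \<inter> T) \<le> card (I0 k \<Omega> \<T> \<inter> T)" using J finite_I0[OF k] by (intro card_mono) auto
    also have "\<dots> \<le> Suc k ^ Suc DIM('a)" by (rule card_nodes_elem[OF T k])
    finally show ?thesis by (rule of_nat_mono)
  qed
  have lat: "restrict (node_index k j) (verts T) \<in> lattice_indices T k" if "j \<in> J \<inter> T" for j
    using node_lattice(1)[OF _ k T] that J by (auto simp: I0_def)
  have kk: "real k ^ k \<le> real k ^ Suc k" using k by (intro power_increasing) auto
  have "\<bar>\<Sum>j\<in>J \<inter> T. c j * node_basis k j x\<bar> \<le> (\<Sum>j\<in>J \<inter> T. M * real k ^ Suc k)"
  proof (rule order_trans[OF sum_abs sum_mono])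
    fix j assume j: "j \<in> J \<inter> T"
    have "\<bar>node_basis k j x\<bar> \<le> real k ^ Suc k"
      using node_basis_on[OF T x] lagrange_bounds(1)[OF full[OF T] lat[OF j] k x] kk j by auto
    then show "\<bar>c j * node_basis k j x\<bar> \<le> M * real k ^ Suc k"
      unfolding abs_mult using M j by (intro mult_mono) auto
  qed
  also have "\<dots> = real (card (J \<inter> T)) * (M * real k ^ Suc k)" by simp
  also have "\<dots> \<le> real (Suc k ^ Suc DIM('a)) * (M * real k ^ Suc k)" using M cardJ by (intro mult_right_mono) auto
  finally show "\<bar>\<Sum>j\<in>J. c j * node_basis k j x\<bar> \<le> K * M" unfolding restr[OF x] K_def by (simp only: mult_ac)
  fix y x0 r assume y: "y \<in> T" and ball: "cball x0 r \<subseteq> T" "r > 0"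
  have "\<bar>\<Sum>j\<in>J \<inter> T. c j * (node_basis k j x - node_basis k j y)\<bar> \<le> (\<Sum>j\<in>J \<inter> T. M * (real k ^ Suc k * dist x y / r))"
  proof (rule order_trans[OF sum_abs sum_mono])
    fix j assume j: "j \<in> J \<inter> T"
    have "\<bar>node_basis k j x - node_basis k j y\<bar> \<le> real k ^ Suc k * dist x y / r"
      using node_basis_on[OF T x] node_basis_on[OF T y] lagrange_bounds(2)[OF full[OF T] lat[OF j] k x y ball] j
      by (simp add: mult_ac)
    then show "\<bar>c j * (node_basis k j x - node_basis k j y)\<bar> \<le> M * (real k ^ Suc k * dist x y / r)"
      unfolding abs_mult using M j by (intro mult_mono) auto
  qed
  also have "\<dots> = real (card (J \<inter> T)) * (M * (real k ^ Suc k * dist x y / r))" by simp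
  also have "\<dots> \<le> real (Suc k ^ Suc DIM('a)) * (M * (real k ^ Suc k * dist x y / r))"
    using M cardJ ball by (intro mult_right_mono) auto
  also have "\<dots> = K * M * dist x y / r" unfolding K_def by (simp only: times_divide_eq_right times_divide_eq_left mult_ac)
  finally show "\<bar>(\<Sum>j\<in>J. c j * node_basis k j x) - (\<Sum>j\<in>J. c j * node_basis k j y)\<bar> \<le> K * M * dist x y / r"
    unfolding restr[OF x] restr[OF y] by (simp add: right_diff_distrib sum_subtractf)
qed

end

section \<open>Cut elements of shape regular meshes\<close>

locale shape_mesh = fe_mesh +
  fixes \<sigma> :: real
  assumes reg: "shape_regular \<sigma> \<T>" and \<sigma>: "\<sigma> > 0" and dim: "DIM('a) \<ge> 2"
begin

lemma inball:
  assumes "T \<in> \<T>"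
  obtains x0 r where "r > 0" "cball x0 r \<subseteq> T" "diameter T \<le> \<sigma> * r"
  using reg assms unfolding shape_regular_def by blast

lemma dist_le_diameter: "T \<in> \<T> \<Longrightarrow> x \<in> T \<Longrightarrow> y \<in> T \<Longrightarrow> dist x y \<le> diameter T"
  using diameter_bounded_bound compact_imp_bounded[OF elem_compact] by blast

lemma diameter_pos:
  assumes "T \<in> \<T>"
  shows "diameter T > 0"
proof -
  obtain x0 r where b: "r > 0" "cball x0 r \<subseteq> T" by (rule inball[OF assms])
  have "diameter (cball x0 r) \<le> diameter T" by (rule diameter_subset[OF b(2) compact_imp_bounded[OF elem_compact[OF assms]]])
  then show ?thesis using b(1) by simp
qed

text \<open>Along an edge the barycentric coordinate of \<open>v\<close> falls from 1 to 0 although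
  its Lipschitz constant is at most \<open>1 / r\<close>.\<close>

lemma edge_length:
  assumes T: "T \<in> \<T>" and vw: "v \<in> verts T" "w \<in> verts T" "v \<noteq> w"
  shows "diameter T \<le> \<sigma> * dist v w"
proof -
  obtain x0 r where b: "r > 0" "cball x0 r \<subseteq> T" "diameter T \<le> \<sigma> * r" by (rule inball[OF T])
  have "\<bar>bary T v v - bary T v w\<bar> \<le> dist v w / r" by (rule bary_lipschitz[OF full[OF T] b(2,1) vw(1)])
  then have "1 \<le> dist v w / r" using bary_props(2)[OF full[OF T] vw(1)] vw by auto
  then have "r \<le> dist v w" using b(1) by (simp add: field_simps)
  then have "\<sigma> * r \<le> \<sigma> * dist v w" using \<sigma> by simp
  then show ?thesis using b(3) by simp
qed

lemma share_edge:
  assumes "T \<in> \<T>" "T' \<in> \<T>" "v \<in> verts T" "w \<in> verts T" "v \<in> verts T'" "w \<in> verts T'" "v \<noteq> w"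
  shows "diameter T \<le> \<sigma> * diameter T'"
proof -
  have "dist v w \<le> diameter T'"
    using dist_le_diameter[OF assms(2)] verts_subset[OF full[OF assms(2)]] assms(5,6) by blast
  then have "\<sigma> * dist v w \<le> \<sigma> * diameter T'" using \<sigma> by simp
  then show ?thesis using edge_length[OF assms(1,3,4,7)] by simp
qed

lemma interiors_disjoint:
  assumes "T \<in> \<T>" "T' \<in> \<T>" "T \<noteq> T'"
  shows "interior T \<inter> interior T' = {}"
proof (rule ccontr)
  assume "interior T \<inter> interior T' \<noteq> {}"
  then obtain z where z: "z \<in> interior T" "z \<in> interior T'" by blast
  then have zz: "z \<in> T \<inter> T'" using interior_subset by blast
  have "T \<inter> T' = T" using face_of_disjoint_interior[OF faces[OF assms(1,2)]] zz z by blast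
  moreover have "T' \<inter> T = T'" using face_of_disjoint_interior[OF faces[OF assms(2,1)]] zz z by blast
  ultimately show False using assms(3) by blast
qed

section \<open>Elements around a vertex\<close>

definition star :: "'a \<Rightarrow> 'a set set" where "star v = {T\<in>\<T>. v \<in> verts T}"

lemma finite_star: "finite (star v)" using fin by (simp add: star_def)

text \<open>The elements may differ in size, so each is shrunk towards \<open>v\<close> to the
  smallest diameter \<open>e\<close>. By convexity the image stays in the element. It contains a
  ball of radius \<open>e / \<sigma>\<close> inside \<open>cball v e\<close>, and packing these
  disjoint balls gives the bound.\<close>

lemma card_star: "real (card (star v)) \<le> \<sigma> ^ DIM('a)"
proof (cases "star v = {}")
  case False
  define e where "e = Min (diameter ` star v)"
  have e: "e > 0" using False finite_star diameter_pos by (auto simp: e_def star_def)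
  have ele: "e \<le> diameter T" if "T \<in> star v" for T unfolding e_def using finite_star that by (intro Min_le) auto
  have "\<exists>q. cball q (e / \<sigma>) \<subseteq> T \<inter> cball v e" if T: "T \<in> star v" for T
  proof -
    have TT: "T \<in> \<T>" "v \<in> T" using T verts_subset[OF full] by (auto simp: star_def)
    obtain x0 r where b: "r > 0" "cball x0 r \<subseteq> T" "diameter T \<le> \<sigma> * r" by (rule inball[OF TT(1)])
    define h where "h = diameter T"
    have h: "h > 0" "e \<le> h" using diameter_pos[OF TT(1)] ele[OF T] by (auto simp: h_def)
    define q where "q = v + (e / h) *\<^sub>R (x0 - v)"
    have "u \<in> T \<inter> cball v e" if u: "u \<in> cball q (e / \<sigma>)" for u
    proof -
      define y where "y = v + (h / e) *\<^sub>R (u - v)"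
      have "x0 - y = (h / e) *\<^sub>R (q - u)" using e h by (simp add: y_def q_def algebra_simps)
      then have "dist x0 y = h / e * dist q u" using e h by (simp add: dist_norm)
      also have "\<dots> \<le> h / e * (e / \<sigma>)" using u e h by (intro mult_left_mono) auto
      also have "\<dots> = h / \<sigma>" using e by simp
      also have "\<dots> \<le> r" using b(3) \<sigma> by (simp add: h_def field_simps)
      finally have yT: "y \<in> T" using b(2) by auto
      have u1: "u = (1 - e / h) *\<^sub>R v + (e / h) *\<^sub>R y" using e h by (simp add: y_def algebra_simps)
      have "u \<in> T" unfolding u1 by (rule convexD_alt[OF elem_convex[OF TT(1)] TT(2) yT]) (use e h in auto)
      moreover have "dist v u \<le> e"
      proof -
        have "v - u = (e / h) *\<^sub>R (v - y)" using e h by (simp add: y_def)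
        then have "dist v u = e / h * dist v y" using e h by (simp add: dist_norm)
        also have "\<dots> \<le> e / h * h" using dist_le_diameter[OF TT yT] e h by (intro mult_left_mono) (auto simp: h_def)
        finally show ?thesis using h by simp
      qed
      ultimately show ?thesis by simp
    qed
    then show ?thesis by blast
  qed
  then obtain q where q: "\<And>T. T \<in> star v \<Longrightarrow> cball (q T) (e / \<sigma>) \<subseteq> T \<inter> cball v e" by metis
  have es: "e / \<sigma> > 0" using e \<sigma> by simp
  have sep: "2 * (e / \<sigma>) \<le> dist (q T) (q T')" if T: "T \<in> star v" "T' \<in> star v" "T \<noteq> T'" for T T'
  proof (rule ccontr)
    assume a: "\<not> ?thesis"
    define m where "m = midpoint (q T) (q T')"
    have "dist (q T) (q T') / 2 < e / \<sigma>" using a by linarith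
    then have m: "m \<in> ball (q T) (e / \<sigma>) \<and> m \<in> ball (q T') (e / \<sigma>)"
      unfolding m_def mem_ball dist_midpoint by (intro conjI)
    have "ball (q T) (e / \<sigma>) \<subseteq> T" "ball (q T') (e / \<sigma>) \<subseteq> T'"
      using q[OF T(1)] q[OF T(2)] ball_subset_cball by blast+
    then have "ball (q T) (e / \<sigma>) \<subseteq> interior T" "ball (q T') (e / \<sigma>) \<subseteq> interior T'"
      by (simp_all add: interior_maximal)
    moreover have "interior T \<inter> interior T' = {}"
      by (rule interiors_disjoint) (use T in \<open>auto simp: star_def\<close>)
    ultimately show False using m by blast
  qed
  have inj: "inj_on q (star v)"
  proof (rule inj_onI, rule ccontr)
    fix T T' assume "T \<in> star v" "T' \<in> star v" "q T = q T'" "T \<noteq> T'"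
    then show False using sep[of T T'] es by simp
  qed
  have "real (card (q ` star v)) * (e / \<sigma>) ^ DIM('a) \<le> e ^ DIM('a)"
  proof (rule packing_card[where c = v])
    fix z z' assume "z \<in> q ` star v" "z' \<in> q ` star v" "z \<noteq> z'"
    then obtain T T' where "T \<in> star v" "T' \<in> star v" "z = q T" "z' = q T'" "T \<noteq> T'" by auto
    then show "2 * (e / \<sigma>) \<le> dist z z'" using sep by simp
  next
    fix z assume "z \<in> q ` star v"
    then show "cball z (e / \<sigma>) \<subseteq> cball v e" using q by auto
  qed (use finite_star es e in auto)
  then have "real (card (star v)) * (e / \<sigma>) ^ DIM('a) \<le> e ^ DIM('a)" by (simp add: card_image[OF inj])
  then show ?thesis using e \<sigma> by (simp add: power_divide divide_le_eq mult.commute)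
qed (use \<sigma> in simp)

definition edge_rel :: "'a \<Rightarrow> ('a set \<times> 'a set) set" where
  "edge_rel v = {(T, T'). T \<in> star v \<and> T' \<in> star v \<and> (\<exists>w. w \<noteq> v \<and> w \<in> verts T \<and> w \<in> verts T')}"

text \<open>The elements reachable through common edges at \<open>v\<close>. At a vertex on the
  boundary of \<Omega> a star may consist of several clusters.\<close>

definition cluster :: "'a \<Rightarrow> 'a set \<Rightarrow> 'a set set" where "cluster v T = (edge_rel v)\<^sup>* `` {T}"

text \<open>At most \<open>\<sigma>\<^sup>d\<close> elements meet at a vertex, and elements with a common edge have sizes in ratio at most \<open>\<sigma>\<close>.\<close>

definition size_ratio :: real where
  "size_ratio = max 1 \<sigma> ^ (nat \<lfloor>\<sigma> ^ DIM('a)\<rfloor> * nat \<lfloor>\<sigma> ^ DIM('a)\<rfloor>)"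

lemma size_ratio_ge_1: "1 \<le> size_ratio" by (simp add: size_ratio_def)

lemma edge_rel_sym: "(T, T') \<in> edge_rel v \<Longrightarrow> (T', T) \<in> edge_rel v"
  by (auto simp: edge_rel_def)

lemma cluster_sym:
  assumes "T' \<in> cluster v T"
  shows "T \<in> cluster v T'"
proof -
  have "sym (edge_rel v)" using edge_rel_sym by (auto simp: sym_def)
  then have "sym ((edge_rel v)\<^sup>*)" by (rule sym_rtrancl)
  then show ?thesis using assms by (auto simp: cluster_def sym_def)
qed

lemma edge_rel_diameter: "(T, T') \<in> edge_rel v \<Longrightarrow> diameter T \<le> max 1 \<sigma> * diameter T'"
proof -
  assume "(T, T') \<in> edge_rel v"
  then obtain w where w: "T \<in> \<T>" "T' \<in> \<T>" "v \<in> verts T" "w \<in> verts T" "v \<in> verts T'" "w \<in> verts T'" "v \<noteq> w"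
    by (auto simp: edge_rel_def star_def)
  have "diameter T \<le> \<sigma> * diameter T'" by (rule share_edge[OF w])
  also have "\<dots> \<le> max 1 \<sigma> * diameter T'" using diameter_pos[OF w(2)] by (intro mult_right_mono) auto
  finally show ?thesis .
qed

lemma cluster_diameter:
  assumes "T' \<in> cluster v T" "T \<in> \<T>"
  shows "diameter T \<le> size_ratio * diameter T'"
proof -
  let ?E = "edge_rel v" let ?N = "nat \<lfloor>\<sigma> ^ DIM('a)\<rfloor>"
  have E: "?E \<subseteq> star v \<times> star v" by (auto simp: edge_rel_def)
  have fE: "finite ?E" by (rule finite_subset[OF E]) (simp add: finite_star)
  have N: "card (star v) \<le> ?N" using card_star[of v] by linarith
  have "card ?E \<le> card (star v \<times> star v)" by (rule card_mono[OF _ E]) (simp add: finite_star)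
  also have "\<dots> \<le> ?N * ?N" using N by (simp add: card_cartesian_product mult_le_mono)
  finally have cE: "card ?E \<le> ?N * ?N" .
  have "(T, T') \<in> ?E\<^sup>*" using assms(1) by (simp add: cluster_def)
  \<comment> \<open>A path in a finite relation can be taken no longer than the number of its pairs,
    hence the product of two equal factors in the exponent of \<open>size_ratio\<close>.\<close>
  then obtain n where n: "n \<le> card ?E" "(T, T') \<in> ?E ^^ n" unfolding rtrancl_finite_eq_relpow[OF fE] by auto
  have chain: "S' \<in> \<T> \<and> diameter S \<le> max 1 \<sigma> ^ n * diameter S'" if "(S, S') \<in> ?E ^^ n" "S \<in> \<T>" for S S' n
    using that
  proof (induction n arbitrary: S')
    case (Suc n)
    then obtain S'' where S'': "(S, S'') \<in> ?E ^^ n" "(S'', S') \<in> ?E" by auto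
    have "diameter S \<le> max 1 \<sigma> ^ n * diameter S''" using Suc.IH[OF S''(1)] Suc.prems by simp
    also have "\<dots> \<le> max 1 \<sigma> ^ n * (max 1 \<sigma> * diameter S')"
      by (intro mult_left_mono edge_rel_diameter[OF S''(2)]) auto
    finally show ?case using S''(2) by (auto simp: edge_rel_def star_def mult_ac)
  qed simp
  have "diameter T \<le> max 1 \<sigma> ^ n * diameter T'" "T' \<in> \<T>" using chain[OF n(2) assms(2)] by auto
  moreover have "max 1 \<sigma> ^ n \<le> size_ratio" unfolding size_ratio_def using n(1) cE by (intro power_increasing) auto
  ultimately show ?thesis using diameter_pos[of T'] mult_right_mono[of "max 1 \<sigma> ^ n" size_ratio "diameter T'"] by linarith
qed

lemma cluster_subset_star: "T \<in> star v \<Longrightarrow> cluster v T \<subseteq> star v"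
proof
  fix T' assume "T \<in> star v" "T' \<in> cluster v T"
  then have "(T, T') \<in> (edge_rel v)\<^sup>*" by (simp add: cluster_def)
  then show "T' \<in> star v" by (induction rule: rtrancl_induct) (use \<open>T \<in> star v\<close> in \<open>auto simp: edge_rel_def\<close>)
qed

lemma cluster_self: "T \<in> cluster v T" by (simp add: cluster_def)

lemma cluster_step: "T' \<in> cluster v T \<Longrightarrow> (T', S) \<in> edge_rel v \<Longrightarrow> S \<in> cluster v T"
  by (auto simp: cluster_def intro: rtrancl_into_rtrancl)

lemma supp_ne: "x \<in> \<Union>\<T> \<Longrightarrow> supp x \<noteq> {}"
proof
  assume "x \<in> \<Union>\<T>" and e: "supp x = {}"
  then obtain T where T: "T \<in> \<T>" "x \<in> T" by blast
  have "(\<Sum>v\<in>verts T. hat v x) = 0" using e by (intro sum.neutral) (auto simp: supp_def)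
  then show False using hat_comb(1)[OF T] by simp
qed

lemma supp_other:
  assumes T: "T \<in> \<T>" "x \<in> T" and "x \<noteq> v"
  shows "\<exists>w. w \<noteq> v \<and> w \<in> supp x"
proof (rule ccontr)
  assume a: "\<not> ?thesis"
  then have z: "hat w x = 0" if "w \<noteq> v" for w using that by (auto simp: supp_def)
  have "x \<in> \<Union>\<T>" using T by blast
  then obtain u where "u \<in> supp x" using supp_ne[of x] by auto
  moreover have "u = v" using a calculation by blast
  ultimately have "v \<in> verts T" using supp_subset[OF T] by blast
  have "(\<Sum>w\<in>verts T. hat w x) = hat v x"
    using sum.remove[OF finite_verts[OF T(1)] \<open>v \<in> verts T\<close>, of "\<lambda>w. hat w x"] z by simp
  then have 1: "hat v x = 1" using hat_comb(1)[OF T] by simp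
  have "(\<Sum>w\<in>verts T. hat w x *\<^sub>R w) = hat v x *\<^sub>R v"
    using sum.remove[OF finite_verts[OF T(1)] \<open>v \<in> verts T\<close>, of "\<lambda>w. hat w x *\<^sub>R w"] z by simp
  then show False using hat_comb(2)[OF T] 1 assms(3) by simp
qed

text \<open>The carrier of \<open>z\<close> has a vertex other than \<open>v\<close>, and it belongs
  to both elements.\<close>

lemma share_point_edge:
  assumes "T \<in> star v" "T' \<in> star v" "z \<in> T" "z \<in> T'" "z \<noteq> v"
  shows "(T, T') \<in> edge_rel v"
proof -
  have T: "T \<in> \<T>" "T' \<in> \<T>" using assms by (auto simp: star_def)
  obtain w where w: "w \<noteq> v" "w \<in> supp z" using supp_other[OF T(1) assms(3,5)] by blast
  then have "w \<in> verts T" "w \<in> verts T'" using supp_subset[OF T(1) assms(3)] supp_subset[OF T(2) assms(4)] by auto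
  then show ?thesis using assms w by (auto simp: edge_rel_def)
qed

lemma vertex_in_star: "v \<in> vertices \<Longrightarrow> T \<in> \<T> \<Longrightarrow> v \<in> T \<Longrightarrow> T \<in> star v"
proof -
  assume v: "v \<in> vertices" "T \<in> \<T>" "v \<in> T"
  obtain T0 where T0: "T0 \<in> \<T>" "v \<in> verts T0" using v(1) by (auto simp: vertices_def)
  then have "v \<in> T0" "bary T0 v v \<noteq> 0" using verts_subset[OF full] bary_props(2)[OF full] by auto
  then show ?thesis using face_transfer[OF T0(1) v(2) _ v(3) T0(2)] v by (simp add: star_def)
qed

text \<open>Small spheres around the vertex are connected, and elements that meet on such a sphere share an edge.\<close>

lemma cluster_interior_vertex:
  assumes v: "v \<in> \<Omega>" and T: "T \<in> star v"
  shows "cluster v T = star v"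
proof -
  have vV: "v \<in> vertices" using T by (auto simp: star_def vertices_def)
  obtain d1 where d1: "d1 > 0" "\<And>T. T \<in> \<T> \<Longrightarrow> T \<inter> ball v d1 \<noteq> {} \<Longrightarrow> v \<in> T" by (rule local_elements[of v]) (rule that)
  obtain d2 where d2: "d2 > 0" "ball v d2 \<subseteq> \<Omega>" using open_dom v open_contains_ball by blast
  \<comment> \<open>Radii below the distance to every other vertex ensure that each element of the
    star meets the sphere.\<close>
  define d3 where "d3 = Min (insert 1 (dist v ` (vertices - {v})))"
  have d3: "d3 > 0" using finite_vertices by (auto simp: d3_def)
  have d3le: "d3 \<le> dist v w" if "w \<in> vertices" "w \<noteq> v" for w unfolding d3_def using finite_vertices that by (intro Min_le) auto
  define e where "e = Min {d1, d2, d3} / 2"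
  have e: "e > 0" "e < d1" "e < d2" "e < d3" using d1 d2 d3 by (auto simp: e_def)
  let ?S = "sphere v e"
  define A where "A = \<Union>(cluster v T)"
  define B where "B = \<Union>(star v - cluster v T)"
  have sub: "cluster v T \<subseteq> \<T>" using cluster_subset_star[OF T] by (auto simp: star_def)
  have fc: "finite (cluster v T)" using finite_subset[OF cluster_subset_star[OF T] finite_star] .
  have "closed A" unfolding A_def using sub elem_closed by (intro closed_Union fc) auto
  moreover have "closed B" unfolding B_def using elem_closed finite_star by (intro closed_Union) (auto simp: star_def)
  moreover have "?S \<subseteq> A \<union> B"
  proof
    fix z assume z: "z \<in> ?S"
    then have "z \<in> \<Omega>" using d2 e by auto
    then obtain S where S: "S \<in> \<T>" "z \<in> S" using dom_subset by blast
    have "S \<inter> ball v d1 \<noteq> {}" using S z e by auto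
    then have "S \<in> star v" using d1(2)[OF S(1)] vertex_in_star[OF vV S(1)] by blast
    then show "z \<in> A \<union> B" using S by (auto simp: A_def B_def)
  qed
  moreover have "A \<inter> B \<inter> ?S = {}"
  proof (rule equals0I)
    fix z assume z: "z \<in> A \<inter> B \<inter> ?S"
    then obtain S S' where S: "S \<in> cluster v T" "z \<in> S" "S' \<in> star v" "S' \<notin> cluster v T" "z \<in> S'"
      by (auto simp: A_def B_def)
    have "z \<noteq> v" using z e by auto
    then have "(S, S') \<in> edge_rel v" using share_point_edge S cluster_subset_star[OF T] by blast
    then show False using cluster_step S by blast
  qed
  moreover have "connected ?S" by (rule connected_sphere[OF dim])
  moreover have hit: "S \<inter> ?S \<noteq> {}" if S: "S \<in> star v" for S
  proof -
    have SS: "S \<in> \<T>" "v \<in> verts S" using S by (auto simp: star_def)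
    have "card (verts S) \<noteq> 1" using full_simplex_verts(3)[OF full[OF SS(1)]] dim by simp
    then have "verts S \<noteq> {v}" by auto
    then obtain w where w: "w \<in> verts S" "w \<noteq> v" using SS by blast
    have "w \<in> vertices" using w SS by (auto simp: vertices_def)
    then have dvw: "e < dist v w" using d3le[of w] w(2) e by simp
    define z where "z = (1 - e / dist v w) *\<^sub>R v + (e / dist v w) *\<^sub>R w"
    have "z \<in> S" unfolding z_def
      by (rule convexD_alt[OF elem_convex[OF SS(1)]]) (use verts_subset[OF full[OF SS(1)]] SS w e dvw in auto)
    moreover have "v - z = (e / dist v w) *\<^sub>R (v - w)" by (simp add: z_def algebra_simps)
    then have "dist v z = e" using e dvw w(2) by (simp add: dist_norm)
    ultimately show ?thesis by auto
  qed
  ultimately have "A \<inter> ?S = {} \<or> B \<inter> ?S = {}" unfolding connected_closed by blast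
  moreover have "A \<inter> ?S \<noteq> {}" using hit[OF T] cluster_self[of T v] by (auto simp: A_def)
  ultimately have "B \<inter> ?S = {}" by blast
  then have "star v - cluster v T = {}" using hit unfolding B_def by blast
  then show ?thesis using cluster_subset_star[OF T] by blast
qed

text \<open>The cut-off creates no jump, because the segment can leave the cluster only through points where the
  hat function vanishes.\<close>

lemma cluster_hat_lipschitz:
  assumes T: "T \<in> star v" and seg: "closed_segment a b \<subseteq> \<Union>\<T>" and v: "v \<in> \<Omega> \<or> v \<notin> closed_segment a b"
  defines "G \<equiv> \<lambda>z. if z \<in> \<Union>(cluster v T) then hat v z else 0"
  shows "\<bar>G a - G b\<bar> \<le> size_ratio * \<sigma> / diameter T * dist a b"
proof -
  have TT: "T \<in> \<T>" using T by (simp add: star_def)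
  define L where "L = size_ratio * \<sigma> / diameter T"
  have L: "L \<ge> 0" using size_ratio_ge_1 \<sigma> diameter_pos[OF TT] by (simp add: L_def)
  have lip: "\<bar>G x - G y\<bar> \<le> L * dist x y"
    if S: "S \<in> \<T>" "x \<in> S" "y \<in> S" "x \<in> closed_segment a b" "y \<in> closed_segment a b" for S x y
  proof (cases "S \<in> cluster v T")
    case True
    then have v: "v \<in> verts S" using cluster_subset_star[OF T] by (auto simp: star_def)
    have "G x = bary S v x" "G y = bary S v y" using True S hat_eq[OF S(1) _ v] by (auto simp: G_def)
    moreover obtain x0 r where b: "r > 0" "cball x0 r \<subseteq> S" "diameter S \<le> \<sigma> * r" by (rule inball[OF S(1)])
    moreover have "1 / r \<le> L"
    proof -
      have "diameter T \<le> size_ratio * (\<sigma> * r)"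
        using cluster_diameter[OF True TT] b(3) size_ratio_ge_1 mult_left_mono[of "diameter S" "\<sigma> * r" size_ratio] by linarith
      then show ?thesis using b(1) diameter_pos[OF TT] by (simp add: L_def field_simps)
    qed
    then have "1 / r * dist x y \<le> L * dist x y" by (rule mult_right_mono) simp
    ultimately show ?thesis using bary_lipschitz[OF full[OF S(1)] b(2,1) v, of x y] by simp
  next
    case False
    have "G z = 0" if z: "z \<in> S" "z \<in> closed_segment a b" for z
    proof (rule ccontr)
      assume "G z \<noteq> 0"
      then obtain S' where S': "S' \<in> cluster v T" "z \<in> S'" "hat v z \<noteq> 0" by (auto simp: G_def split: if_splits)
      then have "v \<in> supp z" by (simp add: supp_def)
      then have Ss: "S \<in> star v" using supp_subset[OF S(1) z(1)] S(1) by (auto simp: star_def)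
      show False
      proof (cases "z = v")
        \<comment> \<open>Different clusters can meet in \<open>v\<close> itself. If the segment
          passes through \<open>v\<close>, the hypothesis puts \<open>v\<close> into \<Omega>, where
          there is only one cluster.\<close>
        case True
        then have "v \<in> \<Omega>" using v z by blast
        then show False using cluster_interior_vertex[OF _ T] Ss \<open>S \<notin> cluster v T\<close> by blast
      next
        case False
        then have "(S', S) \<in> edge_rel v" using share_point_edge[OF _ Ss S'(2) z(1)] S' cluster_subset_star[OF T] by blast
        then show False using cluster_step[OF S'(1)] \<open>S \<notin> cluster v T\<close> by blast
      qed
    qed
    then show ?thesis using S L by simp
  qed
  \<comment> \<open>The bound holds for two points of the segment in the same element. The finitely
    many closed parameter sets that belong to the elements glue to the same constant on the whole
    interval.\<close>
  define \<gamma> where "\<gamma> t = a + t *\<^sub>R (b - a)" for t :: real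
  have \<gamma>S: "\<gamma> t \<in> closed_segment a b" if "t \<in> {0..1}" for t
    using that by (auto simp: \<gamma>_def in_segment algebra_simps intro!: exI[of _ t])
  have "lipschitz_on (L * dist a b) {0..1} (\<lambda>t. G (\<gamma> t))"
  proof (rule lipschitz_on_closed_Union[where I = \<T> and U = "\<lambda>S. {t\<in>{0..1}. \<gamma> t \<in> S}"])
    fix S assume S: "S \<in> \<T>"
    show "lipschitz_on (L * dist a b) {t\<in>{0..1}. \<gamma> t \<in> S} (\<lambda>t. G (\<gamma> t))"
    proof (rule lipschitz_onI)
      fix s t assume st: "s \<in> {t\<in>{0..1}. \<gamma> t \<in> S}" "t \<in> {t\<in>{0..1}. \<gamma> t \<in> S}"
      have "\<gamma> s - \<gamma> t = (s - t) *\<^sub>R (b - a)" by (simp add: \<gamma>_def algebra_simps)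
      then have "dist (\<gamma> s) (\<gamma> t) = \<bar>s - t\<bar> * dist a b" by (simp add: dist_norm norm_minus_commute)
      then show "dist (G (\<gamma> s)) (G (\<gamma> t)) \<le> L * dist a b * dist s t"
        using lip[OF S, of "\<gamma> s" "\<gamma> t"] st \<gamma>S by (simp add: dist_real_def mult_ac)
    qed (use L in simp)
    have "continuous_on {0..1} \<gamma>" unfolding \<gamma>_def by (intro continuous_intros)
    then show "closed {t\<in>{0..1}. \<gamma> t \<in> S}"
      using continuous_closed_preimage[of "{0..1}" \<gamma> S] elem_closed[OF S] by (simp add: vimage_def Int_def)
  next
    show "{0..1} \<subseteq> (\<Union>S\<in>\<T>. {t\<in>{0..1}. \<gamma> t \<in> S})" using \<gamma>S seg by blast
  qed (use fin L in auto)
  from lipschitz_onD[OF this, of 0 1] show ?thesis by (simp add: \<gamma>_def dist_real_def L_def)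
qed

end

locale cut_mesh = shape_mesh +
  fixes k :: nat and r0 :: real and \<Omega>1 :: "'a set"
  assumes k: "k \<ge> 1" and cone: "uniform_cone r0 \<Omega>1" and open1: "open \<Omega>1" and sub1: "\<Omega>1 \<subseteq> \<Omega>"
    and nodes_off: "mesh_nodes k \<T> \<inter> frontier \<Omega>1 = {}"
begin

section \<open>Position of elements relative to \<Gamma>\<close>

lemma verts_nodes: "T \<in> \<T> \<Longrightarrow> v \<in> verts T \<Longrightarrow> v \<in> mesh_nodes k \<T>"
proof -
  assume T: "T \<in> \<T>" "v \<in> verts T"
  have "(\<Sum>w\<in>verts T. (real (if w = v then k else 0) / real k) *\<^sub>R w) = (\<Sum>w\<in>verts T. if w = v then v else 0)"
    using k by (intro sum.cong) auto
  also have "\<dots> = v" using finite_verts[OF T(1)] T(2) by simp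
  finally have "v = (\<Sum>w\<in>verts T. (real (if w = v then k else 0) / real k) *\<^sub>R w)" ..
  moreover have "(\<Sum>w\<in>verts T. if w = v then k else 0) = k" using finite_verts[OF T(1)] T(2) by simp
  ultimately have "v \<in> simplex_nodes k T" unfolding simplex_nodes_def verts_def[symmetric]
    by (intro CollectI exI[of _ "\<lambda>w. if w = v then k else 0"]) auto
  then show ?thesis using T by (auto simp: mesh_nodes_def)
qed

lemma frontier_in_mesh: "frontier \<Omega>1 \<subseteq> \<Union>\<T>"
  unfolding Un using closure_mono[OF sub1] by (auto simp: frontier_def)

lemma elem_subset_closure_interior: "T \<in> \<T> \<Longrightarrow> T \<subseteq> closure (interior T)"
  using convex_closure_interior[OF elem_convex elem_interior] closure_subset by blast

lemma elem_meets_interior: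
  assumes "T \<in> \<T>" "open O'" "T \<inter> O' \<noteq> {}"
  shows "interior T \<inter> O' \<noteq> {}"
  using elem_subset_closure_interior[OF assms(1)] assms(2,3) open_Int_closure_eq_empty[OF assms(2), of "interior T"] by blast

text \<open>The interior of \<open>T\<close> is connected and misses \<Gamma>, so it lies in
  \<open>\<Omega>1\<close> once it meets it. Vertices are nodes, hence off \<Gamma>, and so lie in
  \<open>\<Omega>1\<close> rather than merely in its closure.\<close>

lemma uncut_elem:
  assumes "T \<in> \<T>" "T \<notin> cut_elements \<T> \<Omega>1" "T \<inter> \<Omega>1 \<noteq> {}"
  shows "T \<subseteq> closure \<Omega>1" "verts T \<subseteq> \<Omega>1"
proof -
  have "interior T \<inter> frontier \<Omega>1 = {}" using assms by (simp add: cut_elements_def)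
  moreover have "interior T \<inter> \<Omega>1 \<noteq> {}" by (rule elem_meets_interior[OF assms(1) open1 assms(3)])
  moreover have "connected (interior T)" using elem_convex[OF assms(1)] by (intro convex_connected convex_interior)
  ultimately have "interior T \<subseteq> \<Omega>1" using connected_Int_frontier[of "interior T" \<Omega>1] by blast
  then show c: "T \<subseteq> closure \<Omega>1" using elem_subset_closure_interior[OF assms(1)] closure_mono by blast
  show "verts T \<subseteq> \<Omega>1"
  proof
    fix v assume v: "v \<in> verts T"
    then have "v \<in> closure \<Omega>1" "v \<notin> frontier \<Omega>1"
      using c verts_subset[OF full[OF assms(1)]] verts_nodes[OF assms(1)] nodes_off by auto
    then show "v \<in> \<Omega>1" using open1 by (simp add: frontier_def interior_open)
  qed
qed

lemma cut_subset_ex: "cut_elements \<T> \<Omega>1 \<subseteq> ex_elements \<T> \<Omega>1"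
proof
  fix T assume "T \<in> cut_elements \<T> \<Omega>1"
  then obtain x where x: "T \<in> \<T>" "x \<in> interior T" "x \<in> closure \<Omega>1" by (auto simp: cut_elements_def frontier_def)
  then have "interior T \<inter> \<Omega>1 \<noteq> {}" using open_Int_closure_eq_empty[OF open_interior, of T \<Omega>1] by blast
  then show "T \<in> ex_elements \<T> \<Omega>1" using x interior_subset by (auto simp: ex_elements_def)
qed

text \<open>An uncut element that meets \<open>\<Omega>1\<close> lies in its closure, which would
  put the exterior node \<open>j\<close> on \<Gamma>.\<close>

lemma ex_elem_exterior_node:
  assumes T: "T \<in> ex_elements \<T> \<Omega>1" and j: "j \<in> mesh_nodes k \<T>" "j \<in> T" "j \<notin> \<Omega>1"
  shows "T \<in> cut_elements \<T> \<Omega>1"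
proof (rule ccontr)
  assume "T \<notin> cut_elements \<T> \<Omega>1"
  then have "T \<subseteq> closure \<Omega>1" using T uncut_elem by (auto simp: ex_elements_def)
  then have "j \<in> frontier \<Omega>1" using j open1 by (auto simp: frontier_def interior_open)
  then show False using nodes_off j by blast
qed

text \<open>Parts of \<open>\<Gamma>\<close> may run inside faces of elements that do not count as cut. That no node lies on \<open>\<Gamma>\<close> excludes
  that all elements at a point of \<open>\<Gamma>\<close> are of this kind, also where \<open>\<Gamma>\<close> touches the boundary of \<open>\<Omega>\<close>.\<close>

lemma cut_elements_cover_frontier:
  assumes y: "y \<in> frontier \<Omega>1"
  shows "\<exists>T\<in>cut_elements \<T> \<Omega>1. y \<in> T"
proof (rule ccontr)
  assume a: "\<not> ?thesis"
  have yU: "y \<in> \<Union>\<T>" using frontier_in_mesh y by blast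
  obtain d where d: "d > 0" "\<And>T. T \<in> \<T> \<Longrightarrow> T \<inter> ball y d \<noteq> {} \<Longrightarrow> y \<in> T" by (rule local_elements[of y]) (rule that)
  have "y \<in> closure \<Omega>1" using y by (simp add: frontier_def)
  then obtain z where z: "z \<in> \<Omega>1" "z \<in> ball y d" using d(1) by (metis closure_approachable dist_commute mem_ball)
  then obtain T where T: "T \<in> \<T>" "z \<in> T" using sub1 dom_subset by blast
  have yT: "y \<in> T" using d(2)[OF T(1)] T z by blast
  have ver: "verts T \<subseteq> \<Omega>1" by (rule uncut_elem(2)) (use T z yT a in auto)
  obtain w where w: "w \<in> supp y" using supp_ne[OF yU] by blast
  have wO: "w \<in> \<Omega>1" using w supp_subset[OF T(1) yT] ver by blast
  have inside: "S \<subseteq> closure \<Omega>1" if S: "S \<in> \<T>" "y \<in> S" for S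
  proof (rule uncut_elem(1)[OF S(1)])
    show "S \<notin> cut_elements \<T> \<Omega>1" using a S by blast
    have "w \<in> S" using w supp_subset[OF S] verts_subset[OF full[OF S(1)]] by blast
    then show "S \<inter> \<Omega>1 \<noteq> {}" using wO by blast
  qed
  \<comment> \<open>A vertex is its own carrier. As \<open>w\<close> lies in \<Omega> and in the
    carrier of \<open>y\<close>, the point \<open>y\<close> is interior to \<Omega>, so a short step
    along \<open>- \<xi>\<close> stays in the mesh. It leaves \<open>closure \<Omega>1\<close>,
    which contains all elements at \<open>y\<close>.\<close>
  have "supp w \<subseteq> supp y"
  proof
    fix u assume u: "u \<in> supp w"
    have wv: "w \<in> verts T" "w \<in> T" using w supp_subset[OF T(1) yT] verts_subset[OF full[OF T(1)]] by auto
    then have "u \<in> verts T" using u supp_subset[OF T(1)] by blast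
    then have "u = w" using u hat_eq[OF T(1) wv(2)] bary_props(2)[OF full[OF T(1)], of u w] wv
      by (auto simp: supp_def split: if_splits)
    then show "u \<in> supp y" using w by simp
  qed
  then have "y \<in> \<Omega>" using interior_of_face[of w y] wO sub1 yU by blast
  then obtain e where e: "e > 0" "ball y e \<subseteq> \<Omega>" using open_dom open_contains_ball by blast
  obtain \<xi> where \<xi>: "norm \<xi> = 1" and
    c1: "\<And>u w. u \<in> frontier \<Omega>1 \<Longrightarrow> dist y u < r0 \<Longrightarrow> w \<noteq> 0 \<Longrightarrow> norm w < r0 \<Longrightarrow> norm w / 2 \<le> \<xi> \<bullet> w \<Longrightarrow> u + w \<in> \<Omega>1" and
    c2: "\<And>u w. u \<in> frontier \<Omega>1 \<Longrightarrow> dist y u < r0 \<Longrightarrow> w \<noteq> 0 \<Longrightarrow> norm w < r0 \<Longrightarrow> norm w / 2 \<le> \<xi> \<bullet> w \<Longrightarrow> u - w \<notin> closure \<Omega>1"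
    by (rule uniform_coneE[OF cone y]) (rule that)
  have r0: "r0 > 0" using cone by (simp add: uniform_cone_def)
  define t where "t = Min {d, e, r0} / 2"
  have t: "t > 0" "t < d" "t < e" "t < r0" using d e r0 by (auto simp: t_def)
  have "y - t *\<^sub>R \<xi> \<notin> closure \<Omega>1"
    by (rule c2[OF y]) (use \<xi> t r0 norm_eq_1[of \<xi>] in auto)
  moreover have "dist y (y - t *\<^sub>R \<xi>) = t" using \<xi> t by (simp add: dist_norm)
  then have "y - t *\<^sub>R \<xi> \<in> \<Omega>" "y - t *\<^sub>R \<xi> \<in> ball y d" using e t by auto
  then obtain S where S: "S \<in> \<T>" "y - t *\<^sub>R \<xi> \<in> S" using dom_subset by blast
  have "S \<subseteq> closure \<Omega>1" by (rule inside[OF S(1) d(2)[OF S(1)]]) (use S \<open>y - t *\<^sub>R \<xi> \<in> ball y d\<close> in blast)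
  ultimately show False using S by blast
qed

text \<open>Some vertex \<open>v\<close> of \<open>T\<close> has a barycentric coordinate of at least \<open>1/(d+1)\<close> at \<open>x\<close>. Along the path from \<open>x\<close> through
  \<open>x + 3 \<rho> \<xi>\<close> to \<open>y\<close>, which stays in \<open>\<Omega>\<^sub>1\<close> by the cone condition, the hat function of \<open>v\<close> remains positive.\<close>

lemma frontier_patch:
  assumes T: "T \<in> \<T>" and x: "x \<in> T" "x \<in> frontier \<Omega>1" and \<rho>: "\<rho> > 0" "4 * \<rho> < r0"
    "8 * (real DIM('a) + 1) * size_ratio * \<sigma> * \<rho> \<le> diameter T"
  obtains v where "v \<in> verts T"
    "\<And>y S. y \<in> frontier \<Omega>1 \<Longrightarrow> dist x y < \<rho> \<Longrightarrow> S \<in> \<T> \<Longrightarrow> y \<in> S \<Longrightarrow>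
       v \<in> verts S \<and> diameter T \<le> size_ratio * diameter S \<and> diameter S \<le> size_ratio * diameter T"
proof -
  let ?n = "real DIM('a) + 1"
  have n: "?n > 0" by (simp add: add_pos_pos)
  have "\<exists>v\<in>verts T. 1 / ?n \<le> bary T v x"
  proof (rule ccontr)
    assume a: "\<not> ?thesis"
    have "verts T \<noteq> {}" using full_simplex_verts(3)[OF full[OF T]] by auto
    then have "(\<Sum>v\<in>verts T. bary T v x) < (\<Sum>v\<in>verts T. 1 / ?n)"
      using a finite_verts[OF T] by (intro sum_strict_mono) auto
    also have "\<dots> = 1" using full_simplex_verts(3)[OF full[OF T]] by simp
    finally show False using bary_comb(1)[OF full[OF T] x(1)] by simp
  qed
  then obtain v where v: "v \<in> verts T" "1 / ?n \<le> bary T v x" by blast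
  have Ts: "T \<in> star v" using T v by (simp add: star_def)
  have v_off: "v \<notin> frontier \<Omega>1" using verts_nodes[OF T v(1)] nodes_off by blast
  define G where "G = (\<lambda>z. if z \<in> \<Union>(cluster v T) then hat v z else 0)"
  define L where "L = size_ratio * \<sigma> / diameter T"
  have Gx: "1 / ?n \<le> G x"
    using hat_eq[OF T x(1) v(1)] v(2) x(1) cluster_self[of T v] by (auto simp: G_def)
  have L0: "L > 0" using size_ratio_ge_1 \<sigma> diameter_pos[OF T] by (simp add: L_def)
  \<comment> \<open>The path has length at most \<open>3 * \<rho> + 4 * \<rho>\<close>, so
    \<open>G\<close> falls by at most \<open>7 * L * \<rho>\<close>, less than its initial
    value.\<close>
  have L\<rho>: "8 * L * \<rho> \<le> 1 / ?n"
    using \<rho>(3) diameter_pos[OF T] n by (simp add: L_def field_simps)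
  obtain \<xi> where \<xi>: "norm \<xi> = 1" and
    c1: "\<And>u w. u \<in> frontier \<Omega>1 \<Longrightarrow> dist x u < r0 \<Longrightarrow> w \<noteq> 0 \<Longrightarrow> norm w < r0 \<Longrightarrow> norm w / 2 \<le> \<xi> \<bullet> w \<Longrightarrow> u + w \<in> \<Omega>1" and
    c2: "\<And>u w. u \<in> frontier \<Omega>1 \<Longrightarrow> dist x u < r0 \<Longrightarrow> w \<noteq> 0 \<Longrightarrow> norm w < r0 \<Longrightarrow> norm w / 2 \<le> \<xi> \<bullet> w \<Longrightarrow> u - w \<notin> closure \<Omega>1"
    by (rule uniform_coneE[OF cone x(2)]) (rule that)
  have seg: "closed_segment u (u + e) \<subseteq> insert u \<Omega>1"
    if u: "u \<in> frontier \<Omega>1" "dist x u < r0" and e: "norm e < r0" "norm e / 2 \<le> \<xi> \<bullet> e" for u e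
  proof
    fix z assume "z \<in> closed_segment u (u + e)"
    then obtain s where s: "0 \<le> s" "s \<le> 1" "z = u + s *\<^sub>R e" by (auto simp: in_segment algebra_simps)
    show "z \<in> insert u \<Omega>1"
    proof (cases "s *\<^sub>R e = 0")
      case False
      have "s * norm e \<le> norm e" using s by (simp add: mult_left_le_one_le)
      then have "u + s *\<^sub>R e \<in> \<Omega>1"
        using s False mult_left_mono[OF e(2) s(1)] order_le_less_trans[OF _ e(1)] by (intro c1[OF u]) auto
      then show ?thesis using s by simp
    qed (use s in simp)
  qed
  have step: "\<bar>G a - G b\<bar> \<le> L * dist a b" if "u \<in> frontier \<Omega>1" "closed_segment a b \<subseteq> insert u \<Omega>1" for a b u
    unfolding G_def L_def
  proof (rule cluster_hat_lipschitz[OF Ts])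
    show "closed_segment a b \<subseteq> \<Union>\<T>" using that frontier_in_mesh sub1 dom_subset by blast
    show "v \<in> \<Omega> \<or> v \<notin> closed_segment a b" using that v_off sub1 by blast
  qed
  show thesis
  proof (rule that[OF v(1)])
    fix y S assume y: "y \<in> frontier \<Omega>1" "dist x y < \<rho>" and S: "S \<in> \<T>" "y \<in> S"
    \<comment> \<open>Seen from any \<open>y\<close> within \<open>\<rho>\<close> of
      \<open>x\<close>, the point \<open>z\<close> lies in the cone: \<open>e\<close> has norm at
      most \<open>4 * \<rho>\<close> and axial component at least \<open>2 * \<rho>\<close>.\<close>
    define z where "z = x + (3 * \<rho>) *\<^sub>R \<xi>"
    define e where "e = z - y"
    have \<xi>\<xi>: "\<xi> \<bullet> \<xi> = 1" using \<xi> by (simp add: norm_eq_1)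
    have e1: "norm e \<le> 4 * \<rho>"
    proof -
      have "e = (3 * \<rho>) *\<^sub>R \<xi> + (x - y)" by (simp add: e_def z_def)
      then have "norm e \<le> norm ((3 * \<rho>) *\<^sub>R \<xi>) + norm (x - y)" using norm_triangle_ineq by metis
      then show ?thesis using \<xi> \<rho> y(2) by (simp add: dist_norm)
    qed
    have e2: "norm e / 2 \<le> \<xi> \<bullet> e"
    proof -
      have "\<bar>\<xi> \<bullet> (x - y)\<bar> \<le> norm (x - y)" using Cauchy_Schwarz_ineq2[of \<xi> "x - y"] \<xi> by simp
      then have "2 * \<rho> \<le> \<xi> \<bullet> e" using y(2) by (simp add: e_def z_def inner_diff_right inner_add_right \<xi>\<xi> dist_norm)
      then show ?thesis using e1 by simp
    qed
    have "\<bar>G x - G z\<bar> \<le> L * dist x z" unfolding z_def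
      by (rule step[OF x(2) seg[OF x(2)]]) (use \<xi> \<rho> \<xi>\<xi> in auto)
    moreover have "dist x z = 3 * \<rho>" using \<xi> \<rho> by (simp add: z_def dist_norm)
    moreover have "\<bar>G y - G z\<bar> \<le> L * dist y z"
      using step[OF y(1) seg[OF y(1), of e]] e1 e2 y(2) \<rho> by (simp add: e_def)
    moreover have "L * dist y z \<le> L * (4 * \<rho>)" using e1 L0 by (simp add: e_def dist_norm norm_minus_commute)
    moreover have "0 < L * \<rho>" using L0 \<rho> by simp
    ultimately have "G y > 0" using Gx L\<rho> by (simp add: algebra_simps abs_le_iff)
    then obtain S' where S': "S' \<in> cluster v T" "y \<in> S'" "hat v y \<noteq> 0" by (auto simp: G_def split: if_splits)
    have vS: "v \<in> verts S" using S'(3) supp_subset[OF S] by (auto simp: supp_def)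
    have "y \<noteq> v" using v_off y by auto
    moreover have "S \<in> star v" using S vS by (simp add: star_def)
    ultimately have "(S', S) \<in> edge_rel v" using share_point_edge[of S' v S y] S' S cluster_subset_star[OF Ts] by blast
    then have SC: "S \<in> cluster v T" using cluster_step[OF S'(1)] by blast
    show "v \<in> verts S \<and> diameter T \<le> size_ratio * diameter S \<and> diameter S \<le> size_ratio * diameter T"
      using vS cluster_diameter[OF SC T] cluster_diameter[OF cluster_sym[OF SC] S(1)] by blast
  qed
qed

end

section \<open>Stable splitting\<close>

lemma grad_within_cong:
  assumes "\<And>y. y \<in> T \<Longrightarrow> f y = g y" "x \<in> T"
  shows "grad_within T f x = grad_within T g x"
proof -
  have "(f has_derivative D) (at x within T) \<longleftrightarrow> (g has_derivative D) (at x within T)" for D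
    using has_derivative_transform[OF assms(2), of g f D] has_derivative_transform[OF assms(2), of f g D] assms(1) by metis
  then show ?thesis unfolding grad_within_def frechet_derivative_def by simp
qed

text \<open>Along the direction \<open>g\<close> itself \<open>p\<close> grows at rate
  \<open>g \<bullet> g\<close>, whereas the Lipschitz bound allows only
  \<open>L * norm g\<close>.\<close>

lemma gradient_le_lipschitz:
  fixes p :: "'a::euclidean_space \<Rightarrow> real"
  assumes T: "x \<in> interior T" and p: "(p has_derivative (\<lambda>h. g \<bullet> h)) (at x)"
    and lip: "\<And>y. y \<in> T \<Longrightarrow> \<bar>p y - p x\<bar> \<le> L * dist x y" and L: "L \<ge> 0"
  shows "norm g \<le> L"
proof (rule ccontr)
  assume a: "\<not> norm g \<le> L"
  then have g: "norm g > 0" using L by linarith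
  obtain e where e: "e > 0" "ball x e \<subseteq> T" using T mem_interior by blast
  define \<psi> where "\<psi> t = p (x + t *\<^sub>R g) - L * norm g * t" for t :: real
  have inn: "((\<lambda>t. x + t *\<^sub>R g) has_derivative (\<lambda>h. h *\<^sub>R g)) (at 0)" by (auto intro!: derivative_eq_intros)
  have "((\<lambda>t. p (x + t *\<^sub>R g)) has_derivative (\<lambda>h. g \<bullet> (h *\<^sub>R g))) (at 0)"
    using has_derivative_compose[OF inn, of p "\<lambda>h. g \<bullet> h"] p by simp
  then have "((\<lambda>t. p (x + t *\<^sub>R g)) has_field_derivative (g \<bullet> g)) (at 0)"
    unfolding has_field_derivative_def by (simp add: mult_commute_abs)
  then have D: "DERIV \<psi> 0 :> g \<bullet> g - L * norm g"
    unfolding \<psi>_def by (auto intro!: derivative_eq_intros)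
  have "g \<bullet> g - L * norm g = (norm g - L) * norm g" by (simp add: power2_norm_eq_inner[symmetric] power2_eq_square algebra_simps)
  then have "g \<bullet> g - L * norm g > 0" using a g by simp
  from DERIV_pos_inc_right[OF D this] obtain d where d: "d > 0" "\<And>h. 0 < h \<Longrightarrow> h < d \<Longrightarrow> \<psi> 0 < \<psi> h" by auto
  define t where "t = min d (e / norm g) / 2"
  have t: "t > 0" "t < d" "t * norm g < e" using d e g by (auto simp: t_def min_def field_simps)
  then have "x + t *\<^sub>R g \<in> T" using e by (intro subsetD[OF e(2)]) (simp add: dist_norm)
  then have "\<bar>p (x + t *\<^sub>R g) - p x\<bar> \<le> L * (t * norm g)" using lip[of "x + t *\<^sub>R g"] t by (simp add: dist_norm)
  moreover have "\<psi> 0 < \<psi> t" using d t by blast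
  ultimately show False by (simp add: \<psi>_def algebra_simps)
qed

text \<open>The constants of the auxiliary estimates are parameters, so every constant derived from
  them is a term in which no mesh occurs.\<close>

locale cut_mesh_est = cut_mesh +
  fixes \<gamma> Co Cu cl H :: real
  assumes pos: "\<gamma> > 0" "Co > 0" "Cu > 0" "cl > 0" "H > 0"
    and osc: "\<And>(T :: 'a set) x0 r p g a b. convex T \<Longrightarrow> compact T \<Longrightarrow> cball x0 r \<subseteq> T \<Longrightarrow> r > 0 \<Longrightarrow>
     (\<And>x. (p has_derivative (\<lambda>h. g x \<bullet> h)) (at x)) \<Longrightarrow> (\<And>b. b \<in> Basis \<Longrightarrow> (\<lambda>x. g x \<bullet> b) \<in> polynomials k) \<Longrightarrow>
     a \<in> T \<Longrightarrow> b \<in> T \<Longrightarrow> (p a - p b)\<^sup>2 * r ^ DIM('a) \<le> Co * (dist a b)\<^sup>2 * (LINT y:T|lborel. (norm (g y))\<^sup>2)"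
    and upper: "\<And>T. T \<in> \<T> \<Longrightarrow> emeasure surface_measure (T \<inter> frontier \<Omega>1) \<le> ennreal (Cu * diameter T ^ (DIM('a) - 1))"
    and lower: "\<And>x \<rho>. x \<in> frontier \<Omega>1 \<Longrightarrow> 0 < \<rho> \<Longrightarrow> \<rho> \<le> r0 \<Longrightarrow>
      ennreal (cl * \<rho> ^ (DIM('a) - 1)) \<le> emeasure surface_measure (frontier \<Omega>1 \<inter> ball x \<rho>)"
    and H: "\<And>T. T \<in> \<T> \<Longrightarrow> diameter T \<le> H"
begin

section \<open>Energies and their elementwise bounds\<close>

definition grad_energy :: "'a set \<Rightarrow> ('a \<Rightarrow> real) \<Rightarrow> real" where
  "grad_energy T f = (LINT x:T|lborel. (norm (grad_within T f x))\<^sup>2)"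

definition surf_energy :: "'a set \<Rightarrow> ('a \<Rightarrow> real) \<Rightarrow> real" where
  "surf_energy T f = (LINT x:T \<inter> frontier \<Omega>1|surface_measure. f x * f x)"

definition b_energy :: "('a \<Rightarrow> real) \<Rightarrow> real" where
  "b_energy f = (\<Sum>T\<in>ex_elements \<T> \<Omega>1. grad_energy T f) + \<gamma> * (\<Sum>T\<in>cut_elements \<T> \<Omega>1. inverse (diameter T) * surf_energy T f)"

lemma norm_b_sq_b_energy: "norm_b_sq \<gamma> \<T> \<Omega>1 u = b_energy (L1 u)"
  by (simp add: norm_b_sq_def b_energy_def grad_energy_def surf_energy_def Gamma_weighted_def)

definition piecewise_poly :: "('a \<Rightarrow> real) \<Rightarrow> bool" where
  "piecewise_poly f \<longleftrightarrow> (\<forall>T\<in>\<T>. \<exists>p\<in>polynomials k. \<forall>x\<in>T. f x = p x)"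

lemma piecewise_poly_elem:
  assumes "piecewise_poly f" "T \<in> \<T>"
  obtains p g where "p \<in> polynomials k" "\<And>x. x \<in> T \<Longrightarrow> f x = p x" "\<And>x. (p has_derivative (\<lambda>h. g x \<bullet> h)) (at x)"
    "\<And>b. b \<in> Basis \<Longrightarrow> (\<lambda>x. g x \<bullet> b) \<in> polynomials k" "grad_energy T f = (LINT x:T|lborel. (norm (g x))\<^sup>2)"
proof -
  obtain p where p: "p \<in> polynomials k" "\<forall>x\<in>T. f x = p x" using assms unfolding piecewise_poly_def by blast
  obtain g where g: "\<forall>x. (p has_derivative (\<lambda>h. g x \<bullet> h)) (at x)" "\<forall>b\<in>Basis. (\<lambda>x. g x \<bullet> b) \<in> polynomials k"
    using polynomials_has_gradient[OF p(1)] by (elim exE conjE)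
  have "grad_energy T f = (LINT x:T|lborel. (norm (g x))\<^sup>2)" unfolding grad_energy_def
    by (rule set_integral_grad_within[OF elem_convex[OF assms(2)] elem_interior[OF assms(2)]]) (use p g in auto)
  then show thesis by (intro that[of p g]) (use p g in auto)
qed

lemma ex_sub: "T \<in> ex_elements \<T> \<Omega>1 \<Longrightarrow> T \<in> \<T>" and cut_sub: "T \<in> cut_elements \<T> \<Omega>1 \<Longrightarrow> T \<in> \<T>"
  and fin_ex: "finite (ex_elements \<T> \<Omega>1)" and fin_cut: "finite (cut_elements \<T> \<Omega>1)"
  using fin by (auto simp: ex_elements_def cut_elements_def)

lemma grad_energy_nonneg: "grad_energy T f \<ge> 0" and surf_energy_nonneg: "surf_energy T f \<ge> 0"
  unfolding grad_energy_def surf_energy_def set_lebesgue_integral_def by (auto intro!: integral_nonneg)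

text \<open>Derivatives are taken within the closed element, so only the values on the extended
  region count. This permits replacing \<open>u\<^sup>\<Gamma>\<close>, which is cut off outside the
  cut region, by a global piecewise polynomial.\<close>

lemma b_energy_cong:
  assumes "\<And>T x. T \<in> ex_elements \<T> \<Omega>1 \<Longrightarrow> x \<in> T \<Longrightarrow> f x = g x"
  shows "b_energy f = b_energy g"
proof -
  have "grad_energy T f = grad_energy T g" if T: "T \<in> ex_elements \<T> \<Omega>1" for T
    unfolding grad_energy_def set_lebesgue_integral_def
  proof (intro Bochner_Integration.integral_cong refl)
    fix x
    show "indicator T x *\<^sub>R (norm (grad_within T f x))\<^sup>2 = indicator T x *\<^sub>R (norm (grad_within T g x))\<^sup>2"
      using grad_within_cong[of T f g x] assms[OF T] by (cases "x \<in> T") auto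
  qed
  moreover have "surf_energy T f = surf_energy T g" if T: "T \<in> cut_elements \<T> \<Omega>1" for T
    unfolding surf_energy_def set_lebesgue_integral_def
  proof (intro Bochner_Integration.integral_cong refl)
    have "T \<in> ex_elements \<T> \<Omega>1" using T cut_subset_ex by blast
    then show "indicator (T \<inter> frontier \<Omega>1) x *\<^sub>R (f x * f x) = indicator (T \<inter> frontier \<Omega>1) x *\<^sub>R (g x * g x)" for x
      using assms[of T x] by (cases "x \<in> T") auto
  qed
  ultimately show ?thesis unfolding b_energy_def by simp
qed

lemma surface_integrable:
  assumes "piecewise_poly f" "T \<in> \<T>"
  shows "integrable surface_measure (\<lambda>x. indicator (T \<inter> frontier \<Omega>1) x *\<^sub>R (f x * f x))"
proof -
  obtain p g where p: "p \<in> polynomials k" "\<And>x. x \<in> T \<Longrightarrow> f x = p x" by (rule piecewise_poly_elem[OF assms]) (rule that)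
  have pc: "continuous_on UNIV (\<lambda>x. p x * p x)" by (intro continuous_intros polynomials_continuous[OF p(1)])
  have "compact ((\<lambda>x. p x * p x) ` T)"
    by (rule compact_continuous_image[OF continuous_on_subset[OF pc subset_UNIV] elem_compact[OF assms(2)]])
  then have "bounded ((\<lambda>x. p x * p x) ` T)" by (rule compact_imp_bounded)
  then obtain B where B: "\<And>x. x \<in> T \<Longrightarrow> norm (p x * p x) \<le> B" unfolding bounded_iff by blast
  have "integrable surface_measure (\<lambda>x. indicator (T \<inter> frontier \<Omega>1) x *\<^sub>R (p x * p x))"
  proof (rule integrableI_bounded_set_indicator[where B = B])
    show "T \<inter> frontier \<Omega>1 \<in> sets surface_measure" using elem_closed[OF assms(2)] by simp
    show "(\<lambda>x. p x * p x) \<in> borel_measurable surface_measure"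
      using borel_measurable_continuous_onI[OF pc] by simp
    show "emeasure surface_measure (T \<inter> frontier \<Omega>1) < \<infinity>"
      using upper[OF assms(2)] by (simp add: order_le_less_trans)
    show "AE x in surface_measure. x \<in> T \<inter> frontier \<Omega>1 \<longrightarrow> norm (p x * p x) \<le> B" using B by simp
  qed
  moreover have "(\<lambda>x. indicator (T \<inter> frontier \<Omega>1) x *\<^sub>R (p x * p x)) = (\<lambda>x. indicator (T \<inter> frontier \<Omega>1) x *\<^sub>R (f x * f x))"
    using p(2) by (auto simp: fun_eq_iff indicator_def)
  ultimately show ?thesis by simp
qed

lemma nn_surface_integral:
  assumes "piecewise_poly f" "T \<in> \<T>"
  shows "(\<integral>\<^sup>+x. ennreal (indicator (T \<inter> frontier \<Omega>1) x *\<^sub>R (f x * f x)) \<partial>surface_measure) = ennreal (surf_energy T f)"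
  unfolding surf_energy_def set_lebesgue_integral_def
  by (rule nn_integral_eq_integral[OF surface_integrable[OF assms]]) (auto simp: indicator_def)

lemma surf_energy_bound:
  assumes f: "piecewise_poly f" and T: "T \<in> \<T>" and B: "\<And>x. x \<in> T \<Longrightarrow> \<bar>f x\<bar> \<le> B" "B \<ge> 0"
  shows "surf_energy T f \<le> B\<^sup>2 * (Cu * diameter T ^ (DIM('a) - 1))"
proof -
  have "ennreal (surf_energy T f) \<le> (\<integral>\<^sup>+x. ennreal (B\<^sup>2) * indicator (T \<inter> frontier \<Omega>1) x \<partial>surface_measure)"
    unfolding nn_surface_integral[OF f T, symmetric]
  proof (rule nn_integral_mono)
    fix x
    have "x \<in> T \<Longrightarrow> f x * f x \<le> B\<^sup>2" using B abs_le_square_iff[of "f x" B] by (simp add: power2_eq_square)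
    then show "ennreal (indicator (T \<inter> frontier \<Omega>1) x *\<^sub>R (f x * f x)) \<le> ennreal (B\<^sup>2) * indicator (T \<inter> frontier \<Omega>1) x"
      by (auto simp: indicator_def ennreal_leI)
  qed
  also have "\<dots> = ennreal (B\<^sup>2) * emeasure surface_measure (T \<inter> frontier \<Omega>1)"
    using elem_closed[OF T] by (intro nn_integral_cmult_indicator) simp
  also have "\<dots> \<le> ennreal (B\<^sup>2) * ennreal (Cu * diameter T ^ (DIM('a) - 1))"
    by (intro mult_left_mono upper[OF T]) simp
  also have "\<dots> = ennreal (B\<^sup>2 * (Cu * diameter T ^ (DIM('a) - 1)))" by (rule ennreal_mult'[symmetric]) simp
  finally show ?thesis
    using pos diameter_pos[OF T] by (subst (asm) ennreal_le_iff) auto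
qed

lemma grad_energy_bound:
  assumes f: "piecewise_poly f" and T: "T \<in> \<T>" and L: "\<And>x y. x \<in> T \<Longrightarrow> y \<in> T \<Longrightarrow> \<bar>f x - f y\<bar> \<le> L * dist x y" "L \<ge> 0"
  shows "grad_energy T f \<le> L\<^sup>2 * (unit_ball_vol (real DIM('a)) * diameter T ^ DIM('a))"
proof -
  obtain p g where p: "\<And>x. x \<in> T \<Longrightarrow> f x = p x" "\<And>x. (p has_derivative (\<lambda>h. g x \<bullet> h)) (at x)"
    "\<And>b. b \<in> Basis \<Longrightarrow> (\<lambda>x. g x \<bullet> b) \<in> polynomials k" "grad_energy T f = (LINT x:T|lborel. (norm (g x))\<^sup>2)"
    by (rule piecewise_poly_elem[OF f T]) (rule that)
  have gc: "continuous_on UNIV (\<lambda>x. (norm (g x))\<^sup>2)"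
    unfolding norm_sq_gradient_sum by (intro continuous_intros polynomials_continuous[OF p(3)])
  have gi: "(norm (g x))\<^sup>2 \<le> L\<^sup>2" if "x \<in> interior T" for x
  proof -
    have xT: "x \<in> T" using that interior_subset by blast
    have "norm (g x) \<le> L"
    proof (rule gradient_le_lipschitz[OF that p(2) _ L(2)])
      fix y assume "y \<in> T"
      then show "\<bar>p y - p x\<bar> \<le> L * dist x y" using L(1)[of y x] xT p(1) by (simp add: dist_commute)
    qed
    then show ?thesis by (intro power_mono) auto
  qed
  have "closed {x. (norm (g x))\<^sup>2 \<le> L\<^sup>2}" using gc by (intro closed_Collect_le) auto
  then have "closure (interior T) \<subseteq> {x. (norm (g x))\<^sup>2 \<le> L\<^sup>2}" using gi by (intro closure_minimal) auto
  then have gT: "(norm (g x))\<^sup>2 \<le> L\<^sup>2" if "x \<in> T" for x using elem_subset_closure_interior[OF T] that by blast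
  have Tb: "T \<in> sets lborel" using elem_closed[OF T] by simp
  obtain z where z: "z \<in> T" using elem_interior[OF T] interior_subset by blast
  have sub: "T \<subseteq> cball z (diameter T)" using dist_le_diameter[OF T z] by auto
  have fT: "emeasure lborel T < \<infinity>" by (rule emeasure_compact_finite[OF elem_compact[OF T]])
  have vol: "measure lborel T \<le> unit_ball_vol (real DIM('a)) * diameter T ^ DIM('a)"
  proof -
    have "measure lborel T \<le> measure lborel (cball z (diameter T))"
      using sub Tb emeasure_lborel_cball_finite[of z "diameter T"]
      by (intro measure_mono_fmeasurable fmeasurableI) auto
    also have "\<dots> = unit_ball_vol (real DIM('a)) * diameter T ^ DIM('a)"
      using content_cball[of "diameter T" z] diameter_pos[OF T] by simp
    finally show ?thesis .
  qed
  have "grad_energy T f \<le> (LINT x|lborel. indicator T x *\<^sub>R L\<^sup>2)"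
    unfolding p(4) set_lebesgue_integral_def
  proof (rule integral_mono)
    show "integrable lborel (\<lambda>x. indicator T x *\<^sub>R (norm (g x))\<^sup>2)"
      using polynomial_gradient_integrable[OF elem_compact[OF T], of g k] p(3) by (simp add: set_integrable_def)
    show "integrable lborel (\<lambda>x. indicator T x *\<^sub>R L\<^sup>2)" using Tb fT by simp
    show "indicator T x *\<^sub>R (norm (g x))\<^sup>2 \<le> indicator T x *\<^sub>R L\<^sup>2" for x using gT by (auto simp: indicator_def)
  qed
  also have "\<dots> = L\<^sup>2 * measure lborel T" using Tb fT by simp
  also have "\<dots> \<le> L\<^sup>2 * (unit_ball_vol (real DIM('a)) * diameter T ^ DIM('a))" by (intro mult_left_mono vol) simp
  finally show ?thesis .
qed

lemma piecewise_poly_comb: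
  assumes "piecewise_poly f" "piecewise_poly g"
  shows "piecewise_poly (\<lambda>x. f x + s * g x)"
  unfolding piecewise_poly_def
proof
  fix T assume T: "T \<in> \<T>"
  obtain p where p: "p \<in> polynomials k" "\<forall>x\<in>T. f x = p x" using assms(1) T unfolding piecewise_poly_def by blast
  obtain q where q: "q \<in> polynomials k" "\<forall>x\<in>T. g x = q x" using assms(2) T unfolding piecewise_poly_def by blast
  show "\<exists>p\<in>polynomials k. \<forall>x\<in>T. f x + s * g x = p x"
    by (rule bexI[of _ "\<lambda>x. p x + s * q x"]) (use p q in \<open>auto intro: polynomials_add polynomials_cmult\<close>)
qed

text \<open>The triangle inequality for squares. The sign \<open>-1\<close> serves to recover
  \<open>u\<^sup>-\<close> as a difference.\<close>

lemma b_energy_comb_le: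
  assumes f: "piecewise_poly f" and g: "piecewise_poly g" and s: "s = 1 \<or> s = -1"
  shows "b_energy (\<lambda>x. f x + s * g x) \<le> 2 * (b_energy f + b_energy g)"
proof -
  have fg: "piecewise_poly (\<lambda>x. f x + s * g x)" by (rule piecewise_poly_comb[OF f g])
  have s2: "s * s = 1" using s by auto
  have 1: "grad_energy T (\<lambda>x. f x + s * g x) \<le> 2 * (grad_energy T f + grad_energy T g)" if T: "T \<in> \<T>" for T
  proof -
    obtain p p' where p: "p \<in> polynomials k" "\<And>x. x \<in> T \<Longrightarrow> f x = p x" "\<And>x. (p has_derivative (\<lambda>h. p' x \<bullet> h)) (at x)"
      "\<And>b. b \<in> Basis \<Longrightarrow> (\<lambda>x. p' x \<bullet> b) \<in> polynomials k" "grad_energy T f = (LINT x:T|lborel. (norm (p' x))\<^sup>2)"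
      by (rule piecewise_poly_elem[OF f T]) (rule that)
    obtain q q' where q: "q \<in> polynomials k" "\<And>x. x \<in> T \<Longrightarrow> g x = q x" "\<And>x. (q has_derivative (\<lambda>h. q' x \<bullet> h)) (at x)"
      "\<And>b. b \<in> Basis \<Longrightarrow> (\<lambda>x. q' x \<bullet> b) \<in> polynomials k" "grad_energy T g = (LINT x:T|lborel. (norm (q' x))\<^sup>2)"
      by (rule piecewise_poly_elem[OF g T]) (rule that)
    have d: "((\<lambda>x. p x + s * q x) has_derivative (\<lambda>h. (p' x + s *\<^sub>R q' x) \<bullet> h)) (at x)" for x
      using has_derivative_add[OF p(3)[of x] has_derivative_mult_right[OF q(3)[of x], of s]] by (simp add: inner_add_left)
    have E1: "grad_energy T (\<lambda>x. f x + s * g x) = (LINT x:T|lborel. (norm (p' x + s *\<^sub>R q' x))\<^sup>2)" unfolding grad_energy_def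
      by (rule set_integral_grad_within[OF elem_convex[OF T] elem_interior[OF T] _ d]) (use p q in auto)
    have ip: "set_integrable lborel T (\<lambda>x. (norm (p' x))\<^sup>2)" by (rule polynomial_gradient_integrable[OF elem_compact[OF T] p(4)])
    have iq: "set_integrable lborel T (\<lambda>x. (norm (q' x))\<^sup>2)" by (rule polynomial_gradient_integrable[OF elem_compact[OF T] q(4)])
    have ipq: "set_integrable lborel T (\<lambda>x. (norm (p' x + s *\<^sub>R q' x))\<^sup>2)"
    proof (rule polynomial_gradient_integrable[OF elem_compact[OF T]])
      fix b :: 'a assume "b \<in> Basis"
      then have "(\<lambda>x. p' x \<bullet> b + s * (q' x \<bullet> b)) \<in> polynomials k" by (intro polynomials_add polynomials_cmult p q)
      then show "(\<lambda>x. (p' x + s *\<^sub>R q' x) \<bullet> b) \<in> polynomials k" by (simp add: inner_add_left)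
    qed
    have pt: "(norm (u + s *\<^sub>R w))\<^sup>2 \<le> 2 * ((norm u)\<^sup>2 + (norm w)\<^sup>2)" for u w :: 'a
    proof -
      have "(norm (u + s *\<^sub>R w))\<^sup>2 + (norm (u - s *\<^sub>R w))\<^sup>2 = 2 * ((norm u)\<^sup>2 + (norm w)\<^sup>2)"
        unfolding power2_norm_eq_inner using s by (auto simp: inner_add_left inner_add_right inner_diff_left inner_diff_right inner_commute)
      then show ?thesis using zero_le_power2[of "norm (u - s *\<^sub>R w)"] by linarith
    qed
    have "(LINT x:T|lborel. (norm (p' x + s *\<^sub>R q' x))\<^sup>2) \<le> (LINT x:T|lborel. 2 * ((norm (p' x))\<^sup>2 + (norm (q' x))\<^sup>2))"
      by (rule set_integral_mono[OF ipq]) (use ip iq pt in \<open>auto intro!: set_integral_add\<close>)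
    also have "\<dots> = 2 * ((LINT x:T|lborel. (norm (p' x))\<^sup>2) + (LINT x:T|lborel. (norm (q' x))\<^sup>2))"
      unfolding set_integral_mult_right set_integral_add(2)[OF ip iq] ..
    finally show ?thesis unfolding E1 p(5) q(5) .
  qed
  have 2: "surf_energy T (\<lambda>x. f x + s * g x) \<le> 2 * (surf_energy T f + surf_energy T g)" if T: "T \<in> \<T>" for T
  proof -
    let ?i = "\<lambda>x. indicator (T \<inter> frontier \<Omega>1) x :: real"
    note I = surface_integrable[OF f T] surface_integrable[OF g T] surface_integrable[OF fg T]
    have "surf_energy T (\<lambda>x. f x + s * g x) \<le> (\<integral>x. 2 * (?i x *\<^sub>R (f x * f x) + ?i x *\<^sub>R (g x * g x)) \<partial>surface_measure)"
      unfolding surf_energy_def set_lebesgue_integral_def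
    proof (rule integral_mono[OF I(3)])
      show "integrable surface_measure (\<lambda>x. 2 * (?i x *\<^sub>R (f x * f x) + ?i x *\<^sub>R (g x * g x)))" using I by simp
      fix x
      have gen: "(u + w) * (u + w) \<le> 2 * (u * u + w * w)" for u w :: real
        using zero_le_square[of "u - w"] by (simp add: algebra_simps)
      have "(s * g x) * (s * g x) = g x * g x" using s by auto
      then have "(f x + s * g x) * (f x + s * g x) \<le> 2 * (f x * f x + g x * g x)"
        using gen[of "f x" "s * g x"] by (simp only:)
      then show "?i x *\<^sub>R ((f x + s * g x) * (f x + s * g x)) \<le> 2 * (?i x *\<^sub>R (f x * f x) + ?i x *\<^sub>R (g x * g x))"
        by (auto simp: indicator_def)
    qed
    also have "\<dots> = 2 * (surf_energy T f + surf_energy T g)" unfolding surf_energy_def set_lebesgue_integral_def using I by simp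
    finally show ?thesis .
  qed
  have "(\<Sum>T\<in>ex_elements \<T> \<Omega>1. grad_energy T (\<lambda>x. f x + s * g x)) \<le> (\<Sum>T\<in>ex_elements \<T> \<Omega>1. 2 * (grad_energy T f + grad_energy T g))"
    by (intro sum_mono 1 ex_sub)
  moreover have "(\<Sum>T\<in>cut_elements \<T> \<Omega>1. inverse (diameter T) * surf_energy T (\<lambda>x. f x + s * g x)) \<le>
      (\<Sum>T\<in>cut_elements \<T> \<Omega>1. inverse (diameter T) * (2 * (surf_energy T f + surf_energy T g)))"
    using diameter_pos cut_sub by (intro sum_mono mult_left_mono 2) (auto simp: less_imp_le)
  then have "\<gamma> * (\<Sum>T\<in>cut_elements \<T> \<Omega>1. inverse (diameter T) * surf_energy T (\<lambda>x. f x + s * g x)) \<le>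
      \<gamma> * (\<Sum>T\<in>cut_elements \<T> \<Omega>1. inverse (diameter T) * (2 * (surf_energy T f + surf_energy T g)))"
    using pos by (intro mult_left_mono) auto
  ultimately have "b_energy (\<lambda>x. f x + s * g x) \<le> (\<Sum>T\<in>ex_elements \<T> \<Omega>1. 2 * (grad_energy T f + grad_energy T g)) +
     \<gamma> * (\<Sum>T\<in>cut_elements \<T> \<Omega>1. inverse (diameter T) * (2 * (surf_energy T f + surf_energy T g)))" unfolding b_energy_def by (rule add_mono)
  also have "\<dots> = 2 * (b_energy f + b_energy g)"
    by (simp add: b_energy_def sum_distrib_left distrib_left sum.distrib mult_ac)
  finally show ?thesis .
qed

text \<open>The oscillation estimate with \<open>dist a b \<le> diameter T\<close> and
  \<open>diameter T \<le> \<sigma> * r\<close>; two powers of the diameter cancel.\<close>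

lemma elem_oscillation:
  assumes f: "piecewise_poly f" and T: "T \<in> \<T>" and ab: "a \<in> T" "b \<in> T"
  shows "(f a - f b)\<^sup>2 * diameter T ^ (DIM('a) - 2) \<le> Co * \<sigma> ^ DIM('a) * grad_energy T f"
proof -
  obtain p g where p: "\<And>x. x \<in> T \<Longrightarrow> f x = p x" "\<And>x. (p has_derivative (\<lambda>h. g x \<bullet> h)) (at x)"
    "\<And>b. b \<in> Basis \<Longrightarrow> (\<lambda>x. g x \<bullet> b) \<in> polynomials k" "grad_energy T f = (LINT x:T|lborel. (norm (g x))\<^sup>2)"
    by (rule piecewise_poly_elem[OF f T]) (rule that)
  obtain x0 r where b: "r > 0" "cball x0 r \<subseteq> T" "diameter T \<le> \<sigma> * r" by (rule inball[OF T])
  let ?h = "diameter T"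
  have h: "?h > 0" by (rule diameter_pos[OF T])
  have dS: "DIM('a) = 2 + (DIM('a) - 2)" using dim by simp
  have "(f a - f b)\<^sup>2 * ?h ^ DIM('a) \<le> (f a - f b)\<^sup>2 * (\<sigma> * r) ^ DIM('a)"
    using h b by (intro mult_left_mono power_mono) auto
  also have "\<dots> = \<sigma> ^ DIM('a) * ((p a - p b)\<^sup>2 * r ^ DIM('a))" using p(1) ab by (simp add: power_mult_distrib)
  also have "\<dots> \<le> \<sigma> ^ DIM('a) * (Co * (dist a b)\<^sup>2 * grad_energy T f)"
    unfolding p(4) using \<sigma> by (intro mult_left_mono osc[OF elem_convex[OF T] elem_compact[OF T] b(2,1) p(2,3) ab]) auto
  also have "\<dots> \<le> \<sigma> ^ DIM('a) * (Co * ?h\<^sup>2 * grad_energy T f)"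
    using \<sigma> pos grad_energy_nonneg[of T f] dist_le_diameter[OF T ab] by (intro mult_left_mono mult_right_mono power_mono) auto
  finally have "((f a - f b)\<^sup>2 * ?h ^ (DIM('a) - 2)) * ?h\<^sup>2 \<le> (Co * \<sigma> ^ DIM('a) * grad_energy T f) * ?h\<^sup>2"
    by (subst (asm) dS) (simp add: power_add power2_eq_square mult_ac)
  then show ?thesis using h by simp
qed

text \<open>A common vertex does not bound the relative size, since the star may have several
  clusters, so the size is restricted separately. The bound lets \<open>inverse (diameter T)\<close>
  be replaced by the weight of \<open>T'\<close>.\<close>

definition patch :: "'a set \<Rightarrow> 'a set set" where
  "patch T = {T'\<in>cut_elements \<T> \<Omega>1. (\<exists>v. v \<in> verts T \<and> v \<in> verts T') \<and> diameter T' \<le> size_ratio * diameter T}"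

lemma finite_patch: "finite (patch T)" using fin_cut by (simp add: patch_def)

text \<open>With \<open>\<rho> = radius_const * diameter T\<close> the first entry yields the size
  condition of \<open>frontier_patch\<close>. The second yields \<open>4 * \<rho> < r0\<close>,
  because \<open>H\<close> bounds all diameters.\<close>

definition radius_const :: real where "radius_const = min (1 / (8 * (real DIM('a) + 1) * size_ratio * \<sigma>)) (r0 / (8 * H))"

lemma r0_pos: "r0 > 0" using cone by (simp add: uniform_cone_def)

lemma radius_const_pos: "radius_const > 0"
  using size_ratio_ge_1 \<sigma> r0_pos pos unfolding radius_const_def by (simp add: add_pos_pos)

text \<open>The first term stems from two oscillations, on \<open>T\<close> and on
  \<open>T'\<close>, each with the factor 3 from squaring a sum of three terms and with powers of
  \<open>size_ratio\<close> from rescaling. The second stems from division by the measure of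
  \<Gamma> in the ball.\<close>

definition poincare_const :: real where
  "poincare_const = 6 * size_ratio ^ DIM('a) * (Co * \<sigma> ^ DIM('a)) + 3 * size_ratio / (cl * radius_const ^ (DIM('a) - 1))"

lemma poincare_const_pos: "poincare_const > 0"
  using size_ratio_ge_1 \<sigma> pos radius_const_pos unfolding poincare_const_def by (intro add_pos_pos) auto

text \<open>Poincare-type estimate: near a cut element the boundary has measure at least a multiple of
  \<open>h\<^sup>d\<^sup>-\<^sup>1\<close>, and all cut elements met there share a vertex \<open>v\<close> with \<open>T\<close>. Hence the value at \<open>j\<close> is
  compared with the values on the boundary through the value at \<open>v\<close>.\<close>

lemma nodal_value_bound:
  assumes U: "piecewise_poly U" and T: "T \<in> cut_elements \<T> \<Omega>1" and j: "j \<in> T"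
  shows "(U j)\<^sup>2 * diameter T ^ (DIM('a) - 2) \<le> poincare_const * (\<Sum>T'\<in>patch T. grad_energy T' U + inverse (diameter T') * surf_energy T' U)"
proof -
  let ?h = "diameter T" let ?d = "DIM('a)"
  have TT: "T \<in> \<T>" by (rule cut_sub[OF T])
  have h: "?h > 0" "?h \<le> H" using diameter_pos[OF TT] H[OF TT] by auto
  obtain x where x: "x \<in> interior T" "x \<in> frontier \<Omega>1" using T by (auto simp: cut_elements_def)
  then have xT: "x \<in> T" using interior_subset by blast
  define \<rho> where "\<rho> = radius_const * ?h"
  have \<rho>: "\<rho> > 0" using radius_const_pos h by (simp add: \<rho>_def)
  have "radius_const * ?h \<le> r0 / (8 * H) * H" using radius_const_pos h r0_pos pos by (intro mult_mono) (auto simp: radius_const_def)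
  then have \<rho>4: "4 * \<rho> < r0" using r0_pos pos by (simp add: \<rho>_def)
  have p8: "8 * (real ?d + 1) * size_ratio * \<sigma> > 0" using size_ratio_ge_1 \<sigma> by (simp add: add_pos_pos)
  have "8 * (real ?d + 1) * size_ratio * \<sigma> * radius_const \<le> 8 * (real ?d + 1) * size_ratio * \<sigma> * (1 / (8 * (real ?d + 1) * size_ratio * \<sigma>))"
    using p8 by (intro mult_left_mono) (auto simp: radius_const_def)
  also have "\<dots> = 1" unfolding times_divide_eq_right mult_1_right using p8 by (intro divide_self) (rule less_imp_neq[symmetric])
  finally have "8 * (real ?d + 1) * size_ratio * \<sigma> * radius_const * ?h \<le> 1 * ?h" using h by (intro mult_right_mono) auto
  then have \<rho>8: "8 * (real ?d + 1) * size_ratio * \<sigma> * \<rho> \<le> ?h" by (simp add: \<rho>_def mult_ac)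
  obtain v where v: "v \<in> verts T" and pv: "\<And>y S. y \<in> frontier \<Omega>1 \<Longrightarrow> dist x y < \<rho> \<Longrightarrow> S \<in> \<T> \<Longrightarrow> y \<in> S \<Longrightarrow>
       v \<in> verts S \<and> diameter T \<le> size_ratio * diameter S \<and> diameter S \<le> size_ratio * diameter T"
    by (rule frontier_patch[OF TT xT x(2) \<rho> \<rho>4 \<rho>8]) (rule that)
  have vT: "v \<in> T" using v verts_subset[OF full[OF TT]] by blast
  have Tp: "T \<in> patch T" using T v size_ratio_ge_1 h mult_right_mono[of 1 size_ratio ?h] by (auto simp: patch_def)
  define EE where "EE = (\<Sum>T'\<in>patch T. grad_energy T' U)"
  define SS where "SS = (\<Sum>T'\<in>patch T. surf_energy T' U)"
  have EE: "grad_energy T' U \<le> EE" if "T' \<in> patch T" for T'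
    unfolding EE_def using member_le_sum[OF that, of "\<lambda>T'. grad_energy T' U"] grad_energy_nonneg finite_patch by simp
  let ?C = "Co * \<sigma> ^ ?d"
  have C0: "?C > 0" using pos \<sigma> by simp
  \<comment> \<open>The part of the nodal value that oscillations do not account for. It is a lower
    bound for \<open>3 * ?h ^ (?d - 2) * (U y)\<^sup>2\<close> at every \<open>y\<close> of \<Gamma>
    in the ball, and integration over that set gives the claim if \<open>K\<close> is
    positive.\<close>
  define K where "K = (U j)\<^sup>2 * ?h ^ (?d - 2) - 6 * size_ratio ^ ?d * ?C * EE"
  let ?\<Gamma> = "frontier \<Omega>1 \<inter> ball x \<rho>"
  have ty: "\<exists>T'\<in>patch T. y \<in> T' \<and> ?h \<le> size_ratio * diameter T'" if y: "y \<in> ?\<Gamma>" for y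
  proof -
    obtain T' where T': "T' \<in> cut_elements \<T> \<Omega>1" "y \<in> T'" using cut_elements_cover_frontier[of y] y by blast
    then show ?thesis using pv[of y T'] y v cut_sub[OF T'(1)] by (auto simp: patch_def)
  qed
  have pw: "K \<le> 3 * ?h ^ (?d - 2) * (U y * U y)" if y: "y \<in> ?\<Gamma>" for y
  proof -
    obtain T' where T': "T' \<in> patch T" "y \<in> T'" "?h \<le> size_ratio * diameter T'" using ty[OF y] by blast
    have TT': "T' \<in> \<T>" using T' cut_sub by (auto simp: patch_def)
    have vT': "v \<in> T'" using pv[of y T'] y T' TT' verts_subset[OF full[OF TT']] by auto
    have cge: "1 \<le> size_ratio ^ n" for n using size_ratio_ge_1 by simp
    have "(U j - U v)\<^sup>2 * ?h ^ (?d - 2) \<le> ?C * grad_energy T U" by (rule elem_oscillation[OF U TT j vT])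
    also have "\<dots> \<le> ?C * EE" using C0 by (intro mult_left_mono EE[OF Tp]) simp
    also have "\<dots> \<le> size_ratio ^ ?d * (?C * EE)"
      using mult_right_mono[OF cge[of ?d], of "?C * EE"] C0 grad_energy_nonneg[of T U] EE[OF Tp] by simp
    finally have a1: "(U j - U v)\<^sup>2 * ?h ^ (?d - 2) \<le> size_ratio ^ ?d * (?C * EE)" .
    have "(U v - U y)\<^sup>2 * ?h ^ (?d - 2) \<le> (U v - U y)\<^sup>2 * (size_ratio * diameter T') ^ (?d - 2)"
      using h T' by (intro mult_left_mono power_mono) auto
    also have "\<dots> = size_ratio ^ (?d - 2) * ((U v - U y)\<^sup>2 * diameter T' ^ (?d - 2))" by (simp add: power_mult_distrib)
    also have "\<dots> \<le> size_ratio ^ ?d * (?C * grad_energy T' U)"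
      using size_ratio_ge_1 diameter_pos[OF TT'] by (intro mult_mono elem_oscillation[OF U TT' vT' T'(2)] power_increasing) auto
    also have "\<dots> \<le> size_ratio ^ ?d * (?C * EE)" using C0 size_ratio_ge_1 by (intro mult_left_mono EE[OF T'(1)]) auto
    finally have a2: "(U v - U y)\<^sup>2 * ?h ^ (?d - 2) \<le> size_ratio ^ ?d * (?C * EE)" .
    have "(U j)\<^sup>2 \<le> 3 * ((U j - U v)\<^sup>2 + (U v - U y)\<^sup>2 + (U y)\<^sup>2)"
    proof -
      have "(a + b + c)\<^sup>2 \<le> 3 * (a\<^sup>2 + b\<^sup>2 + c\<^sup>2)" for a b c :: real
      proof -
        have "0 \<le> (a - b)\<^sup>2 + (a - c)\<^sup>2 + (b - c)\<^sup>2" by simp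
        then show ?thesis by (simp add: power2_eq_square algebra_simps)
      qed
      from this[of "U j - U v" "U v - U y" "U y"] show ?thesis by simp
    qed
    then have "(U j)\<^sup>2 * ?h ^ (?d - 2) \<le> 3 * ((U j - U v)\<^sup>2 + (U v - U y)\<^sup>2 + (U y)\<^sup>2) * ?h ^ (?d - 2)"
      using h by (intro mult_right_mono) auto
    also have "\<dots> = 3 * ((U j - U v)\<^sup>2 * ?h ^ (?d - 2)) + 3 * ((U v - U y)\<^sup>2 * ?h ^ (?d - 2)) + 3 * ?h ^ (?d - 2) * (U y * U y)"
      by (simp add: algebra_simps power2_eq_square)
    also have "\<dots> \<le> 6 * (size_ratio ^ ?d * (?C * EE)) + 3 * ?h ^ (?d - 2) * (U y * U y)" using a1 a2 by linarith
    finally show ?thesis by (simp add: K_def mult_ac)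
  qed
  have SS0: "SS \<ge> 0" unfolding SS_def by (intro sum_nonneg surf_energy_nonneg)
  have main: "K * (cl * \<rho> ^ (?d - 1)) \<le> 3 * ?h ^ (?d - 2) * SS" if K: "K > 0"
  proof -
    have "ennreal K * ennreal (cl * \<rho> ^ (?d - 1)) \<le> ennreal K * emeasure surface_measure ?\<Gamma>"
      using \<rho> \<rho>4 by (intro mult_left_mono lower x) auto
    also have "\<dots> = (\<integral>\<^sup>+y. ennreal K * indicator ?\<Gamma> y \<partial>surface_measure)"
      by (rule nn_integral_cmult_indicator[symmetric]) simp
    also have "\<dots> \<le> (\<integral>\<^sup>+y. (\<Sum>T'\<in>patch T. ennreal (3 * ?h ^ (?d - 2)) * ennreal (indicator (T' \<inter> frontier \<Omega>1) y *\<^sub>R (U y * U y))) \<partial>surface_measure)"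
    proof (rule nn_integral_mono)
      fix y
      show "ennreal K * indicator ?\<Gamma> y \<le> (\<Sum>T'\<in>patch T. ennreal (3 * ?h ^ (?d - 2)) * ennreal (indicator (T' \<inter> frontier \<Omega>1) y *\<^sub>R (U y * U y)))"
      proof (cases "y \<in> ?\<Gamma>")
        case True
        obtain T' where T': "T' \<in> patch T" "y \<in> T'" using ty[OF True] by blast
        have "ennreal K \<le> ennreal (3 * ?h ^ (?d - 2) * (U y * U y))" by (rule ennreal_leI[OF pw[OF True]])
        also have "\<dots> = ennreal (3 * ?h ^ (?d - 2)) * ennreal (indicator (T' \<inter> frontier \<Omega>1) y *\<^sub>R (U y * U y))"
          using True T' h by (simp add: ennreal_mult)
        also have "\<dots> \<le> (\<Sum>T'\<in>patch T. ennreal (3 * ?h ^ (?d - 2)) * ennreal (indicator (T' \<inter> frontier \<Omega>1) y *\<^sub>R (U y * U y)))"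
          by (rule member_le_sum[OF T'(1) _ finite_patch]) simp
        finally show ?thesis using True by simp
      qed simp
    qed
    also have "\<dots> = (\<Sum>T'\<in>patch T. ennreal (3 * ?h ^ (?d - 2)) * ennreal (surf_energy T' U))"
    proof -
      have m: "(\<lambda>y. ennreal (indicator (T' \<inter> frontier \<Omega>1) y *\<^sub>R (U y * U y))) \<in> borel_measurable surface_measure" if "T' \<in> patch T" for T'
        using borel_measurable_integrable[OF surface_integrable[OF U]] that cut_sub by (auto simp: patch_def)
      have "T' \<in> \<T>" if "T' \<in> patch T" for T' using that cut_sub by (auto simp: patch_def)
      then show ?thesis
        using m by (subst nn_integral_sum) (auto intro!: sum.cong simp: nn_integral_cmult nn_surface_integral[OF U] simp del: scaleR_conv_of_real real_scaleR_def)
    qed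
    also have "\<dots> = ennreal (3 * ?h ^ (?d - 2)) * (\<Sum>T'\<in>patch T. ennreal (surf_energy T' U))" by (rule sum_distrib_left[symmetric])
    also have "(\<Sum>T'\<in>patch T. ennreal (surf_energy T' U)) = ennreal SS" unfolding SS_def by (rule sum_ennreal[OF surf_energy_nonneg])
    finally have "ennreal K * ennreal (cl * \<rho> ^ (?d - 1)) \<le> ennreal (3 * ?h ^ (?d - 2)) * ennreal SS" .
    then have "ennreal (K * (cl * \<rho> ^ (?d - 1))) \<le> ennreal (3 * ?h ^ (?d - 2) * SS)"
      using K pos \<rho> h SS0 by (simp add: ennreal_mult)
    then show ?thesis using h SS0 by (subst (asm) ennreal_le_iff) auto
  qed
  have cc: "cl * radius_const ^ (?d - 1) > 0" using pos radius_const_pos by simp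
  have Kle: "K \<le> 3 / (cl * radius_const ^ (?d - 1)) * (inverse ?h * SS)"
  proof (cases "K > 0")
    case True
    have d1: "?d - 1 = Suc (?d - 2)" using dim by simp
    have "K * (cl * \<rho> ^ (?d - 1)) = (K * (cl * radius_const ^ (?d - 1)) * ?h) * ?h ^ (?d - 2)"
    proof -
      have "?h ^ (?d - 1) = ?h * ?h ^ (?d - 2)" by (subst d1) (rule power_Suc)
      then show ?thesis unfolding \<rho>_def power_mult_distrib by (simp only: mult_ac)
    qed
    then have "(K * (cl * radius_const ^ (?d - 1)) * ?h) * ?h ^ (?d - 2) \<le> (3 * SS) * ?h ^ (?d - 2)"
      using main[OF True] by (simp only: mult_ac)
    then have "K * (cl * radius_const ^ (?d - 1)) * ?h \<le> 3 * SS" using h by simp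
    then have "K * ((cl * radius_const ^ (?d - 1)) * ?h) \<le> 3 * SS" by (simp only: mult.assoc)
    then have "K \<le> 3 * SS / ((cl * radius_const ^ (?d - 1)) * ?h)" using cc h by (simp only: pos_le_divide_eq mult_pos_pos)
    also have "\<dots> = 3 / (cl * radius_const ^ (?d - 1)) * (inverse ?h * SS)" by (simp add: divide_inverse mult_ac)
    finally show ?thesis .
  next
    case False
    have "0 \<le> 3 / (cl * radius_const ^ (?d - 1)) * (inverse ?h * SS)" using cc h SS0 by (intro mult_nonneg_nonneg) auto
    then show ?thesis using False by linarith
  qed
  have "inverse ?h * SS \<le> (\<Sum>T'\<in>patch T. size_ratio * (inverse (diameter T') * surf_energy T' U))"
    unfolding SS_def sum_distrib_left
  proof (rule sum_mono)
    fix T' assume T': "T' \<in> patch T"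
    then have h': "diameter T' > 0" "diameter T' \<le> size_ratio * ?h" using diameter_pos cut_sub by (auto simp: patch_def)
    then have "inverse ?h \<le> size_ratio * inverse (diameter T')" using h by (simp add: field_simps)
    then show "inverse ?h * surf_energy T' U \<le> size_ratio * (inverse (diameter T') * surf_energy T' U)"
      using mult_right_mono[of "inverse ?h" "size_ratio * inverse (diameter T')" "surf_energy T' U"] surf_energy_nonneg[of T' U] by (simp only: mult.assoc)
  qed
  then have "3 / (cl * radius_const ^ (?d - 1)) * (inverse ?h * SS) \<le> 3 / (cl * radius_const ^ (?d - 1)) * (\<Sum>T'\<in>patch T. size_ratio * (inverse (diameter T') * surf_energy T' U))"
    using cc by (intro mult_left_mono) auto
  with Kle have Kle2: "K \<le> 3 / (cl * radius_const ^ (?d - 1)) * (\<Sum>T'\<in>patch T. size_ratio * (inverse (diameter T') * surf_energy T' U))"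
    by (rule order_trans)
  define Q where "Q = (\<Sum>T'\<in>patch T. inverse (diameter T') * surf_energy T' U)"
  have Q0: "Q \<ge> 0" unfolding Q_def
    using diameter_pos cut_sub surf_energy_nonneg by (intro sum_nonneg mult_nonneg_nonneg) (auto simp: patch_def less_imp_le)
  have E0: "EE \<ge> 0" unfolding EE_def by (intro sum_nonneg grad_energy_nonneg)
  have "K \<le> 3 * size_ratio / (cl * radius_const ^ (?d - 1)) * Q"
    using Kle2 unfolding sum_distrib_left[symmetric] Q_def[symmetric] by (simp add: mult_ac)
  then have "(U j)\<^sup>2 * ?h ^ (?d - 2) \<le> 6 * size_ratio ^ ?d * ?C * EE + 3 * size_ratio / (cl * radius_const ^ (?d - 1)) * Q"
    by (simp add: K_def)
  also have "\<dots> \<le> poincare_const * EE + poincare_const * Q"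
    using E0 Q0 cc C0 size_ratio_ge_1 by (intro add_mono mult_right_mono) (auto simp: poincare_const_def)
  also have "\<dots> = poincare_const * (\<Sum>T'\<in>patch T. grad_energy T' U + inverse (diameter T') * surf_energy T' U)"
    by (simp add: EE_def Q_def sum.distrib distrib_left)
  finally show ?thesis .
qed

text \<open>After exchanging the sums, \<open>T'\<close> is counted once for each \<open>T\<close>
  whose patch contains it. Such \<open>T\<close> lie in the stars of the \<open>DIM('a) + 1\<close>
  vertices of \<open>T'\<close>, each with at most \<open>\<sigma> ^ DIM('a)\<close>
  elements.\<close>

lemma patch_overlap:
  assumes a: "\<And>T. T \<in> cut_elements \<T> \<Omega>1 \<Longrightarrow> a T \<ge> 0"
  shows "(\<Sum>T\<in>ex_elements \<T> \<Omega>1. \<Sum>T'\<in>patch T. a T') \<le> (real DIM('a) + 1) * \<sigma> ^ DIM('a) * (\<Sum>T\<in>cut_elements \<T> \<Omega>1. a T)"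
proof -
  let ?X = "ex_elements \<T> \<Omega>1" let ?Y = "cut_elements \<T> \<Omega>1"
  have "(\<Sum>T\<in>?X. \<Sum>T'\<in>patch T. a T') = (\<Sum>T\<in>?X. \<Sum>T'\<in>?Y. if T' \<in> patch T then a T' else 0)"
    by (intro sum.cong refl sum.mono_neutral_cong_left fin_cut) (auto simp: patch_def)
  also have "\<dots> = (\<Sum>T'\<in>?Y. \<Sum>T\<in>?X. if T' \<in> patch T then a T' else 0)" by (rule sum.swap)
  also have "\<dots> \<le> (\<Sum>T'\<in>?Y. (real DIM('a) + 1) * \<sigma> ^ DIM('a) * a T')"
  proof (rule sum_mono)
    fix T' assume T': "T' \<in> ?Y"
    have TT': "T' \<in> \<T>" by (rule cut_sub[OF T'])
    have "{T\<in>?X. T' \<in> patch T} \<subseteq> (\<Union>v\<in>verts T'. star v)" using ex_sub by (auto simp: patch_def star_def)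
    then have "card {T\<in>?X. T' \<in> patch T} \<le> card (\<Union>v\<in>verts T'. star v)"
      using finite_verts[OF TT'] finite_star by (intro card_mono) auto
    also have "\<dots> \<le> (\<Sum>v\<in>verts T'. card (star v))" by (rule card_UN_le[OF finite_verts[OF TT']])
    finally have "real (card {T\<in>?X. T' \<in> patch T}) \<le> (\<Sum>v\<in>verts T'. real (card (star v)))"
      by (metis of_nat_mono of_nat_sum)
    also have "\<dots> \<le> (\<Sum>v\<in>verts T'. \<sigma> ^ DIM('a))" by (intro sum_mono card_star)
    also have "\<dots> = (real DIM('a) + 1) * \<sigma> ^ DIM('a)" using full_simplex_verts(3)[OF full[OF TT']] by simp
    finally have *: "real (card {T\<in>?X. T' \<in> patch T}) \<le> (real DIM('a) + 1) * \<sigma> ^ DIM('a)" .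
    have "(\<Sum>T\<in>?X. if T' \<in> patch T then a T' else 0) = (\<Sum>T\<in>{T\<in>?X. T' \<in> patch T}. a T')"
      using fin_ex by (intro sum.mono_neutral_cong_right) auto
    also have "\<dots> = real (card {T\<in>?X. T' \<in> patch T}) * a T'" by simp
    also have "\<dots> \<le> (real DIM('a) + 1) * \<sigma> ^ DIM('a) * a T'" by (rule mult_right_mono[OF * a[OF T']])
    finally show "(\<Sum>T\<in>?X. if T' \<in> patch T then a T' else 0) \<le> (real DIM('a) + 1) * \<sigma> ^ DIM('a) * a T'" .
  qed
  finally show ?thesis by (simp add: sum_distrib_left)
qed

section \<open>Assembling the splitting estimate\<close>

lemma piecewise_poly_nodal:
  assumes "J \<subseteq> I0 k \<Omega> \<T>"
  shows "piecewise_poly (\<lambda>x. \<Sum>j\<in>J. c j * node_basis k j x)"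
  unfolding piecewise_poly_def
proof
  fix T assume T: "T \<in> \<T>"
  have "\<forall>j\<in>J. \<exists>p. p \<in> polynomials k \<and> (\<forall>x\<in>T. node_basis k j x = p x)"
  proof
    fix j assume "j \<in> J"
    then have "j \<in> mesh_nodes k \<T>" using assms by (auto simp: I0_def)
    from node_basis_polynomial[OF this k T] show "\<exists>p. p \<in> polynomials k \<and> (\<forall>x\<in>T. node_basis k j x = p x)" by blast
  qed
  from bchoice[OF this] obtain p where p: "\<forall>j\<in>J. p j \<in> polynomials k \<and> (\<forall>x\<in>T. node_basis k j x = p j x)" by (rule exE)
  show "\<exists>q\<in>polynomials k. \<forall>x\<in>T. (\<Sum>j\<in>J. c j * node_basis k j x) = q x"
    by (rule bexI[of _ "\<lambda>x. \<Sum>j\<in>J. c j * p j x"]) (use p in \<open>auto intro!: polynomials_sum polynomials_cmult\<close>)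
qed

definition nodal_const :: real where "nodal_const = real (Suc k ^ Suc DIM('a)) * real k ^ Suc k"

text \<open>The factors bound, in turn, the energy of a nodal combination by its coefficients, the
  coefficients by patch energies with their overlap, and the unweighted energies by
  \<open>b_energy\<close>.\<close>

definition splitting_const :: real where
  "splitting_const = (nodal_const\<^sup>2 * \<sigma>\<^sup>2 * unit_ball_vol (real DIM('a)) + \<gamma> * (nodal_const\<^sup>2 * Cu)) * (poincare_const * ((real DIM('a) + 1) * \<sigma> ^ DIM('a))) * (1 + 1 / \<gamma>)"

lemma splitting_const_pos: "splitting_const > 0"
proof -
  have "nodal_const > 0" unfolding nodal_const_def using k by (intro mult_pos_pos zero_less_power) (auto simp del: of_nat_power power_Suc)
  then show ?thesis
    using \<sigma> pos poincare_const_pos unfolding splitting_const_def by (intro mult_pos_pos add_pos_pos) auto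
qed

text \<open>The coefficient of an exterior node \<open>j\<close> is \<open>U j\<close>, so the
  energies of \<open>W\<close> on \<open>T\<close> scale like
  \<open>(M T)\<^sup>2 * diameter T ^ (DIM('a) - 2)\<close>. If \<open>M T\<close> is nonzero and
  \<open>T\<close> meets \<open>\<Omega>1\<close>, then \<open>T\<close> is cut and
  \<open>nodal_value_bound\<close> applies.\<close>

lemma exterior_part_bound:
  assumes J: "J \<subseteq> I0 k \<Omega> \<T>" and J2: "J2 \<subseteq> J" "\<And>j. j \<in> J2 \<Longrightarrow> j \<notin> \<Omega>1"
  shows "b_energy (\<lambda>x. \<Sum>j\<in>J2. c j * node_basis k j x) \<le> splitting_const * b_energy (\<lambda>x. \<Sum>j\<in>J. c j * node_basis k j x)"
proof -
  let ?d = "DIM('a)" let ?X = "ex_elements \<T> \<Omega>1" let ?Y = "cut_elements \<T> \<Omega>1"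
  define U where "U = (\<lambda>x. \<Sum>j\<in>J. c j * node_basis k j x)"
  define W where "W = (\<lambda>x. \<Sum>j\<in>J2. c j * node_basis k j x)"
  have J20: "J2 \<subseteq> I0 k \<Omega> \<T>" using J J2 by blast
  have fJ: "finite J" "finite J2" using finite_subset[OF _ finite_I0[OF k]] J J20 by auto
  have U: "piecewise_poly U" and W: "piecewise_poly W" unfolding U_def W_def by (rule piecewise_poly_nodal[OF J], rule piecewise_poly_nodal[OF J20])
  have Uj: "U j = c j" if j: "j \<in> J" for j
  proof -
    have "U j = (\<Sum>i\<in>J. if i = j then c j else 0)" unfolding U_def
      using j J by (intro sum.cong refl) (auto simp: node_basis_kronecker[OF _ _ k] I0_def subset_iff)
    then show ?thesis using fJ j by simp
  qed
  \<comment> \<open>The value 0 is for elements without exterior nodes, where \<open>W\<close>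
    vanishes.\<close>
  define M where "M T = Max (insert 0 ((\<lambda>j. \<bar>c j\<bar>) ` (J2 \<inter> T)))" for T
  have M0: "M T \<ge> 0" and Mj: "\<And>j. j \<in> J2 \<Longrightarrow> j \<in> T \<Longrightarrow> \<bar>c j\<bar> \<le> M T" for T
    unfolding M_def using fJ by (auto intro!: Max_ge)
  have MU: "(M T)\<^sup>2 * diameter T ^ (?d - 2) \<le> poincare_const * (\<Sum>T'\<in>patch T. grad_energy T' U + inverse (diameter T') * surf_energy T' U)"
    (is "_ \<le> ?R T") if T: "T \<in> ?X" for T
  proof (cases "M T = 0")
    case True
    have "0 \<le> ?R T" using poincare_const_pos grad_energy_nonneg surf_energy_nonneg diameter_pos cut_sub
      by (intro mult_nonneg_nonneg sum_nonneg add_nonneg_nonneg) (auto simp: patch_def less_imp_le)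
    then show ?thesis using True by simp
  next
    case False
    have "M T \<in> insert 0 ((\<lambda>j. \<bar>c j\<bar>) ` (J2 \<inter> T))" unfolding M_def using fJ by (intro Max_in) auto
    then obtain j where j: "j \<in> J2" "j \<in> T" "M T = \<bar>c j\<bar>" using False by auto
    have "T \<in> ?Y" using ex_elem_exterior_node[OF T _ j(2) J2(2)[OF j(1)]] J20 j by (auto simp: I0_def)
    from nodal_value_bound[OF U this j(2)] show ?thesis using Uj[of j] j J2 by auto
  qed
  have EW: "grad_energy T W \<le> nodal_const\<^sup>2 * \<sigma>\<^sup>2 * unit_ball_vol (real ?d) * ((M T)\<^sup>2 * diameter T ^ (?d - 2))" if T: "T \<in> \<T>" for T
  proof -
    obtain x0 r where b: "r > 0" "cball x0 r \<subseteq> T" "diameter T \<le> \<sigma> * r" by (rule inball[OF T])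
    have h: "diameter T > 0" by (rule diameter_pos[OF T])
    have K0: "nodal_const * M T \<ge> 0" using M0 by (simp add: nodal_const_def)
    have "grad_energy T W \<le> (nodal_const * M T * \<sigma> / diameter T)\<^sup>2 * (unit_ball_vol (real ?d) * diameter T ^ ?d)"
    proof (rule grad_energy_bound[OF W T])
      fix x y assume xy: "x \<in> T" "y \<in> T"
      have "\<bar>W x - W y\<bar> \<le> nodal_const * M T * dist x y / r"
        unfolding W_def nodal_const_def by (rule nodal_combination_bounds(2)[OF T k J20 Mj M0 xy(1) xy(2) b(2,1)])
      also have "\<dots> = nodal_const * M T * dist x y * (1 / r)" by simp
      also have "\<dots> \<le> nodal_const * M T * dist x y * (\<sigma> / diameter T)"
        using b h mult_nonneg_nonneg[OF K0 zero_le_dist[of x y]] by (intro mult_left_mono) (auto simp: field_simps)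
      finally show "\<bar>W x - W y\<bar> \<le> nodal_const * M T * \<sigma> / diameter T * dist x y" by (simp add: mult_ac)
    qed (use K0 \<sigma> h in simp)
    also have "\<dots> = nodal_const\<^sup>2 * \<sigma>\<^sup>2 * unit_ball_vol (real ?d) * ((M T)\<^sup>2 * diameter T ^ (?d - 2))"
    proof -
      have "diameter T ^ ?d = (diameter T)\<^sup>2 * diameter T ^ (?d - 2)" by (metis power_add le_add_diff_inverse dim)
      then show ?thesis using h by (simp add: power_divide power_mult_distrib)
    qed
    finally show ?thesis .
  qed
  have SW: "inverse (diameter T) * surf_energy T W \<le> nodal_const\<^sup>2 * Cu * ((M T)\<^sup>2 * diameter T ^ (?d - 2))" if T: "T \<in> \<T>" for T
  proof -
    have h: "diameter T > 0" by (rule diameter_pos[OF T])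
    have "surf_energy T W \<le> (nodal_const * M T)\<^sup>2 * (Cu * diameter T ^ (?d - 1))"
    proof (rule surf_energy_bound[OF W T])
      show "\<bar>W x\<bar> \<le> nodal_const * M T" if "x \<in> T" for x
        unfolding W_def nodal_const_def by (rule nodal_combination_bounds(1)[OF T k J20 Mj M0 that])
      show "0 \<le> nodal_const * M T" using M0 by (simp add: nodal_const_def)
    qed
    then have "inverse (diameter T) * surf_energy T W \<le> inverse (diameter T) * ((nodal_const * M T)\<^sup>2 * (Cu * diameter T ^ (?d - 1)))"
      using h by (intro mult_left_mono) auto
    also have "\<dots> = nodal_const\<^sup>2 * Cu * ((M T)\<^sup>2 * diameter T ^ (?d - 2))"
    proof -
      have "?d - 1 = Suc (?d - 2)" using dim by simp
      then have "diameter T ^ (?d - 1) = diameter T * diameter T ^ (?d - 2)" by (simp only: power_Suc)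
      then show ?thesis using h by (simp add: power_mult_distrib)
    qed
    finally show ?thesis .
  qed
  define A where "A = nodal_const\<^sup>2 * \<sigma>\<^sup>2 * unit_ball_vol (real ?d)"
  define A' where "A' = nodal_const\<^sup>2 * Cu"
  define m where "m T = (M T)\<^sup>2 * diameter T ^ (?d - 2)" for T
  have m0: "T \<in> \<T> \<Longrightarrow> m T \<ge> 0" for T using diameter_pos[of T] by (simp add: m_def)
  have A0: "A \<ge> 0" "A' \<ge> 0" using pos by (auto simp: A_def A'_def)
  define Q where "Q = (\<Sum>T\<in>?Y. grad_energy T U + inverse (diameter T) * surf_energy T U)"
  have "b_energy W \<le> (\<Sum>T\<in>?X. A * m T) + \<gamma> * (\<Sum>T\<in>?Y. A' * m T)"
    unfolding b_energy_def A_def A'_def m_def using pos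
    by (intro add_mono mult_left_mono sum_mono EW SW ex_sub cut_sub) auto
  also have "(\<Sum>T\<in>?Y. A' * m T) \<le> (\<Sum>T\<in>?X. A' * m T)"
    using A0 m0 ex_sub by (intro sum_mono2 fin_ex cut_subset_ex) auto
  then have "(\<Sum>T\<in>?X. A * m T) + \<gamma> * (\<Sum>T\<in>?Y. A' * m T) \<le> (\<Sum>T\<in>?X. A * m T) + \<gamma> * (\<Sum>T\<in>?X. A' * m T)"
    using pos by simp
  also have "\<dots> = (A + \<gamma> * A') * (\<Sum>T\<in>?X. m T)" by (simp add: sum_distrib_left[symmetric] algebra_simps)
  also have "\<dots> \<le> (A + \<gamma> * A') * (\<Sum>T\<in>?X. poincare_const * (\<Sum>T'\<in>patch T. grad_energy T' U + inverse (diameter T') * surf_energy T' U))"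
    using A0 pos by (intro mult_left_mono sum_mono) (auto simp: m_def MU)
  also have "\<dots> = (A + \<gamma> * A') * (poincare_const * (\<Sum>T\<in>?X. \<Sum>T'\<in>patch T. grad_energy T' U + inverse (diameter T') * surf_energy T' U))"
    by (simp only: sum_distrib_left)
  also have "\<dots> \<le> (A + \<gamma> * A') * (poincare_const * ((real ?d + 1) * \<sigma> ^ ?d * Q))"
  proof -
    have "grad_energy T U + inverse (diameter T) * surf_energy T U \<ge> 0" if "T \<in> ?Y" for T
      using grad_energy_nonneg surf_energy_nonneg diameter_pos[OF cut_sub[OF that]] by (intro add_nonneg_nonneg mult_nonneg_nonneg) auto
    from patch_overlap[of "\<lambda>T. grad_energy T U + inverse (diameter T) * surf_energy T U", OF this]
    show ?thesis unfolding Q_def using A0 pos poincare_const_pos by (intro mult_left_mono) auto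
  qed
  also have "\<dots> \<le> (A + \<gamma> * A') * (poincare_const * ((real ?d + 1) * \<sigma> ^ ?d * ((1 + 1 / \<gamma>) * b_energy U)))"
  proof -
    define e where "e = (\<Sum>T\<in>?X. grad_energy T U)"
    define s where "s = (\<Sum>T\<in>?Y. inverse (diameter T) * surf_energy T U)"
    have e0: "e \<ge> 0" unfolding e_def by (intro sum_nonneg grad_energy_nonneg)
    have s0: "s \<ge> 0" unfolding s_def
      using surf_energy_nonneg diameter_pos cut_sub by (intro sum_nonneg mult_nonneg_nonneg) (auto simp: less_imp_le)
    have "(\<Sum>T\<in>?Y. grad_energy T U) \<le> e" unfolding e_def using grad_energy_nonneg by (intro sum_mono2 fin_ex cut_subset_ex) auto
    then have "Q \<le> e + s" unfolding Q_def s_def sum.distrib by simp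
    \<comment> \<open>The added terms complete \<open>e + s\<close> to the product of
      \<open>1 + 1 / \<gamma>\<close> and \<open>e + \<gamma> * s\<close>, so one constant works for
      large and small \<open>\<gamma>\<close>.\<close>
    also have "e + s \<le> (e + s) + (e / \<gamma> + \<gamma> * s)" using e0 s0 pos by simp
    also have "\<dots> = (1 + 1 / \<gamma>) * b_energy U"
      unfolding b_energy_def e_def[symmetric] s_def[symmetric] using pos by (simp add: field_simps)
    finally show ?thesis using A0 pos poincare_const_pos \<sigma> by (intro mult_left_mono) (auto intro!: mult_nonneg_nonneg)
  qed
  also have "\<dots> = splitting_const * b_energy U" by (simp add: splitting_const_def A_def A'_def mult_ac)
  finally show ?thesis by (simp add: U_def W_def)
qed

text \<open>With \<open>Z = U - W\<close> the energy of \<open>Z\<close> is at most twice the sum of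
  those of \<open>U\<close> and \<open>W\<close>. Adding the energy of \<open>W\<close> once more
  gives \<open>2 + 3 * splitting_const\<close>.\<close>

lemma splitting_estimates:
  assumes um: "um \<in> V1_minus k \<Omega> \<T> \<Omega>1" and uG: "uG \<in> V1_Gamma k \<Omega> \<T> \<Omega>1"
  shows "norm_b_sq \<gamma> \<T> \<Omega>1 (um, \<lambda>_. 0) + norm_b_sq \<gamma> \<T> \<Omega>1 (\<lambda>_. 0, uG) \<le> (2 + 3 * splitting_const) * norm_b_sq \<gamma> \<T> \<Omega>1 (um, uG)"
    "norm_b_sq \<gamma> \<T> \<Omega>1 (um, uG) \<le> 2 * (norm_b_sq \<gamma> \<T> \<Omega>1 (um, \<lambda>_. 0) + norm_b_sq \<gamma> \<T> \<Omega>1 (\<lambda>_. 0, uG))"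
proof -
  define J2 where "J2 = I1_Gamma k \<Omega> \<T> \<Omega>1"
  define J1 where "J1 = I1 k \<Omega> \<T> \<Omega>1 - J2"
  define J where "J = J1 \<union> J2"
  have J0: "J1 \<subseteq> I0 k \<Omega> \<T>" "J2 \<subseteq> I0 k \<Omega> \<T>" "J \<subseteq> I0 k \<Omega> \<T>"
    by (auto simp: J_def J1_def J2_def I1_def I1_Gamma_def I_Gamma_def)
  have J2off: "j \<notin> \<Omega>1" if "j \<in> J2" for j using that by (simp add: J2_def I1_Gamma_def)
  have fJ: "finite J1" "finite J2" using finite_subset[OF _ finite_I0[OF k]] J0 by auto
  obtain a where a: "um = (\<lambda>x. \<Sum>j\<in>J1. a j * nodal_basis k \<Omega> \<T> j x)"
    using um unfolding V1_minus_def fun_span_def J1_def J2_def by blast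
  obtain b where b: "uG = (\<lambda>x. \<Sum>j\<in>J2. b j * (if x \<in> cut_region \<T> \<Omega>1 then nodal_basis k \<Omega> \<T> j x else 0))"
    using uG unfolding V1_Gamma_def fun_span_def J2_def by blast
  \<comment> \<open>The label sets are disjoint, so the two coefficient families merge. On the
    extended region \<open>U\<close>, \<open>Z\<close> and \<open>W\<close> represent
    \<open>u\<close>, \<open>u\<^sup>-\<close> and \<open>u\<^sup>\<Gamma>\<close>.\<close>
  define c where "c j = (if j \<in> J2 then b j else a j)" for j
  define U where "U = (\<lambda>x. \<Sum>j\<in>J. c j * node_basis k j x)"
  define W where "W = (\<lambda>x. \<Sum>j\<in>J2. c j * node_basis k j x)"
  define Z where "Z = (\<lambda>x. \<Sum>j\<in>J1. c j * node_basis k j x)"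
  have U: "piecewise_poly U" and W: "piecewise_poly W" and Z: "piecewise_poly Z" unfolding U_def W_def Z_def by (intro piecewise_poly_nodal J0)+
  have UZW: "U x = Z x + W x" for x
    unfolding U_def Z_def W_def J_def by (rule sum.union_disjoint[OF fJ]) (auto simp: J1_def)
  have umZ: "um x = Z x" for x
    unfolding a Z_def using J0 by (intro sum.cong refl) (auto simp: c_def J1_def nodal_basis_eq[OF _ k] subset_iff)
  \<comment> \<open>An element of the extended region that contains a point outside the cut region
    is not cut and so has no exterior nodes. There the basis functions of \<open>J2\<close> vanish,
    in accordance with the cut-off.\<close>
  have uGW: "uG x = W x" if T: "T \<in> ex_elements \<T> \<Omega>1" and x: "x \<in> T" for T x
    unfolding b W_def
  proof (rule sum.cong[OF refl])
    fix j assume j: "j \<in> J2"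
    have eq: "nodal_basis k \<Omega> \<T> j = node_basis k j" using nodal_basis_eq[OF _ k] J0 j by blast
    have jn: "j \<in> mesh_nodes k \<T>" using J0 j by (auto simp: I0_def)
    show "b j * (if x \<in> cut_region \<T> \<Omega>1 then nodal_basis k \<Omega> \<T> j x else 0) = c j * node_basis k j x"
    proof (cases "x \<in> cut_region \<T> \<Omega>1")
      case False
      then have "T \<notin> cut_elements \<T> \<Omega>1" using x by (auto simp: cut_region_def)
      then have "j \<notin> T" using ex_elem_exterior_node[OF T jn _ J2off[OF j]] by blast
      then show ?thesis using node_basis_off[OF jn k ex_sub[OF T] x] False by simp
    qed (simp add: eq c_def j)
  qed
  have n1: "norm_b_sq \<gamma> \<T> \<Omega>1 (um, uG) = b_energy U"
    unfolding norm_b_sq_b_energy L1_def by (rule b_energy_cong) (use uGW umZ UZW in auto)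
  have n2: "norm_b_sq \<gamma> \<T> \<Omega>1 (um, \<lambda>_. 0) = b_energy Z"
    unfolding norm_b_sq_b_energy L1_def by (rule b_energy_cong) (use umZ in auto)
  have n3: "norm_b_sq \<gamma> \<T> \<Omega>1 (\<lambda>_. 0, uG) = b_energy W"
    unfolding norm_b_sq_b_energy L1_def by (rule b_energy_cong) (use uGW in auto)
  have W_le: "b_energy W \<le> splitting_const * b_energy U"
    unfolding U_def W_def by (rule exterior_part_bound[OF J0(3)]) (use J2off in \<open>auto simp: J_def\<close>)
  have "b_energy Z = b_energy (\<lambda>x. U x + (-1) * W x)" by (rule b_energy_cong) (simp add: UZW)
  also have "\<dots> \<le> 2 * (b_energy U + b_energy W)" by (rule b_energy_comb_le[OF U W]) simp
  finally have Z_le: "b_energy Z \<le> 2 * (b_energy U + b_energy W)" .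
  have "b_energy Z + b_energy W \<le> 2 * b_energy U + 3 * b_energy W" using Z_le by simp
  also have "\<dots> \<le> 2 * b_energy U + 3 * (splitting_const * b_energy U)" using W_le by simp
  finally have "b_energy Z + b_energy W \<le> 2 * b_energy U + 3 * (splitting_const * b_energy U)" .
  then show "norm_b_sq \<gamma> \<T> \<Omega>1 (um, \<lambda>_. 0) + norm_b_sq \<gamma> \<T> \<Omega>1 (\<lambda>_. 0, uG) \<le> (2 + 3 * splitting_const) * norm_b_sq \<gamma> \<T> \<Omega>1 (um, uG)"
    unfolding n1 n2 n3 by (simp add: algebra_simps)
  have "b_energy U = b_energy (\<lambda>x. Z x + 1 * W x)" by (rule b_energy_cong) (simp add: UZW)
  also have "\<dots> \<le> 2 * (b_energy Z + b_energy W)" by (rule b_energy_comb_le[OF Z W]) simp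
  finally show "norm_b_sq \<gamma> \<T> \<Omega>1 (um, uG) \<le> 2 * (norm_b_sq \<gamma> \<T> \<Omega>1 (um, \<lambda>_. 0) + norm_b_sq \<gamma> \<T> \<Omega>1 (\<lambda>_. 0, uG))"
    unfolding n1 n2 n3 .
qed

end

text \<open>Everything that enters the constant is obtained before a mesh or a position of \<Gamma>
  is fixed: the cone radius from \<open>D\<close>, the measure bounds from that radius and \<Omega>,
  the oscillation constant from \<open>k\<close>, and \<open>H\<close> from the diameter of
  \<Omega>.\<close>

lemma b_norm_splitting:
  fixes \<Omega> D :: "'a::euclidean_space set"
  assumes d: "DIM('a) \<ge> 2" and k: "k \<ge> 1" and \<Omega>: "polygonal_domain \<Omega>"
    and D: "open D" "D \<subseteq> \<Omega>" "smooth_boundary D" and \<gamma>: "\<gamma> > 0" and \<sigma>: "\<sigma> > 0"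
  obtains c where "c > 0" "\<And>\<T> \<Omega>1 um uG. admissible_configuration k \<sigma> \<Omega> D \<T> \<Omega>1 \<Longrightarrow>
      um \<in> V1_minus k \<Omega> \<T> \<Omega>1 \<Longrightarrow> uG \<in> V1_Gamma k \<Omega> \<T> \<Omega>1 \<Longrightarrow>
      norm_b_sq \<gamma> \<T> \<Omega>1 (um, \<lambda>_. 0) + norm_b_sq \<gamma> \<T> \<Omega>1 (\<lambda>_. 0, uG) \<le> c * norm_b_sq \<gamma> \<T> \<Omega>1 (um, uG) \<and>
      norm_b_sq \<gamma> \<T> \<Omega>1 (um, uG) \<le> 2 * (norm_b_sq \<gamma> \<T> \<Omega>1 (um, \<lambda>_. 0) + norm_b_sq \<gamma> \<T> \<Omega>1 (\<lambda>_. 0, uG))"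
proof -
  have \<Omega>b: "bounded \<Omega>" and \<Omega>r: "\<Omega> = interior (closure \<Omega>)" using \<Omega> by (auto simp: polygonal_domain_def)
  obtain r0 where coneD: "uniform_cone r0 D"
    using smooth_boundary_uniform_cone[OF D(1) bounded_subset[OF \<Omega>b D(2)] D(3)] by blast
  have r0: "r0 > 0" using coneD by (simp add: uniform_cone_def)
  obtain Co where Co: "Co > 0" "\<And>(T :: 'a set) x0 r p g a b. convex T \<Longrightarrow> compact T \<Longrightarrow> cball x0 r \<subseteq> T \<Longrightarrow> r > 0 \<Longrightarrow>
     (\<And>x. (p has_derivative (\<lambda>h. g x \<bullet> h)) (at x)) \<Longrightarrow> (\<And>b. b \<in> Basis \<Longrightarrow> (\<lambda>x. g x \<bullet> b) \<in> polynomials k) \<Longrightarrow>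
     a \<in> T \<Longrightarrow> b \<in> T \<Longrightarrow> (p a - p b)\<^sup>2 * r ^ DIM('a) \<le> Co * (dist a b)\<^sup>2 * (LINT y:T|lborel. (norm (g y))\<^sup>2)"
  proof (rule polynomials_oscillation[where k=k and 'a='a])
    fix C :: real assume "C > 0" "\<And>(T :: 'a set) x0 r p g a b. convex T \<Longrightarrow> compact T \<Longrightarrow> cball x0 r \<subseteq> T \<Longrightarrow> r > 0 \<Longrightarrow>
     (\<And>x. (p has_derivative (\<lambda>h. g x \<bullet> h)) (at x)) \<Longrightarrow> (\<And>b. b \<in> Basis \<Longrightarrow> (\<lambda>x. g x \<bullet> b) \<in> polynomials k) \<Longrightarrow>
     a \<in> T \<Longrightarrow> b \<in> T \<Longrightarrow> (p a - p b)\<^sup>2 * r ^ DIM('a) \<le> C * (dist a b)\<^sup>2 * (LINT y:T|lborel. (norm (g y))\<^sup>2)"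
    from that[OF this] show thesis .
  qed
  obtain Cu where Cu: "Cu > 0" "\<And>S A. uniform_cone r0 S \<Longrightarrow> open S \<Longrightarrow> S \<subseteq> \<Omega> \<Longrightarrow> compact A \<Longrightarrow> diameter A > 0 \<Longrightarrow>
    emeasure surface_measure (A \<inter> frontier S) \<le> ennreal (Cu * diameter A ^ (DIM('a) - 1))"
    by (rule surface_frontier_upper[OF d \<Omega>b r0]) (rule that)
  obtain cl where cl: "cl > 0" "\<And>(S :: 'a set) r0 x \<rho>. uniform_cone r0 S \<Longrightarrow> x \<in> frontier S \<Longrightarrow>
    0 < \<rho> \<Longrightarrow> \<rho> \<le> r0 \<Longrightarrow> ennreal (cl * \<rho> ^ (DIM('a) - 1)) \<le> hausdorff_outer (DIM('a) - 1) (frontier S \<inter> ball x \<rho>)"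
    by (rule hausdorff_outer_frontier_lower[OF d]) (rule that)
  define H where "H = diameter (closure \<Omega>) + 1"
  have clb: "bounded (closure \<Omega>)" by (rule bounded_closure[OF \<Omega>b])
  have H: "H > 0" using diameter_ge_0[OF clb] by (simp add: H_def)
  define C where "C = cut_mesh_est.splitting_const TYPE('a) \<sigma> k r0 \<gamma> Co Cu cl H"
  show thesis
  \<comment> \<open>The witness must be named and shown positive before a mesh is given, while
    \<open>splitting_const_pos\<close> is available only for an actual mesh. Hence the absolute
    value, which is removed again inside the locale.\<close>
  proof (rule that[of "2 + 3 * \<bar>C\<bar>"])
    fix \<T> \<Omega>1 and um uG :: "'a \<Rightarrow> real"
    assume adm: "admissible_configuration k \<sigma> \<Omega> D \<T> \<Omega>1"
      and u: "um \<in> V1_minus k \<Omega> \<T> \<Omega>1" "uG \<in> V1_Gamma k \<Omega> \<T> \<Omega>1"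
    have a: "triangulation_of \<T> \<Omega>" "shape_regular \<sigma> \<T>" "congruent_sets D \<Omega>1" "\<Omega>1 \<subseteq> \<Omega>"
      "mesh_nodes k \<T> \<inter> frontier \<Omega>1 = {}" using adm by (auto simp: admissible_configuration_def)
    have cone1: "uniform_cone r0 \<Omega>1" by (rule uniform_cone_congruent[OF coneD a(3)])
    obtain f c where f: "orthogonal_transformation f" "\<Omega>1 = (\<lambda>x. c + f x) ` D"
      using a(3) unfolding congruent_sets_def by blast
    have "open ((+) c ` (f ` D))"
      using f(1) D(1) by (intro open_translation open_surjective_linear_image)
        (auto simp: orthogonal_transformation_linear orthogonal_transformation_surj)
    then have open1: "open \<Omega>1" unfolding f(2) by (simp add: image_image)
    interpret cut_mesh \<T> \<Omega> \<sigma> k r0 \<Omega>1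
      by unfold_locales (use a \<Omega>r d k \<sigma> cone1 open1 in auto)
    interpret cut_mesh_est \<T> \<Omega> \<sigma> k r0 \<Omega>1 \<gamma> Co Cu cl H
    proof
      fix T assume T: "T \<in> \<T>"
      show "emeasure surface_measure (T \<inter> frontier \<Omega>1) \<le> ennreal (Cu * diameter T ^ (DIM('a) - 1))"
        by (rule Cu(2)[OF cone1 open1 a(4) elem_compact[OF T] diameter_pos[OF T]])
      have "T \<subseteq> closure \<Omega>" using T Un by blast
      from diameter_subset[OF this clb] show "diameter T \<le> H" by (simp add: H_def)
    next
      fix x \<rho> assume "x \<in> frontier \<Omega>1" "0 < \<rho>" "\<rho> \<le> r0"
      then show "ennreal (cl * \<rho> ^ (DIM('a) - 1)) \<le> emeasure surface_measure (frontier \<Omega>1 \<inter> ball x \<rho>)"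
        using cl(2)[OF cone1] emeasure_surface_measure[OF d] by simp
    next
      show "\<gamma> > 0" "Co > 0" "Cu > 0" "cl > 0" "H > 0" by fact+
      show "(p a - p b)\<^sup>2 * r ^ DIM('a) \<le> Co * (dist a b)\<^sup>2 * (LINT y:T|lborel. (norm (g y))\<^sup>2)"
        if "convex T" "compact T" "cball x0 r \<subseteq> T" "r > 0" "\<And>x. (p has_derivative (\<lambda>h. g x \<bullet> h)) (at x)"
          "\<And>b. b \<in> Basis \<Longrightarrow> (\<lambda>x. g x \<bullet> b) \<in> polynomials k" "a \<in> T" "b \<in> T"
        for T :: "'a set" and x0 r p g a b by (rule Co(2)[OF that])
    qed
    have "\<bar>C\<bar> = splitting_const" using splitting_const_pos by (simp add: C_def)
    then show "norm_b_sq \<gamma> \<T> \<Omega>1 (um, \<lambda>_. 0) + norm_b_sq \<gamma> \<T> \<Omega>1 (\<lambda>_. 0, uG) \<le> (2 + 3 * \<bar>C\<bar>) * norm_b_sq \<gamma> \<T> \<Omega>1 (um, uG) \<and>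
      norm_b_sq \<gamma> \<T> \<Omega>1 (um, uG) \<le> 2 * (norm_b_sq \<gamma> \<T> \<Omega>1 (um, \<lambda>_. 0) + norm_b_sq \<gamma> \<T> \<Omega>1 (\<lambda>_. 0, uG))"
      using splitting_estimates[OF u] by simp
  qed simp
qed

lemma zero_in_fun_span: "(\<lambda>_. 0) \<in> fun_span J f"
  unfolding fun_span_def by (auto intro!: exI[of _ "\<lambda>_. 0"])

theorem mainTheorem6:
  fixes \<Omega> D :: "'a::euclidean_space set"
    and k :: nat and \<sigma> \<gamma> \<beta> :: real
  assumes "DIM('a) = 2 \<or> DIM('a) = 3"
    and "k \<ge> 1"
    and "polygonal_domain \<Omega>"
    and "D \<noteq> {}" "open D" "connected D" "D \<subseteq> \<Omega>" "smooth_boundary D"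
    and "\<gamma> > 0" "\<beta> > 0" "\<sigma> > 0"
  shows "(\<exists>c1>0. \<exists>c2>0. \<forall>\<T> \<Omega>1. admissible_configuration k \<sigma> \<Omega> D \<T> \<Omega>1 \<longrightarrow>
      (\<forall>um \<in> V1_minus k \<Omega> \<T> \<Omega>1. \<forall>uG \<in> V1_Gamma k \<Omega> \<T> \<Omega>1.
        c1 * (norm_b_sq \<gamma> \<T> \<Omega>1 (um, \<lambda>_. 0) + norm_b_sq \<gamma> \<T> \<Omega>1 (\<lambda>_. 0, uG))
          \<le> norm_b_sq \<gamma> \<T> \<Omega>1 (um, uG) \<and>
        norm_b_sq \<gamma> \<T> \<Omega>1 (um, uG)
          \<le> c2 * (norm_b_sq \<gamma> \<T> \<Omega>1 (um, \<lambda>_. 0) + norm_b_sq \<gamma> \<T> \<Omega>1 (\<lambda>_. 0, uG))))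
    \<and>
    (\<forall>a1>0. \<forall>a2>0. \<exists>c1>0. \<exists>c2>0. \<forall>\<T> \<Omega>1 \<F>.
      admissible_configuration k \<sigma> \<Omega> D \<T> \<Omega>1 \<and> \<F> \<subseteq> ghost_faces \<T> \<Omega>1 \<and>
      (\<forall>um \<in> V1_minus k \<Omega> \<T> \<Omega>1. \<forall>uG \<in> V1_Gamma k \<Omega> \<T> \<Omega>1.
        a1 * norm_b_sq \<gamma> \<T> \<Omega>1 (um, uG)
          \<le> A_FD k \<gamma> \<beta> \<T> \<Omega>1 \<F> (L1 (um, uG)) (L1 (um, uG)) \<and>
        A_FD k \<gamma> \<beta> \<T> \<Omega>1 \<F> (L1 (um, uG)) (L1 (um, uG))
          \<le> a2 * norm_b_sq \<gamma> \<T> \<Omega>1 (um, uG))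
      \<longrightarrow>
      (\<forall>um \<in> V1_minus k \<Omega> \<T> \<Omega>1. \<forall>uG \<in> V1_Gamma k \<Omega> \<T> \<Omega>1.
        c1 * (norm_a_sq k \<gamma> \<beta> \<T> \<Omega>1 \<F> (um, \<lambda>_. 0) + norm_a_sq k \<gamma> \<beta> \<T> \<Omega>1 \<F> (\<lambda>_. 0, uG))
          \<le> norm_a_sq k \<gamma> \<beta> \<T> \<Omega>1 \<F> (um, uG) \<and>
        norm_a_sq k \<gamma> \<beta> \<T> \<Omega>1 \<F> (um, uG)
          \<le> c2 * (norm_a_sq k \<gamma> \<beta> \<T> \<Omega>1 \<F> (um, \<lambda>_. 0) + norm_a_sq k \<gamma> \<beta> \<T> \<Omega>1 \<F> (\<lambda>_. 0, uG))))"
proof -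
  have d: "DIM('a) \<ge> 2" using assms(1) by auto
  obtain c where c: "c > 0" and split: "\<And>\<T> \<Omega>1 um uG. admissible_configuration k \<sigma> \<Omega> D \<T> \<Omega>1 \<Longrightarrow>
      um \<in> V1_minus k \<Omega> \<T> \<Omega>1 \<Longrightarrow> uG \<in> V1_Gamma k \<Omega> \<T> \<Omega>1 \<Longrightarrow>
      norm_b_sq \<gamma> \<T> \<Omega>1 (um, \<lambda>_. 0) + norm_b_sq \<gamma> \<T> \<Omega>1 (\<lambda>_. 0, uG) \<le> c * norm_b_sq \<gamma> \<T> \<Omega>1 (um, uG) \<and>
      norm_b_sq \<gamma> \<T> \<Omega>1 (um, uG) \<le> 2 * (norm_b_sq \<gamma> \<T> \<Omega>1 (um, \<lambda>_. 0) + norm_b_sq \<gamma> \<T> \<Omega>1 (\<lambda>_. 0, uG))"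
    by (rule b_norm_splitting[OF d assms(2,3,5,7,8,9,11)]) (rule that)
  show ?thesis
  proof (rule conjI, goal_cases)
    case 1
    show ?case
    proof (rule exI[of _ "1 / c"], rule conjI, use c in simp, rule exI[of _ 2], rule conjI, simp, intro allI impI ballI conjI)
      fix \<T> \<Omega>1 and um uG :: "'a \<Rightarrow> real"
      assume "admissible_configuration k \<sigma> \<Omega> D \<T> \<Omega>1" "um \<in> V1_minus k \<Omega> \<T> \<Omega>1" "uG \<in> V1_Gamma k \<Omega> \<T> \<Omega>1"
      note s = split[OF this]
      show "1 / c * (norm_b_sq \<gamma> \<T> \<Omega>1 (um, \<lambda>_. 0) + norm_b_sq \<gamma> \<T> \<Omega>1 (\<lambda>_. 0, uG)) \<le> norm_b_sq \<gamma> \<T> \<Omega>1 (um, uG)"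
        using s c by (simp add: divide_le_eq mult.commute)
      show "norm_b_sq \<gamma> \<T> \<Omega>1 (um, uG) \<le> 2 * (norm_b_sq \<gamma> \<T> \<Omega>1 (um, \<lambda>_. 0) + norm_b_sq \<gamma> \<T> \<Omega>1 (\<lambda>_. 0, uG))"
        using s by simp
    qed
  next
    case 2
    show ?case
    proof (intro allI impI)
      fix a1 a2 :: real assume a: "a1 > 0" "a2 > 0"
      show "\<exists>c1>0. \<exists>c2>0. \<forall>\<T> \<Omega>1 \<F>.
      admissible_configuration k \<sigma> \<Omega> D \<T> \<Omega>1 \<and> \<F> \<subseteq> ghost_faces \<T> \<Omega>1 \<and>
      (\<forall>um \<in> V1_minus k \<Omega> \<T> \<Omega>1. \<forall>uG \<in> V1_Gamma k \<Omega> \<T> \<Omega>1.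
        a1 * norm_b_sq \<gamma> \<T> \<Omega>1 (um, uG)
          \<le> A_FD k \<gamma> \<beta> \<T> \<Omega>1 \<F> (L1 (um, uG)) (L1 (um, uG)) \<and>
        A_FD k \<gamma> \<beta> \<T> \<Omega>1 \<F> (L1 (um, uG)) (L1 (um, uG))
          \<le> a2 * norm_b_sq \<gamma> \<T> \<Omega>1 (um, uG))
      \<longrightarrow>
      (\<forall>um \<in> V1_minus k \<Omega> \<T> \<Omega>1. \<forall>uG \<in> V1_Gamma k \<Omega> \<T> \<Omega>1.
        c1 * (norm_a_sq k \<gamma> \<beta> \<T> \<Omega>1 \<F> (um, \<lambda>_. 0) + norm_a_sq k \<gamma> \<beta> \<T> \<Omega>1 \<F> (\<lambda>_. 0, uG))
          \<le> norm_a_sq k \<gamma> \<beta> \<T> \<Omega>1 \<F> (um, uG) \<and>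
        norm_a_sq k \<gamma> \<beta> \<T> \<Omega>1 \<F> (um, uG)
          \<le> c2 * (norm_a_sq k \<gamma> \<beta> \<T> \<Omega>1 \<F> (um, \<lambda>_. 0) + norm_a_sq k \<gamma> \<beta> \<T> \<Omega>1 \<F> (\<lambda>_. 0, uG)))"
      \<comment> \<open>In the lower bound the parts pass to the b-norm with \<open>a2\<close> and
        the sum returns with \<open>a1\<close>; in the upper bound the roles of parts and sum are
        exchanged. The factors \<open>c\<close> and 2 are those of the b-norm.\<close>
      proof (rule exI[of _ "a1 / (a2 * c)"], rule conjI, use a c in simp, rule exI[of _ "2 * a2 / a1"], rule conjI,
          use a in simp, intro allI impI ballI conjI)
        fix \<T> \<Omega>1 \<F> and um uG :: "'a \<Rightarrow> real"
        assume asm: "admissible_configuration k \<sigma> \<Omega> D \<T> \<Omega>1 \<and> \<F> \<subseteq> ghost_faces \<T> \<Omega>1 \<and>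
          (\<forall>um \<in> V1_minus k \<Omega> \<T> \<Omega>1. \<forall>uG \<in> V1_Gamma k \<Omega> \<T> \<Omega>1.
            a1 * norm_b_sq \<gamma> \<T> \<Omega>1 (um, uG)
              \<le> A_FD k \<gamma> \<beta> \<T> \<Omega>1 \<F> (L1 (um, uG)) (L1 (um, uG)) \<and>
            A_FD k \<gamma> \<beta> \<T> \<Omega>1 \<F> (L1 (um, uG)) (L1 (um, uG))
              \<le> a2 * norm_b_sq \<gamma> \<T> \<Omega>1 (um, uG))"
          and u: "um \<in> V1_minus k \<Omega> \<T> \<Omega>1" "uG \<in> V1_Gamma k \<Omega> \<T> \<Omega>1"
        let ?a = "norm_a_sq k \<gamma> \<beta> \<T> \<Omega>1 \<F>" and ?b = "norm_b_sq \<gamma> \<T> \<Omega>1"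
        have eqv: "a1 * ?b (v, w) \<le> ?a (v, w) \<and> ?a (v, w) \<le> a2 * ?b (v, w)"
          if "v \<in> V1_minus k \<Omega> \<T> \<Omega>1" "w \<in> V1_Gamma k \<Omega> \<T> \<Omega>1" for v w
          using asm that unfolding norm_a_sq_def by blast
        have z: "(\<lambda>_. 0) \<in> V1_minus k \<Omega> \<T> \<Omega>1" "(\<lambda>_. 0) \<in> V1_Gamma k \<Omega> \<T> \<Omega>1"
          unfolding V1_minus_def V1_Gamma_def by (rule zero_in_fun_span)+
        note e = eqv[OF u] eqv[OF u(1) z(2)] eqv[OF z(1) u(2)]
        have s: "?b (um, \<lambda>_. 0) + ?b (\<lambda>_. 0, uG) \<le> c * ?b (um, uG)"
          "?b (um, uG) \<le> 2 * (?b (um, \<lambda>_. 0) + ?b (\<lambda>_. 0, uG))"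
          using split[OF _ u] asm by auto
        have "a1 * (?a (um, \<lambda>_. 0) + ?a (\<lambda>_. 0, uG)) \<le> a1 * (a2 * (?b (um, \<lambda>_. 0) + ?b (\<lambda>_. 0, uG)))"
          using a e by (intro mult_left_mono) (auto simp: distrib_left)
        also have "\<dots> \<le> a1 * (a2 * (c * ?b (um, uG)))" using a s by (intro mult_left_mono) auto
        also have "\<dots> = (a2 * c) * (a1 * ?b (um, uG))" by simp
        also have "\<dots> \<le> (a2 * c) * ?a (um, uG)" using a c e by (intro mult_left_mono) auto
        finally show "a1 / (a2 * c) * (?a (um, \<lambda>_. 0) + ?a (\<lambda>_. 0, uG)) \<le> ?a (um, uG)"
          using a c by (simp add: divide_le_eq mult.commute)
        have "a1 * ?a (um, uG) \<le> a1 * (a2 * (2 * (?b (um, \<lambda>_. 0) + ?b (\<lambda>_. 0, uG))))"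
          using a e s by (intro mult_left_mono order_trans[OF conjunct2[OF eqv[OF u]]]) auto
        also have "\<dots> = 2 * a2 * (a1 * ?b (um, \<lambda>_. 0) + a1 * ?b (\<lambda>_. 0, uG))" by (simp add: algebra_simps)
        also have "\<dots> \<le> 2 * a2 * (?a (um, \<lambda>_. 0) + ?a (\<lambda>_. 0, uG))" using a e by (intro mult_left_mono add_mono) auto
        finally show "?a (um, uG) \<le> 2 * a2 / a1 * (?a (um, \<lambda>_. 0) + ?a (\<lambda>_. 0, uG))"
          using a by (simp add: field_simps)
      qed
    qed
  qed
qed

end
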